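(* Let $\Bbbk$ be a field of characteristic zero, let $v\in\Bbbk$ be transcendental over $\mathbb{Q}$, and let $P_1,P_2\in\Bbbk[z]$ be monic polynomials of degrees $d_1,d_2$ with $P_1(0)=1=P_2(0)$ and $d_1d_2\ge4$. Let $Z_m$ ($m\in\mathbb{Z}$) be the quantum generalized cluster variables $Z_m:=Z_m^{(3)}$. (a) For $m\ge3$, $$Z_m=\sum_{\omega}p_\omega\, v^{1-u_{m-2,1}-u_{m-3,2}+\gamma_\omega+\beta_\omega}\,Z^{(-u_{m-2,1}+|\omega|_V,\,-u_{m-3,2}+|\omega|_H)},$$ where the sum ranges over all $(d_1,d_2)$-bounded compatible gradings $\omega:E_{m-2}\to\mathbb{Z}_{\ge0}$ of $D_{m-2}$; $p_\omega=\prod_{h\in H_{m-2}}p_{1,\omega(h)}\prod_{w\in V_{m-2}}p_{2,d_2-\omega(w)}$; $\gamma_\omega=\sum_{e<e'\in E_{m-2}}\gamma_\omega(e,e')$ with $$\gamma_\omega(e,e')=\begin{cases}0&\text{if } e\in H_{m-2}\setminus\mathrm{supp}(\omega_H)\text{ or }e'\in V_{m-2}\setminus\mathrm{supp}(\omega_V);\\-2\omega(e)\omega(e')&\text{if }e\in\mathrm{supp}(\omega_H)\text{ and }e'\in\mathrm{supp}(\omega_V);\\2\omega(e)&\text{if }e\in\mathrm{supp}(\omega_H)\text{ and }e'\in H_{m-2};\\2\omega(e')&\text{if }e\in V_{m-2}\text{ and }e'\in\mathrm{supp}(\omega_V);\\-2&\text{if }e\in V_{m-2}\text{ and }e'\in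 H_{m-2};\end{cases}$$ and $\beta_\omega=\sum_{e<e'\in E_{m-2}}\beta_\omega(e,e')$ with $\beta_\omega(e,e')=\omega(e)\omega(e')+1$ if one of $e,e'$ is in $H_{m-2}$ and the other in $V_{m-2}$, and $\beta_\omega(e,e')=-(\omega(e)+\omega(e'))$ if $e,e'\in H_{m-2}$ or $e,e'\in V_{m-2}$. (b) For $m\le0$, $$Z_m=\sum_{\omega}p'_\omega\, v^{-1+u'_{-m+1,1}+u'_{-m,2}+\gamma'_\omega+\beta'_\omega}\,Z^{(-u'_{-m,2}+|\omega|_{H'},\,-u'_{-m+1,1}+|\omega|_{V'})},$$ where the sum ranges over all $(d_2,d_1)$-bounded compatible gradings $\omega:E'_{-m+1}\to\mathbb{Z}_{\ge0}$ of $D'_{-m+1}$; $p'_\omega=\prod_{h\in H'_{-m+1}}p_{2,d_2-\omega(h)}\prod_{w\in V'_{-m+1}}p_{1,\omega(w)}$; $\gamma'_\omega=\sum_{e<e'\in E'_{-m+1}}\gamma'_\omega(e,e')$ with $$\gamma'_\omega(e,e')=\begin{cases}0&\text{if }e\in V'_{-m+1}\setminus\mathrm{supp}(\omega_{V'})\text{ or }e'\in H'_{-m+1}\setminus\mathrm{supp}(\omega_{H'});\\-2\omega(e)\omega(e')&\text{if }e\in\mathrm{supp}(\omega_{V'})\text{ and }e'\in\mathrm{supp}(\omega_{H'});\\2\omega(e)&\text{if }e\in\mathrm{supp}(\omega_{V'})\text{ and }e'\in V'_{-m+1};\\2\omega(e')&\text{if }e\in H'_{-m+1}\text{ and }e'\in\mathrm{supp}(\omega_{H'});\\-2&\text{if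 }e\in H'_{-m+1}\text{ and }e'\in V'_{-m+1};\end{cases}$$ and $\beta'_\omega=\sum_{e<e'\in E'_{-m+1}}\beta'_\omega(e,e')$ with $\beta'_\omega(e,e')=\omega(e)\omega(e')+1$ if one of $e,e'$ is in $H'_{-m+1}$ and the other in $V'_{-m+1}$, and $\beta'_\omega(e,e')=-(\omega(e)+\omega(e'))$ if $e,e'\in H'_{-m+1}$ or $e,e'\in V'_{-m+1}$.
   Context: Polynomials: $P_i(z)=\sum_{j=0}^{d_i}p_{i,j}z^j$ and $\bar P_i(z)=z^{d_i}P_i(z^{-1})$ for $i=1,2$; for $k\in\mathbb{Z}$, $P_k$ is $\bar P_2,P_1,P_2,\bar P_1$ according to $k\equiv0,1,2,3$ modulo $4$, and $d_k=d_1$ for $k$ odd, $d_k=d_2$ for $k$ even. Quantum torus: $\mathcal{T}$ is the $\Bbbk$-algebra generated by $Z_1^{\pm1},Z_2^{\pm1}$ with $Z_1Z_2=v^2Z_2Z_1$, $\mathcal{F}$ its skew-field of fractions, and $Z^{(a_1,a_2)}:=v^{-a_1a_2}Z_1^{a_1}Z_2^{a_2}$ for $(a_1,a_2)\in\mathbb{Z}^2$. For $\alpha\in\mathbb{Z}$ the elements $Z_k^{(\alpha)}\in\mathcal{F}$, $k\in\mathbb{Z}$, are defined recursively by $Z_1^{(\alpha)}=Z_1$, $Z_2^{(\alpha)}=Z_2$, $Z_{k-1}^{(\alpha)}Z_{k+1}^{(\alpha)}=P_{\alpha+k}(vZ_k^{(\alpha)})$. Chebyshev polynomials: $u_{m,k}$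 ($m,k\in\mathbb{Z}$) are defined by $u_{0,k}=0$, $u_{1,k}=1$, $u_{m+1,k+1}=d_ku_{m,k}-u_{m-1,k-1}$. Put $u'_{m,1}=u_{m,2}$ and $u'_{m,2}=u_{m,1}$ (these are the same quantities with $d_1,d_2$ interchanged). Maximal Dyck paths: for $\mathbf a=(a_1,a_2)\in\mathbb{Z}_{\ge0}^2$, $D_{\mathbf a}$ is the lattice path from $(0,0)$ to $(a_1,a_2)$ with unit East and North steps that never passes strictly above the main diagonal of $[0,a_1]\times[0,a_2]$ and is maximal with this property (every lattice point strictly above the path is strictly above the diagonal). Edges are totally ordered along the path. For $m\ge1$, $D_m=D_{(u_{m,1},u_{m-1,2})}$ with edge set $E_m=H_m\sqcup V_m$ (horizontal and vertical edges), and $D'_m=D_{(u'_{m,1},u'_{m-1,2})}$ with edge set $E'_m=H'_m\sqcup V'_m$. For edges $e\le e'$, $ee'$ is the subpath from $e$ to $e'$ inclusive; $(ee')_H,(ee')_V$ are its sets of horizontal and vertical edges, $|ee'|_H,|ee'|_V$ their cardinalities. Gradings: a grading of a path with edge set $E=H\sqcup V$ is a map $\omega:E\to\mathbb{Z}_{\ge0}$. It is $(b_1,b_2)$-bounded if $\omega\le b_1$ on horizontal edges and $\omega\le b_2$ on vertical edges. It is compatible if for all $h\in H$, $w\in V$ with $h<w$ there is an edge $e$ of the path $hw$ such that either $e\ne w$ and $|he|_V=\sum_{h'\in(he)_H}\omega(h')$, or $e\ne h$ and $|ew|_H=\sum_{w'\in(ew)_V}\omega(w')$. $\omega_H,\omega_V$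 are the restrictions of $\omega$ to horizontal and vertical edges ($\omega_{H'},\omega_{V'}$ for $D'_m$); $\mathrm{supp}$ is the set of edges with nonzero value; $|\omega|_H,|\omega|_V$ (resp. $|\omega|_{H'},|\omega|_{V'}$) are the sums of $\omega$ over all horizontal, resp. vertical edges. *)

theory Defs
  imports
    "HOL-Computational_Algebra.Polynomial"
    "HOL-Library.Poly_Mapping"
    "HOL-Library.FuncSet"
begin

section \<open>The quantum torus and its skew-field of fractions\<close>

datatype torus_letter = X1 | X1i | X2 | X2i

text \<open>
  Elements of the free algebra over \<open>'k\<close> on the four letters are finitely supported functions
  \<open>torus_letter list \<Rightarrow>\<^sub>0 'k\<close> on words.  A triple \<open>(l, r, c)\<close> stands for the relation \<open>l = c r\<close>.
\<close>

definition torus_relations ::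
    "'k::field \<Rightarrow> (torus_letter list \<times> torus_letter list \<times> 'k) set" where
  "torus_relations v =
     {([X1, X1i], [], 1), ([X1i, X1], [], 1), ([X2, X2i], [], 1), ([X2i, X2], [], 1),
      ([X1, X2], [X2, X1], v\<^sup>2)}"

text \<open>The two-sided ideal of the free algebra generated by the relations.\<close>

inductive_set torus_ideal :: "'k::field \<Rightarrow> (torus_letter list \<Rightarrow>\<^sub>0 'k) set" for v where
  zero: "0 \<in> torus_ideal v"
| add: "f \<in> torus_ideal v \<Longrightarrow> g \<in> torus_ideal v \<Longrightarrow> f + g \<in> torus_ideal v"
| rel: "(l, r, c) \<in> torus_relations v \<Longrightarrow>
    Poly_Mapping.single (x @ l @ y) a - Poly_Mapping.single (x @ r @ y) (a * c) \<in> torus_ideal v"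

fun letter_value :: "'f::division_ring \<Rightarrow> 'f \<Rightarrow> torus_letter \<Rightarrow> 'f" where
  "letter_value Z1 Z2 X1 = Z1"
| "letter_value Z1 Z2 X1i = inverse Z1"
| "letter_value Z1 Z2 X2 = Z2"
| "letter_value Z1 Z2 X2i = inverse Z2"

definition free_eval ::
    "('k::field \<Rightarrow> 'f::division_ring) \<Rightarrow> 'f \<Rightarrow> 'f \<Rightarrow> (torus_letter list \<Rightarrow>\<^sub>0 'k) \<Rightarrow> 'f" where
  "free_eval \<iota> Z1 Z2 f =
     (\<Sum>w\<in>Poly_Mapping.keys f.
        \<iota> (Poly_Mapping.lookup f w) * prod_list (map (letter_value Z1 Z2) w))"

text \<open>
  The type \<open>'f\<close> is the skew-field of fractions of the quantum torus over \<open>'k\<close>: it is a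
  \<open>'k\<close>-algebra via the central embedding \<open>\<iota>\<close>; the subalgebra generated by \<open>Z1\<^sup>\<plusminus>\<^sup>1, Z2\<^sup>\<plusminus>\<^sup>1\<close>, i.e. the
  range of \<open>free_eval\<close>, is the free algebra modulo exactly the defining relations; and every
  element is a fraction of two elements of that subalgebra.
\<close>

locale quantum_torus_fractions =
  fixes v :: "'k::field" and \<iota> :: "'k \<Rightarrow> 'f::division_ring" and Z1 Z2 :: 'f
  assumes scalar_one: "\<iota> 1 = 1"
    and scalar_add: "\<iota> (a + b) = \<iota> a + \<iota> b"
    and scalar_mult: "\<iota> (a * b) = \<iota> a * \<iota> b"
    and scalar_central: "\<iota> a * x = x * \<iota> a"
    and presentation: "free_eval \<iota> Z1 Z2 f = 0 \<longleftrightarrow> f \<in> torus_ideal v"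
    and fraction: "\<exists>f g. free_eval \<iota> Z1 Z2 g \<noteq> 0 \<and>
                     x = free_eval \<iota> Z1 Z2 f * inverse (free_eval \<iota> Z1 Z2 g)"

definition torus_monomial ::
    "'k::field \<Rightarrow> ('k \<Rightarrow> 'f::division_ring) \<Rightarrow> 'f \<Rightarrow> 'f \<Rightarrow> int \<times> int \<Rightarrow> 'f" where
  "torus_monomial v \<iota> Z1 Z2 = (\<lambda>(a1, a2). \<iota> (v powi (- a1 * a2)) * Z1 powi a1 * Z2 powi a2)"


section \<open>Quantum generalized cluster variables\<close>

definition exchange_poly :: "'k::field poly \<Rightarrow> 'k poly \<Rightarrow> int \<Rightarrow> 'k poly" where
  "exchange_poly P1 P2 k =
     (if k mod 4 = 0 then reflect_poly P2
      else if k mod 4 = 1 then P1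
      else if k mod 4 = 2 then P2
      else reflect_poly P1)"

text \<open>\<^const>\<open>poly\<close> is restricted to commutative rings.\<close>

definition nc_eval :: "('k::field \<Rightarrow> 'f::division_ring) \<Rightarrow> 'k poly \<Rightarrow> 'f \<Rightarrow> 'f" where
  "nc_eval \<iota> P x = (\<Sum>j\<le>degree P. \<iota> (coeff P j) * x ^ j)"

text \<open>
  The recursion \<open>Z\<^bsub>k-1\<^esub> Z\<^bsub>k+1\<^esub> = P\<^bsub>\<alpha>+k\<^esub>(v Z\<^bsub>k\<^esub>)\<close>, solved for \<open>Z\<^bsub>k+1\<^esub>\<close> when moving up from \<open>Z\<^sub>1, Z\<^sub>2\<close> and
  for \<open>Z\<^bsub>k-1\<^esub>\<close> when moving down; see \<open>cluster_var_exchange\<close> and \<open>cluster_var_unique\<close>.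
\<close>

function cluster_var ::
    "'k::field \<Rightarrow> ('k \<Rightarrow> 'f::division_ring) \<Rightarrow> 'f \<Rightarrow> 'f \<Rightarrow> 'k poly \<Rightarrow> 'k poly \<Rightarrow> int \<Rightarrow> int \<Rightarrow> 'f" where
  "cluster_var v \<iota> Z1 Z2 P1 P2 \<alpha> k =
     (if k = 1 then Z1
      else if k = 2 then Z2
      else if k > 2 then
        inverse (cluster_var v \<iota> Z1 Z2 P1 P2 \<alpha> (k - 2)) *
        nc_eval \<iota> (exchange_poly P1 P2 (\<alpha> + (k - 1)))
          (\<iota> v * cluster_var v \<iota> Z1 Z2 P1 P2 \<alpha> (k - 1))
      else
        nc_eval \<iota> (exchange_poly P1 P2 (\<alpha> + (k + 1)))
          (\<iota> v * cluster_var v \<iota> Z1 Z2 P1 P2 \<alpha> (k + 1)) *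
        inverse (cluster_var v \<iota> Z1 Z2 P1 P2 \<alpha> (k + 2)))"
  by pat_completeness auto
termination
  by (relation "measure (\<lambda>(_, _, _, _, _, _, _, k). nat \<bar>2 * k - 3\<bar>)") auto

declare cluster_var.simps [simp del]

lemma cluster_var_exchange:
  assumes "k \<ge> 2 \<Longrightarrow> cluster_var v \<iota> Z1 Z2 P1 P2 \<alpha> (k - 1) \<noteq> 0"
    and "k \<le> 1 \<Longrightarrow> cluster_var v \<iota> Z1 Z2 P1 P2 \<alpha> (k + 1) \<noteq> 0"
  shows "cluster_var v \<iota> Z1 Z2 P1 P2 \<alpha> (k - 1) * cluster_var v \<iota> Z1 Z2 P1 P2 \<alpha> (k + 1) =
    nc_eval \<iota> (exchange_poly P1 P2 (\<alpha> + k)) (\<iota> v * cluster_var v \<iota> Z1 Z2 P1 P2 \<alpha> k)"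
proof (cases "k \<ge> 2")
  case True
  have "cluster_var v \<iota> Z1 Z2 P1 P2 \<alpha> (k + 1) =
      inverse (cluster_var v \<iota> Z1 Z2 P1 P2 \<alpha> (k - 1)) *
      nc_eval \<iota> (exchange_poly P1 P2 (\<alpha> + k)) (\<iota> v * cluster_var v \<iota> Z1 Z2 P1 P2 \<alpha> k)"
    using True by (subst cluster_var.simps) (simp add: algebra_simps)
  then show ?thesis
    using assms(1)[OF True] by (simp flip: mult.assoc)
next
  case False
  have "cluster_var v \<iota> Z1 Z2 P1 P2 \<alpha> (k - 1) =
      nc_eval \<iota> (exchange_poly P1 P2 (\<alpha> + k)) (\<iota> v * cluster_var v \<iota> Z1 Z2 P1 P2 \<alpha> k) *
      inverse (cluster_var v \<iota> Z1 Z2 P1 P2 \<alpha> (k + 1))"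
    using False by (subst cluster_var.simps) (simp add: algebra_simps)
  then show ?thesis
    using assms(2) False by (simp add: mult.assoc)
qed

lemma cluster_var_unique:
  assumes "Z 1 = Z1" "Z 2 = Z2" and nz: "\<And>k. Z k \<noteq> 0"
    and rec: "\<And>k. Z (k - 1) * Z (k + 1) = nc_eval \<iota> (exchange_poly P1 P2 (\<alpha> + k)) (\<iota> v * Z k)"
  shows "cluster_var v \<iota> Z1 Z2 P1 P2 \<alpha> k = Z k"
proof (induction "nat \<bar>2 * k - 3\<bar>" arbitrary: k rule: less_induct)
  case less
  consider "k = 1" | "k = 2" | "k > 2" | "k < 1" by linarith
  then show ?case
  proof cases
    case 3
    have "cluster_var v \<iota> Z1 Z2 P1 P2 \<alpha> (k - 2) = Z (k - 2)"
      "cluster_var v \<iota> Z1 Z2 P1 P2 \<alpha> (k - 1) = Z (k - 1)"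
      using 3 by (auto intro!: less)
    moreover have "nc_eval \<iota> (exchange_poly P1 P2 (\<alpha> + (k - 1))) (\<iota> v * Z (k - 1)) =
        Z (k - 2) * Z k"
      using rec[of "k - 1"] by simp
    ultimately show ?thesis
      using 3 nz by (subst cluster_var.simps) (simp flip: mult.assoc)
  next
    case 4
    have "cluster_var v \<iota> Z1 Z2 P1 P2 \<alpha> (k + 2) = Z (k + 2)"
      "cluster_var v \<iota> Z1 Z2 P1 P2 \<alpha> (k + 1) = Z (k + 1)"
      using 4 by (auto intro!: less)
    moreover have "nc_eval \<iota> (exchange_poly P1 P2 (\<alpha> + (k + 1))) (\<iota> v * Z (k + 1)) =
        Z k * Z (k + 2)"
      using rec[of "k + 1"] by (simp add: add.commute)
    ultimately show ?thesis
      using 4 nz by (subst cluster_var.simps) (simp add: mult.assoc)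
  qed (use assms in \<open>simp_all add: cluster_var.simps\<close>)
qed


section \<open>Chebyshev polynomials\<close>

text \<open>
  \<open>cheb d1 d2 m k\<close> is \<open>u\<^bsub>m,k\<^esub>\<close>; the recursion is run downwards for negative \<open>m\<close>, see \<open>cheb_rec\<close>.
\<close>

function cheb :: "nat \<Rightarrow> nat \<Rightarrow> int \<Rightarrow> int \<Rightarrow> int" where
  "cheb d1 d2 m k =
     (if m = 0 then 0
      else if m = 1 then 1
      else if m > 1 then
        int (if odd (k - 1) then d1 else d2) * cheb d1 d2 (m - 1) (k - 1) - cheb d1 d2 (m - 2) (k - 2)
      else
        int (if odd (k + 1) then d1 else d2) * cheb d1 d2 (m + 1) (k + 1) - cheb d1 d2 (m + 2) (k + 2))"
  by pat_completeness auto
termination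
  by (relation "measure (\<lambda>(_, _, m, _). nat \<bar>2 * m - 1\<bar>)") auto

declare cheb.simps [simp del]

lemma cheb_rec:
  "cheb d1 d2 (m + 1) (k + 1) =
     int (if odd k then d1 else d2) * cheb d1 d2 m k - cheb d1 d2 (m - 1) (k - 1)"
proof (cases "m \<ge> 1")
  case True
  then show ?thesis
    by (subst (1) cheb.simps) auto
next
  case False
  then have "cheb d1 d2 (m - 1) (k - 1) =
      int (if odd k then d1 else d2) * cheb d1 d2 m k - cheb d1 d2 (m + 1) (k + 1)"
    by (subst (1) cheb.simps) (auto simp: add.commute)
  then show ?thesis
    by simp
qed

text \<open>\<open>u'\<^bsub>m,k\<^esub>\<close> for \<open>k \<in> {1, 2}\<close>: the reflection \<open>k \<mapsto> 3 - k\<close> interchanges the second indices 1 and 2.\<close>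

definition cheb' :: "nat \<Rightarrow> nat \<Rightarrow> int \<Rightarrow> int \<Rightarrow> int" where
  "cheb' d1 d2 m k = cheb d1 d2 m (3 - k)"


section \<open>Maximal Dyck paths\<close>

datatype step = East | North

definition path_points :: "step list \<Rightarrow> (nat \<times> nat) set" where
  "path_points D = {(count_list (take i D) East, count_list (take i D) North) | i. i \<le> length D}"

text \<open>The main diagonal of the rectangle \<open>[0, a1] \<times> [0, a2]\<close>, without dividing by \<open>a1\<close>.\<close>

definition above_diagonal :: "nat \<Rightarrow> nat \<Rightarrow> nat \<times> nat \<Rightarrow> bool" where
  "above_diagonal a1 a2 = (\<lambda>(x, y). a1 * y > a2 * x)"

definition above_path :: "step list \<Rightarrow> nat \<times> nat \<Rightarrow> bool" where
  "above_path D = (\<lambda>(x, y). \<forall>y'. (x, y') \<in> path_points D \<longrightarrow> y' < y)"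

definition is_maximal_dyck_path :: "nat \<Rightarrow> nat \<Rightarrow> step list \<Rightarrow> bool" where
  "is_maximal_dyck_path a1 a2 D \<longleftrightarrow>
     count_list D East = a1 \<and> count_list D North = a2 \<and>
     (\<forall>p\<in>path_points D. \<not> above_diagonal a1 a2 p) \<and>
     (\<forall>p\<in>{0..a1} \<times> {0..a2}. above_path D p \<longrightarrow> above_diagonal a1 a2 p)"

definition dyck_path :: "nat \<Rightarrow> nat \<Rightarrow> step list" where
  "dyck_path a1 a2 = (THE D. is_maximal_dyck_path a1 a2 D)"

text \<open>
  Edges of a path are identified with their positions \<open>0, \<dots>, length D - 1\<close> along it, so that
  the subpath \<open>e e'\<close> is \<open>{e..e'}\<close>.
\<close>

definition hor_edges :: "step list \<Rightarrow> nat set" where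
  "hor_edges D = {i. i < length D \<and> D ! i = East}"

definition ver_edges :: "step list \<Rightarrow> nat set" where
  "ver_edges D = {i. i < length D \<and> D ! i = North}"


section \<open>Compatible gradings\<close>

definition bounded_grading :: "nat \<Rightarrow> nat \<Rightarrow> step list \<Rightarrow> (nat \<Rightarrow> nat) \<Rightarrow> bool" where
  "bounded_grading b1 b2 D \<omega> \<longleftrightarrow>
     (\<forall>h\<in>hor_edges D. \<omega> h \<le> b1) \<and> (\<forall>w\<in>ver_edges D. \<omega> w \<le> b2)"

definition compatible_grading :: "step list \<Rightarrow> (nat \<Rightarrow> nat) \<Rightarrow> bool" where
  "compatible_grading D \<omega> \<longleftrightarrow>
     (\<forall>h\<in>hor_edges D. \<forall>w\<in>ver_edges D. h < w \<longrightarrow>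
        (\<exists>e\<in>{h..w}.
           e \<noteq> w \<and> card ({h..e} \<inter> ver_edges D) = (\<Sum>h'\<in>{h..e} \<inter> hor_edges D. \<omega> h') \<or>
           e \<noteq> h \<and> card ({e..w} \<inter> hor_edges D) = (\<Sum>w'\<in>{e..w} \<inter> ver_edges D. \<omega> w')))"

definition compatible_gradings :: "nat \<Rightarrow> nat \<Rightarrow> step list \<Rightarrow> (nat \<Rightarrow> nat) set" where
  "compatible_gradings b1 b2 D =
     {\<omega> \<in> {..<length D} \<rightarrow>\<^sub>E UNIV. bounded_grading b1 b2 D \<omega> \<and> compatible_grading D \<omega>}"

text \<open>
  In the two weights below, \<open>H\<close> and \<open>V\<close> are the horizontal and vertical edges for variables with
  positive index.  For those with nonpositive index the roles of horizontal and vertical edges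
  in \<open>\<gamma>\<close> are interchanged.
\<close>

definition gamma_pair :: "nat set \<Rightarrow> nat set \<Rightarrow> (nat \<Rightarrow> nat) \<Rightarrow> nat \<Rightarrow> nat \<Rightarrow> int" where
  "gamma_pair H V \<omega> e e' =
     (if e \<in> H \<and> \<omega> e = 0 \<or> e' \<in> V \<and> \<omega> e' = 0 then 0
      else if e \<in> H \<and> e' \<in> V then - 2 * int (\<omega> e) * int (\<omega> e')
      else if e \<in> H \<and> e' \<in> H then 2 * int (\<omega> e)
      else if e \<in> V \<and> e' \<in> V then 2 * int (\<omega> e')
      else - 2)"

definition gamma_weight :: "nat set \<Rightarrow> nat set \<Rightarrow> (nat \<Rightarrow> nat) \<Rightarrow> int" where
  "gamma_weight H V \<omega> =
     (\<Sum>(e, e')\<in>{(e, e'). e \<in> H \<union> V \<and> e' \<in> H \<union> V \<and> e < e'}. gamma_pair H V \<omega> e e')"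

definition beta_pair :: "nat set \<Rightarrow> nat set \<Rightarrow> (nat \<Rightarrow> nat) \<Rightarrow> nat \<Rightarrow> nat \<Rightarrow> int" where
  "beta_pair H V \<omega> e e' =
     (if e \<in> H \<and> e' \<in> V \<or> e \<in> V \<and> e' \<in> H then int (\<omega> e) * int (\<omega> e') + 1
      else - (int (\<omega> e) + int (\<omega> e')))"

definition beta_weight :: "nat set \<Rightarrow> nat set \<Rightarrow> (nat \<Rightarrow> nat) \<Rightarrow> int" where
  "beta_weight H V \<omega> =
     (\<Sum>(e, e')\<in>{(e, e'). e \<in> H \<union> V \<and> e' \<in> H \<union> V \<and> e < e'}. beta_pair H V \<omega> e e')"

end

theory Submission
  imports Defs "HOL-Library.Product_Plus"
begin

text \<open>
  Up to a power of \<open>v\<close>, the right-hand sides are sums over gradings of ordered products of torus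
  monomials along the path, one for each edge: the exponent \<open>\<gamma> + \<beta>\<close> is the sum of the symplectic
  products of the vectors \<open>(-1, \<omega>(h))\<close> and \<open>(\<omega>(w), -1)\<close>.  Part (b) is part (a) for \<open>v\<^bsup>-1\<^esup>\<close>, \<open>Z\<^sub>2\<close>, \<open>Z\<^sub>1\<close>
  and the reflected polynomials.

  Part (a) goes by induction, replacing \<open>(Z\<^sub>1, Z\<^sub>2, P\<^sub>1, P\<^sub>2)\<close> by \<open>(Z\<^sub>2, Z\<^sub>3, P\<^sub>2, reflected P\<^sub>1)\<close>.  On paths
  this substitution turns the blocks \<open>E N\<^bsup>b\<^esup>\<close> into \<open>E\<^bsup>d2 - b\<^esup> N\<close>.  For fixed values on the edges that
  correspond to each other, the remaining values lie on matched or on unmatched edges of a bracket word.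
  Unmatched edges carry arbitrary values, which sum up to \<open>Z\<^sub>1\<close> for the shorter path and to \<open>Z\<^sub>3\<close> for
  the longer one.  Matched edges are constrained recursively in the same way in both sums, except that the
  polynomial \<open>P\<^sub>1\<close> is expanded at the closing bracket in one case and at the opening bracket in the other.
\<close>

section \<open>Compatible gradings and a stack automaton\<close>

text \<open>The obstacle is that the induction hypothesis involves Z3^-1, one factor for every
  vertical edge, and as Z3 = Z1^-1 P(v Z2) this has no expansion as a finite sum of monomials in Z1
  and Z2. Compatibility is what removes these factors: with horizontal edges as opening and vertical
  edges as closing brackets, a matched Z3^-1 meets a factor Z3 and only powers of Z2 remain, while
  an unmatched one is summed over all its values, and P Z3^-1 = Z1 reappears. To exploit this, a
  condition on all pairs of edges must become a local one along the path.

  The letters of the bracket words are scaled as U = v Z1, T = v^-1 Z3 and y = v Z2, because then U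
  T = P(y) and the scalars left over in the edge weights are powers of q = v^2. The bound d1 d2 >= 4
  enters through the positivity of the Chebyshev numbers, which are the side lengths of the
  paths.\<close>

definition nE :: "(step \<times> nat) list \<Rightarrow> nat" where
  "nE xs = (\<Sum>x\<leftarrow>xs. if fst x = East then 1 else 0)"
definition nN :: "(step \<times> nat) list \<Rightarrow> nat" where
  "nN xs = (\<Sum>x\<leftarrow>xs. if fst x = North then 1 else 0)"
definition sE :: "(step \<times> nat) list \<Rightarrow> nat" where
  "sE xs = (\<Sum>x\<leftarrow>xs. if fst x = East then snd x else 0)"
definition sN :: "(step \<times> nat) list \<Rightarrow> nat" where
  "sN xs = (\<Sum>x\<leftarrow>xs. if fst x = North then snd x else 0)"

lemma counts_simps [simp]:
  "nE [] = 0" "nN [] = 0" "sE [] = 0" "sN [] = 0"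
  "nE ((East, a) # xs) = Suc (nE xs)" "nE ((North, a) # xs) = nE xs"
  "nN ((East, a) # xs) = nN xs" "nN ((North, a) # xs) = Suc (nN xs)"
  "sE ((East, a) # xs) = a + sE xs" "sE ((North, a) # xs) = sE xs"
  "sN ((East, a) # xs) = sN xs" "sN ((North, a) # xs) = a + sN xs"
  "nE (xs @ ys) = nE xs + nE ys" "nN (xs @ ys) = nN xs + nN ys"
  "sE (xs @ ys) = sE xs + sE ys" "sN (xs @ ys) = sN xs + sN ys"
  by (simp_all add: nE_def nN_def sE_def sN_def)

text \<open>The first alternative of compatibility. The empty \<open>M1\<close> stands for the
  witness e = h, and since \<open>M\<close> ends before the vertical edge, e differs from w.\<close>

definition leaves_shadow :: "nat \<Rightarrow> (step \<times> nat) list \<Rightarrow> bool" where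
  "leaves_shadow a M \<longleftrightarrow> (\<exists>M1 M2. M = M1 @ M2 \<and> nN M1 = a + sE M1)"

definition leaves_shadow_rev :: "nat \<Rightarrow> (step \<times> nat) list \<Rightarrow> bool" where
  "leaves_shadow_rev c M \<longleftrightarrow> (\<exists>M1 M2. M = M1 @ M2 \<and> nE M2 = c + sN M2)"

definition compatible_list :: "(step \<times> nat) list \<Rightarrow> bool" where
  "compatible_list xs \<longleftrightarrow>
     (\<forall>A a M c C. xs = A @ (East, a) # M @ (North, c) # C \<longrightarrow>
        leaves_shadow a M \<or> leaves_shadow_rev c M)"

lemma compatible_list_Nil [simp]: "compatible_list []"
  by (simp add: compatible_list_def)

lemma compatible_list_snoc_East [simp]:
  "compatible_list (xs @ [(East, b)]) \<longleftrightarrow> compatible_list xs"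
proof
  assume *: "compatible_list (xs @ [(East, b)])"
  show "compatible_list xs"
    unfolding compatible_list_def
  proof (intro allI impI)
    fix A a M c C assume "xs = A @ (East, a) # M @ (North, c) # C"
    then have "xs @ [(East, b)] = A @ (East, a) # M @ (North, c) # (C @ [(East, b)])" by simp
    then show "leaves_shadow a M \<or> leaves_shadow_rev c M"
      using * unfolding compatible_list_def by blast
  qed
next
  assume *: "compatible_list xs"
  show "compatible_list (xs @ [(East, b)])"
    unfolding compatible_list_def
  proof (intro allI impI)
    fix A a M c C assume eq: "xs @ [(East, b)] = A @ (East, a) # M @ (North, c) # C"
    then have "C \<noteq> []"
      by (metis append_Cons append_assoc last_snoc prod.inject step.distinct(1))
    then obtain C' z where C: "C = C' @ [z]" by (meson rev_exhaust)
    then have "xs = A @ (East, a) # M @ (North, c) # C'"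
      using eq by (metis append.assoc append_Cons butlast_snoc)
    then show "leaves_shadow a M \<or> leaves_shadow_rev c M"
      using * unfolding compatible_list_def by blast
  qed
qed

lemma compatible_list_snoc_North:
  "compatible_list (xs @ [(North, c)]) \<longleftrightarrow>
     compatible_list xs \<and>
     (\<forall>A a M. xs = A @ (East, a) # M \<longrightarrow> leaves_shadow a M \<or> leaves_shadow_rev c M)"
proof (intro iffI conjI allI impI)
  assume *: "compatible_list (xs @ [(North, c)])"
  show "compatible_list xs"
    unfolding compatible_list_def
  proof (intro allI impI)
    fix A a M d C assume "xs = A @ (East, a) # M @ (North, d) # C"
    then have "xs @ [(North, c)] = A @ (East, a) # M @ (North, d) # (C @ [(North, c)])" by simp
    then show "leaves_shadow a M \<or> leaves_shadow_rev d M"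
      using * unfolding compatible_list_def by blast
  qed
  show "leaves_shadow a M \<or> leaves_shadow_rev c M" if "xs = A @ (East, a) # M" for A a M
  proof -
    have "xs @ [(North, c)] = A @ (East, a) # M @ (North, c) # []"
      using that by simp
    then show ?thesis
      using * unfolding compatible_list_def by blast
  qed
next
  assume *: "compatible_list xs \<and>
    (\<forall>A a M. xs = A @ (East, a) # M \<longrightarrow> leaves_shadow a M \<or> leaves_shadow_rev c M)"
  show "compatible_list (xs @ [(North, c)])"
    unfolding compatible_list_def
  proof (intro allI impI)
    fix A a M d C assume eq: "xs @ [(North, c)] = A @ (East, a) # M @ (North, d) # C"
    show "leaves_shadow a M \<or> leaves_shadow_rev d M"
    proof (cases C rule: rev_cases)
      case Nil
      then have "xs @ [(North, c)] = (A @ (East, a) # M) @ [(North, d)]" using eq by simp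
      then have "xs = A @ (East, a) # M" "c = d" by (simp_all only: append1_eq_conv) auto
      then show ?thesis using * by blast
    next
      case (snoc C' z)
      then have "xs @ [(North, c)] = (A @ (East, a) # M @ (North, d) # C') @ [z]" using eq by simp
      then have "xs = A @ (East, a) # M @ (North, d) # C'" by (simp only: append1_eq_conv)
      then show ?thesis
        using * unfolding compatible_list_def by blast
    qed
  qed
qed

text \<open>This symmetry swaps the two alternatives of compatibility. It allows the two sums of the
  exchange step to be read from opposite ends.\<close>

definition mirror :: "(step \<times> nat) list \<Rightarrow> (step \<times> nat) list" where
  "mirror xs = map (\<lambda>(s, a). (if s = East then North else East, a)) (rev xs)"

lemma mirror_simps [simp]:
  "mirror [] = []" "mirror ((East, a) # xs) = mirror xs @ [(North, a)]"
  "mirror ((North, a) # xs) = mirror xs @ [(East, a)]"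
  "mirror (xs @ ys) = mirror ys @ mirror xs"
  by (simp_all add: mirror_def)

lemma mirror_mirror [simp]: "mirror (mirror xs) = xs"
proof (induction xs)
  case (Cons x xs)
  then show ?case by (cases x; cases "fst x") auto
qed simp

lemma counts_mirror [simp]:
  "nE (mirror xs) = nN xs" "nN (mirror xs) = nE xs"
  "sE (mirror xs) = sN xs" "sN (mirror xs) = sE xs"
proof -
  have "nE (mirror xs) = nN xs \<and> nN (mirror xs) = nE xs \<and>
     sE (mirror xs) = sN xs \<and> sN (mirror xs) = sE xs"
  proof (induction xs)
    case (Cons x xs)
    then show ?case by (cases x; cases "fst x") auto
  qed simp
  then show "nE (mirror xs) = nN xs" "nN (mirror xs) = nE xs"
  "sE (mirror xs) = sN xs" "sN (mirror xs) = sE xs" by auto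
qed

lemma leaves_shadow_mirror:
  "leaves_shadow a (mirror M) \<longleftrightarrow> leaves_shadow_rev a M"
  "leaves_shadow_rev a (mirror M) \<longleftrightarrow> leaves_shadow a M"
  unfolding leaves_shadow_def leaves_shadow_rev_def
  by (metis counts_mirror mirror_mirror mirror_simps(4))+

lemma compatible_list_mirror [simp]: "compatible_list (mirror xs) \<longleftrightarrow> compatible_list xs"
proof -
  have *: "compatible_list (mirror xs)" if "compatible_list xs" for xs
    unfolding compatible_list_def
  proof (intro allI impI)
    fix A a M c C assume eq: "mirror xs = A @ (East, a) # M @ (North, c) # C"
    have "xs = mirror (mirror xs)" by simp
    also have "\<dots> = mirror C @ (East, c) # mirror M @ (North, a) # mirror A"
      by (simp only: eq) simp
    finally have "leaves_shadow c (mirror M) \<or> leaves_shadow_rev a (mirror M)"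
      using that unfolding compatible_list_def by blast
    then show "leaves_shadow a M \<or> leaves_shadow_rev c M"
      by (auto simp: leaves_shadow_mirror)
  qed
  show ?thesis using *[of xs] *[of "mirror xs"] by auto
qed

text \<open>
  Reading a grading from the left, a horizontal edge of value \<open>a\<close> opens \<open>a\<close> brackets and a vertical edge
  closes one.  An entry \<open>n\<close> of the stack belongs to an open bracket: it is the number of horizontal
  edges read since then (including the edge of the bracket itself), minus the values of the vertical
  edges read since then, where whatever lies after a later open bracket is left to the entry of
  the latter.  A vertical edge of value \<open>c\<close> lies in the shadow of some
  horizontal edge iff the stack is nonempty, and then compatibility amounts to \<open>c < n\<close> for the top \<open>n\<close>.
\<close>

definition bump :: "nat \<Rightarrow> nat list \<Rightarrow> nat list" where
  "bump k st = (case st of [] \<Rightarrow> [] | n # s \<Rightarrow> (n + k) # s)"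

lemma bump_simps [simp]:
  "bump k [] = []" "bump k (n # s) = (n + k) # s" "bump 0 st = st"
  "bump j (bump k st) = bump (k + j) st" "length (bump k st) = length st"
  by (auto simp: bump_def split: list.splits)

text \<open>The entries are differences of the counts of nested brackets, so popping hands the
  remainder \<open>n - c\<close> to the entry below.\<close>

fun stack_step :: "nat list \<Rightarrow> step \<times> nat \<Rightarrow> nat list option" where
  "stack_step st (East, a) = Some (bump 1 (replicate a 0 @ st))"
| "stack_step [] (North, c) = Some []"
| "stack_step (n # s) (North, c) = (if c < n then Some (bump (n - c) s) else None)"

fun stack_run :: "nat list \<Rightarrow> (step \<times> nat) list \<Rightarrow> nat list option" where
  "stack_run st [] = Some st"
| "stack_run st (x # xs) = (case stack_step st x of None \<Rightarrow> None | Some st' \<Rightarrow> stack_run st' xs)"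

lemma run_append:
  "stack_run st (xs @ ys) = (case stack_run st xs of None \<Rightarrow> None | Some st' \<Rightarrow> stack_run st' ys)"
  by (induction xs arbitrary: st) (auto split: option.splits)

text \<open>Truncated subtraction is intended: a vertical edge met at height 0 is an unmatched
  closing bracket.\<close>

definition height :: "(step \<times> nat) list \<Rightarrow> nat" where
  "height xs = foldl (\<lambda>n (s, a). if s = East then n + a else n - 1) 0 xs"

lemma height_simps [simp]:
  "height [] = 0" "height (xs @ [(East, a)]) = height xs + a"
  "height (xs @ [(North, a)]) = height xs - 1"
  by (simp_all add: height_def)

text \<open>While the shadow lasts, some bracket above \<open>height A\<close> is open, so the
  subtraction in \<open>height\<close> never truncates.\<close>

lemma height_East_append:
  assumes "\<And>M1 M2. M = M1 @ M2 \<Longrightarrow> nN M1 < a + sE M1"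
  shows "height (A @ (East, a) # M) + nN M = height A + a + sE M"
  using assms
proof (induction M rule: rev_induct)
  case (snoc x M)
  have IH: "height (A @ (East, a) # M) + nN M = height A + a + sE M"
    by (rule snoc.IH) (use snoc.prems in \<open>metis append.assoc\<close>)
  obtain s b where x: "x = (s, b)" by (cases x)
  have "height ((A @ (East, a) # M) @ [x]) + nN (M @ [x]) = height A + a + sE (M @ [x])"
    using IH snoc.prems[of "M @ [x]" "[]"] unfolding x by (cases s) (auto simp del: append_assoc)
  then show ?case by simp
qed (use height_simps(2)[of A a] in simp)

text \<open>
  The bracket at level \<open>l\<close> was opened by some horizontal edge and is still open; \<open>k\<close> is the
  cumulative stack content from the top down to this bracket.
\<close>

definition opener_at :: "(step \<times> nat) list \<Rightarrow> nat \<Rightarrow> nat \<Rightarrow> bool" where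
  "opener_at xs l k \<longleftrightarrow> (\<exists>A a M. xs = A @ (East, a) # M \<and> height A \<le> l \<and> l < height A + a \<and>
     (\<forall>M1 M2. M = M1 @ M2 \<longrightarrow> l < height (A @ (East, a) # M1) \<and> sN M1 \<le> nE M1) \<and>
     k + sN M = Suc (nE M))"

text \<open>Positivity of \<open>k'\<close> supplies the clause sN <= nE for the extended middle
  part.\<close>

lemma opener_at_snocI:
  assumes "opener_at xs l k" "l < height (xs @ [x])" "k' + sN [x] = k + nE [x]" "k' > 0"
  shows "opener_at (xs @ [x]) l k'"
proof -
  obtain A a M where *: "xs = A @ (East, a) # M" "height A \<le> l" "l < height A + a"
    "\<And>M1 M2. M = M1 @ M2 \<Longrightarrow> l < height (A @ (East, a) # M1) \<and> sN M1 \<le> nE M1"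
    "k + sN M = Suc (nE M)"
    using assms(1) unfolding opener_at_def by blast
  have k': "k' + sN (M @ [x]) = Suc (nE (M @ [x]))"
    using *(5) assms(3) by simp
  have "l < height (A @ (East, a) # M1) \<and> sN M1 \<le> nE M1" if "M @ [x] = M1 @ M2" for M1 M2
  proof (cases M2 rule: rev_cases)
    case Nil
    then have "M1 = M @ [x]" using that by simp
    then show ?thesis using assms(2,4) k' *(1) by simp
  next
    case (snoc M2' z)
    then have "M @ [x] = (M1 @ M2') @ [z]" using that by simp
    then have "M = M1 @ M2'" by (simp only: append1_eq_conv)
    then show ?thesis using *(4) by blast
  qed
  then show ?thesis
    unfolding opener_at_def using *(1-3) k' by (intro exI[of _ A] exI[of _ a] exI[of _ "M @ [x]"]) auto
qed

lemma run_invariant: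
  assumes "stack_run [] xs = Some st"
  shows "length st = height xs \<and> (st \<noteq> [] \<longrightarrow> hd st > 0) \<and>
    (\<forall>i<length st. opener_at xs (length st - Suc i) (sum_list (take (Suc i) st)))"
  using assms
proof (induction xs arbitrary: st rule: rev_induct)
  case (snoc x xs)
  from snoc.prems obtain st0 where st0: "stack_run [] xs = Some st0" "stack_step st0 x = Some st"
    by (auto simp: run_append split: option.splits)
  note IH = snoc.IH[OF st0(1)]
  obtain s b where x: "x = (s, b)" by (cases x)
  show ?case
  proof (cases s)
    case East
    have st: "st = bump 1 (replicate b 0 @ st0)" using st0(2) x East by simp
    have len: "length st = height xs + b" using IH by (simp add: st)
    have "hd st > 0" if "st \<noteq> []"
      using that by (cases b; cases st0) (auto simp: st)
    moreover have "opener_at (xs @ [x]) (length st - Suc i) (sum_list (take (Suc i) st))"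
      if i: "i < length st" for i
    proof (cases "i < b")
      case True
      then obtain b' where b': "b = Suc b'" by (cases b) auto
      \<comment> \<open>The fresh entries are 1, 0, ..., 0: a new bracket already counts its own
        edge.\<close>
      have "sum_list (take (Suc i) st) = 1"
        using True by (simp add: st b' sum_list_replicate take_Cons')
      then show ?thesis
        unfolding opener_at_def using True len i
        by (intro exI[of _ xs] exI[of _ b] exI[of _ "[]"]) (auto simp: x East)
    next
      case False
      define j where "j = i - b"
      have ij: "i = b + j" and j: "j < length st0" using False i IH len by (auto simp: j_def)
      have "sum_list (take (Suc i) st) = Suc (sum_list (take (Suc j) st0))"
      proof (cases b)
        case 0 then show ?thesis using j by (cases st0) (auto simp: st ij)
      next
        case (Suc b') then show ?thesis by (simp add: st ij sum_list_replicate)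
      qed
      moreover have "opener_at xs (length st0 - Suc j) (sum_list (take (Suc j) st0))"
        using IH j by blast
      moreover have "length st0 - Suc j = length st - Suc i"
        using IH len by (simp add: ij)
      ultimately show ?thesis
        using i len by (intro opener_at_snocI) (auto simp: x East)
    qed
    ultimately show ?thesis using len by (auto simp: x East)
  next
    case North
    show ?thesis
    proof (cases st0)
      case Nil
      then show ?thesis using st0(2) IH by (simp add: x North)
    next
      case (Cons n s0)
      have c: "b < n" and st: "st = bump (n - b) s0"
        using st0(2) by (auto simp: x North Cons split: if_splits)
      have len: "length st = height xs - 1" "Suc (length st) = length st0"
        using IH by (auto simp: st Cons)
      have "hd st > 0" if "st \<noteq> []"
        using that c by (cases s0) (auto simp: st)
      moreover have "opener_at (xs @ [x]) (length st - Suc i) (sum_list (take (Suc i) st))"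
        if i: "i < length st" for i
      proof (rule opener_at_snocI)
        show "opener_at xs (length st - Suc i) (sum_list (take (Suc (Suc i)) st0))"
          using IH i len(2) by (metis Suc_less_eq diff_Suc_Suc)
        show "length st - Suc i < height (xs @ [x])" using i len by (simp add: x North)
        obtain n1 s1 where s0: "s0 = n1 # s1" using i st by (cases s0) auto
        show "sum_list (take (Suc i) st) + sN [x] = sum_list (take (Suc (Suc i)) st0) + nE [x]"
          using c by (simp add: st s0 Cons x North)
        show "sum_list (take (Suc i) st) > 0" using c by (simp add: st s0)
      qed
      ultimately show ?thesis using len by (simp add: x North)
    qed
  qed
qed simp

text \<open>Dropping entries from the left, the slack nE - c - sN decreases by at most 1 at a time
  and ends at -c, so it passes through 0.\<close>

lemma leaves_shadow_revI:
  assumes "c + sN M \<le> nE M"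
  shows "leaves_shadow_rev c M"
  using assms
proof (induction M)
  case Nil
  then show ?case by (auto simp: leaves_shadow_rev_def)
next
  case (Cons x M)
  show ?case
  proof (cases "c + sN (x # M) = nE (x # M)")
    case True
    then show ?thesis unfolding leaves_shadow_rev_def by (metis append_Nil)
  next
    case False
    then have "c + sN M \<le> nE M" using Cons.prems by (cases x; cases "fst x") auto
    then show ?thesis using Cons.IH unfolding leaves_shadow_rev_def by (metis append_Cons)
  qed
qed

text \<open>Discrete continuity: nN grows by steps of 1, while a + sE never decreases and starts
  positive because the empty prefix is no exit. It can be caught up with only through
  equality.\<close>

lemma not_leaves_shadow:
  assumes "\<not> leaves_shadow a M" "M = M1 @ M2"
  shows "nN M1 < a + sE M1"
  using assms
proof (induction M1 arbitrary: M2 rule: rev_induct)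
  case Nil
  then show ?case unfolding leaves_shadow_def by (cases a) fastforce+
next
  case (snoc x M1)
  then have "nN M1 < a + sE M1" by (metis append.assoc)
  moreover have "nN (M1 @ [x]) \<noteq> a + sE (M1 @ [x])"
    using snoc.prems unfolding leaves_shadow_def by blast
  ultimately show ?case by (cases x; cases "fst x") auto
qed

lemma not_leaves_shadow_height:
  assumes "\<not> leaves_shadow a M" "M = M1 @ M2"
  shows "height A < height (A @ (East, a) # M1)"
proof -
  have "height (A @ (East, a) # M1) + nN M1 = height A + a + sE M1"
  proof (rule height_East_append)
    fix N1 N2 assume "M1 = N1 @ N2"
    then show "nN N1 < a + sE N1" using not_leaves_shadow[OF assms(1)] assms(2) by simp
  qed
  with not_leaves_shadow[OF assms] show ?thesis by simp
qed

text \<open>The constraint on a new vertical edge comes from the edge that opened the top bracket.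
  Horizontal edges after that one have already left their shadows, and those before it are served by
  the same suffix.\<close>

lemma compatible_North_iff:
  assumes "stack_run [] xs = Some st"
  shows "(\<forall>A a M. xs = A @ (East, a) # M \<longrightarrow> leaves_shadow a M \<or> leaves_shadow_rev c M) \<longleftrightarrow>
    stack_step st (North, c) \<noteq> None"
proof (cases st)
  case Nil
  have "leaves_shadow a M" if "xs = A @ (East, a) # M" for A a M
    using not_leaves_shadow_height[of a M M "[]" A] that run_invariant[OF assms] Nil by auto
  then show ?thesis by (auto simp: Nil)
next
  case (Cons n s)
  note inv = run_invariant[OF assms]
  then have "opener_at xs (length s) n" using Cons by auto
  then obtain A a M where *: "xs = A @ (East, a) # M" "height A \<le> length s" "length s < height A + a"
    "\<And>M1 M2. M = M1 @ M2 \<Longrightarrow> length s < height (A @ (East, a) # M1) \<and> sN M1 \<le> nE M1"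
    "n + sN M = Suc (nE M)"
    unfolding opener_at_def by blast
  have hxs: "height xs = Suc (length s)" using inv Cons by simp
  show ?thesis
  proof (intro iffI allI impI)
    assume asm: "\<forall>A a M. xs = A @ (East, a) # M \<longrightarrow> leaves_shadow a M \<or> leaves_shadow_rev c M"
    \<comment> \<open>At the first exit the height would fall back to \<open>height A\<close>, but
      the bracket still open keeps it above \<open>length s\<close>.\<close>
    have "\<not> leaves_shadow a M"
    proof
      assume "leaves_shadow a M"
      then obtain M1 M2 where M: "M = M1 @ M2" "nN M1 = a + sE M1"
        unfolding leaves_shadow_def by blast
      \<comment> \<open>The first exit is taken because \<open>height_East_append\<close> controls
        the height only before it.\<close>
      then obtain M1 M2 where M: "M = M1 @ M2" "nN M1 = a + sE M1"
        and min: "\<And>N1 N2. M1 = N1 @ N2 \<Longrightarrow> N2 \<noteq> [] \<Longrightarrow> nN N1 \<noteq> a + sE N1"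
      proof -
        define k where "k = (LEAST k. nN (take k M) = a + sE (take k M))"
        have ex: "nN (take (length M1) M) = a + sE (take (length M1) M)" using M by simp
        have k: "nN (take k M) = a + sE (take k M)" unfolding k_def
          by (rule LeastI[of "\<lambda>k. nN (take k M) = a + sE (take k M)", OF ex])
        have "nN N1 \<noteq> a + sE N1" if "take k M = N1 @ N2" "N2 \<noteq> []" for N1 N2
        proof -
          have "length N1 + length N2 \<le> k"
            using that(1) by (metis length_append length_take min.cobounded2)
          then have "length N1 < k" using that(2) by (cases N2) auto
          moreover have "N1 = take (length N1) M"
            using that(1) calculation by (metis append_eq_conv_conj min.strict_order_iff take_take)
          ultimately show ?thesis using not_less_Least[of "length N1" "\<lambda>k. nN (take k M) = a + sE (take k M)"]
            unfolding k_def by metis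
        qed
        then show thesis using that[of "take k M" "drop k M"] k by simp
      qed
      show False
      proof (cases M1 rule: rev_cases)
        case Nil
        then show False using M *(2,3) by simp
      next
        case (snoc N x)
        have "\<not> leaves_shadow a N"
        proof
          assume "leaves_shadow a N"
          then obtain N1 N2 where "N = N1 @ N2" "nN N1 = a + sE N1"
            unfolding leaves_shadow_def by blast
          then show False using min[of N1 "N2 @ [x]"] snoc by simp
        qed
        from not_leaves_shadow[OF this]
        have "height (A @ (East, a) # N) + nN N = height A + a + sE N" "nN N < a + sE N"
          by (blast intro: height_East_append, simp)
        moreover have "height ((A @ (East, a) # N) @ [x]) > length s"
          using *(4)[OF M(1)] snoc by simp
        ultimately show False using M(2) *(2) snoc
          by (cases x; cases "fst x") (auto simp del: append_assoc)
      qed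
    qed
    then have "leaves_shadow_rev c M" using asm *(1) by blast
    then obtain M1 M2 where M: "M = M1 @ M2" "nE M2 = c + sN M2"
      unfolding leaves_shadow_rev_def by blast
    \<comment> \<open>Hence nE M2 - sN M2, which is c, is at most nE M - sN M = n - 1.\<close>
    have "sN M1 \<le> nE M1" using *(4)[OF M(1)] by simp
    then have "c < n" using *(5) M by simp
    then show "stack_step st (North, c) \<noteq> None" by (simp add: Cons)
  next
    fix A' a' M'
    assume "stack_step st (North, c) \<noteq> None" and xs: "xs = A' @ (East, a') # M'"
    then have "c < n" by (simp add: Cons split: if_splits)
    then have le: "c + sN M \<le> nE M" using *(5) by simp
    show "leaves_shadow a' M' \<or> leaves_shadow_rev c M'"
    proof (cases "\<exists>N. M' = N @ M")
      case True
      then obtain N where N: "M' = N @ M" by blast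
      from leaves_shadow_revI[OF le] obtain M1 M2 where "M = M1 @ M2" "nE M2 = c + sN M2"
        unfolding leaves_shadow_rev_def by blast
      then have "M' = (N @ M1) @ M2" by (simp add: N)
      then show ?thesis using \<open>nE M2 = c + sN M2\<close> unfolding leaves_shadow_rev_def by blast
    next
      case False
      \<comment> \<open>An edge after the opening one starts above \<open>length s\<close>; a
        lasting shadow would push \<open>height xs\<close> beyond
        \<open>Suc (length s)\<close>.\<close>
      have "leaves_shadow a' M'"
      proof (rule ccontr)
        assume "\<not> leaves_shadow a' M'"
        from not_leaves_shadow_height[OF this, of M' "[]" A']
        have h: "height A' \<le> length s" using xs hxs by simp
        have "A @ (East, a) # M = A' @ (East, a') # M'" using xs *(1) by simp
        then obtain us where "A = A' @ us \<and> us @ (East, a) # M = (East, a') # M' \<or>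
            A @ us = A' \<and> (East, a) # M = us @ (East, a') # M'"
          by (meson append_eq_append_conv2)
        then show False
        proof
          assume "A = A' @ us \<and> us @ (East, a) # M = (East, a') # M'"
          then show False using False by (cases us) auto
        next
          assume as: "A @ us = A' \<and> (East, a) # M = us @ (East, a') # M'"
          show False
          proof (cases us)
            case Nil then show False using as False by auto
          next
            case (Cons u us')
            then have "M = us' @ (East, a') # M'" "A' = A @ (East, a) # us'" using as by auto
            then show False using *(4)[of us'] h by auto
          qed
        qed
      qed
      then show ?thesis ..
    qed
  qed
qed

theorem compatible_list_iff_run: "compatible_list xs \<longleftrightarrow> stack_run [] xs \<noteq> None"
proof (induction xs rule: rev_induct)
  case (snoc x xs)
  obtain s b where x: "x = (s, b)" by (cases x)
  show ?case
  proof (cases s)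
    case East
    then show ?thesis using snoc by (auto simp: x run_append split: option.splits)
  next
    case North
    show ?thesis
    proof (cases "stack_run [] xs")
      case None
      then show ?thesis using snoc by (simp add: x North compatible_list_snoc_North run_append)
    next
      case (Some st)
      then show ?thesis using snoc compatible_North_iff[OF Some, of b]
        by (simp add: x North compatible_list_snoc_North run_append split: option.splits)
    qed
  qed
qed simp

section \<open>Weighted bracket words\<close>

text \<open>
  \<open>Open\<close>, \<open>Dot\<close> and \<open>Close\<close> stand for noncommuting factors \<open>T\<close>, \<open>y\<^bsup>-1\<^esup>\<close> and \<open>U\<close> with \<open>U T = P(y)\<close>.
  The weight of a matched closing bracket is one term of \<open>P(y) T\<^bsup>-1\<^esup>\<close>, chosen such that the bracketed
  group keeps a negative power of \<open>y\<close>.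
\<close>

datatype bracket = Open | Dot | Close

text \<open>The word of one horizontal edge of value a followed by b vertical edges.\<close>

definition block :: "nat \<Rightarrow> nat \<Rightarrow> bracket list" where
  "block a b = replicate a Open @ Dot # replicate b Close"

fun blocks :: "nat list \<Rightarrow> nat list \<Rightarrow> bracket list" where
  "blocks (a # as) (b # bs) = block a b @ blocks as bs"
| "blocks _ _ = []"

text \<open>The operators are abstract so that left and right multiplication are covered alike. The
  law \<open>match\<close> is the cancellation of T against T^-1 after T has moved past y^-(n - c),
  which costs q^(n - c).\<close>

locale bracket_weights =
  fixes \<iota> :: "'k::field \<Rightarrow> 'f::division_ring"
    and opn dot :: "'f \<Rightarrow> 'f" and cls :: "nat \<Rightarrow> 'f \<Rightarrow> 'f" and d :: nat
    and p :: "nat \<Rightarrow> 'k" and q :: 'k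
  assumes scalar_one: "\<iota> 1 = 1"
    and scalar_mult: "\<iota> (a * b) = \<iota> a * \<iota> b"
    and opn_add: "opn (x + y) = opn x + opn y"
    and dot_add: "dot (x + y) = dot x + dot y"
    and cls_add: "cls c (x + y) = cls c x + cls c y"
    and opn_scalar: "opn (\<iota> a * x) = \<iota> a * opn x"
    and dot_scalar: "dot (\<iota> a * x) = \<iota> a * dot x"
    and cls_scalar: "cls c (\<iota> a * x) = \<iota> a * cls c x"
    and match: "c < n \<Longrightarrow> opn ((dot ^^ n) (cls c x)) = \<iota> (p c * q ^ (n - c)) * (dot ^^ (n - c)) x"
    and p0: "p 0 = 1"
begin

definition admissible :: "nat \<Rightarrow> nat set" where
  "admissible n = {c. c \<le> d \<and> c < n}"

lemma finite_admissible [simp]: "finite (admissible n)"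
  by (simp add: admissible_def)

lemma admissible_1: "admissible (Suc 0) = {0}"
  by (auto simp: admissible_def)

text \<open>The sum over the vertical values once the horizontal values are frozen into the
  word.\<close>

fun bracket_sum :: "nat list \<Rightarrow> bracket list \<Rightarrow> 'f" where
  "bracket_sum st [] = 1"
| "bracket_sum st (Open # w) = opn (bracket_sum (0 # st) w)"
| "bracket_sum st (Dot # w) = dot (bracket_sum (bump 1 st) w)"
| "bracket_sum [] (Close # w) = (\<Sum>c\<le>d. cls c (bracket_sum [] w))"
| "bracket_sum (n # st) (Close # w) = (\<Sum>c\<in>admissible n. cls c (bracket_sum (bump (n - c) st) w))"

lemma zero_maps: "opn 0 = 0" "dot 0 = 0" "cls c 0 = 0"
  using opn_add[of 0 0] dot_add[of 0 0] cls_add[of c 0 0] by simp_all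

lemma sum_maps:
  "opn (sum f A) = (\<Sum>i\<in>A. opn (f i))" "dot (sum f A) = (\<Sum>i\<in>A. dot (f i))"
  "cls c (sum f A) = (\<Sum>i\<in>A. cls c (f i))"
  by (induction A rule: infinite_finite_induct) (simp_all add: zero_maps opn_add dot_add cls_add)

lemma linear_maps:
  "opn (\<Sum>i\<in>A. \<iota> (k i) * f i) = (\<Sum>i\<in>A. \<iota> (k i) * opn (f i))"
  "dot (\<Sum>i\<in>A. \<iota> (k i) * f i) = (\<Sum>i\<in>A. \<iota> (k i) * dot (f i))"
  "cls c (\<Sum>i\<in>A. \<iota> (k i) * f i) = (\<Sum>i\<in>A. \<iota> (k i) * cls c (f i))"
  by (simp_all add: sum_maps opn_scalar dot_scalar cls_scalar)

lemma funpow_linear: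
  "(opn ^^ n) (\<Sum>i\<in>A. \<iota> (k i) * f i) = (\<Sum>i\<in>A. \<iota> (k i) * (opn ^^ n) (f i))"
  "(dot ^^ n) (\<Sum>i\<in>A. \<iota> (k i) * f i) = (\<Sum>i\<in>A. \<iota> (k i) * (dot ^^ n) (f i))"
  by (induction n) (simp_all add: linear_maps)

lemma funpow_scalar: "(opn ^^ n) (\<iota> a * x) = \<iota> a * (opn ^^ n) x"
  by (induction n) (simp_all add: opn_scalar)

lemma funpow_dot_sum: "(dot ^^ n) (sum f A) = (\<Sum>i\<in>A. (dot ^^ n) (f i))"
  by (induction n) (simp_all add: sum_maps)

lemma bracket_sum_dots: "bracket_sum st (replicate n Dot @ w) = (dot ^^ n) (bracket_sum (bump n st) w)"
  by (induction n arbitrary: st) (simp_all add: add.commute)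

lemma bracket_sum_opens: "bracket_sum st (replicate n Open @ w) = (opn ^^ n) (bracket_sum (replicate n 0 @ st) w)"
proof (induction n arbitrary: st)
  case (Suc n)
  then show ?case by (simp add: funpow_swap1 replicate_app_Cons_same)
qed simp

text \<open>The relation is assumed for every stack, because the prefix decides with which stack the
  words are reached.\<close>

lemma bracket_sum_congI:
  assumes "\<And>st. bracket_sum st w = (\<Sum>i\<in>A. \<iota> (k i) * bracket_sum st (f i))"
  shows "bracket_sum st (u @ w) = (\<Sum>i\<in>A. \<iota> (k i) * bracket_sum st (u @ f i))"
proof (induction u arbitrary: st)
  case (Cons b u)
  show ?case
  proof (cases b)
    case Close
    show ?thesis
    proof (cases st)
      case Nil
      then show ?thesis
        by (simp add: Close Cons.IH linear_maps sum_distrib_left) (rule sum.swap)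
    next
      case (Cons n s)
      then show ?thesis
        by (simp add: Close Cons.IH linear_maps sum_distrib_left) (rule sum.swap)
    qed
  qed (simp_all add: Cons.IH linear_maps)
qed (simp add: assms)

text \<open>After n dots the top entry is n, and handing n - c to the entry below changes the stack
  just as reading n - c dots does. For n = 0 both sides vanish.\<close>

lemma bracket_sum_match:
  "bracket_sum st (u @ Open # replicate n Dot @ Close # w) =
     (\<Sum>c\<in>admissible n. \<iota> (p c * q ^ (n - c)) * bracket_sum st (u @ replicate (n - c) Dot @ w))"
proof (rule bracket_sum_congI)
  fix st
  have "bracket_sum st (Open # replicate n Dot @ Close # w) =
      (\<Sum>c\<in>admissible n. opn ((dot ^^ n) (cls c (bracket_sum (bump (n - c) st) w))))"
    by (simp add: bracket_sum_dots funpow_dot_sum sum_maps)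
  also have "\<dots> = (\<Sum>c\<in>admissible n. \<iota> (p c * q ^ (n - c)) * bracket_sum st (replicate (n - c) Dot @ w))"
    by (intro sum.cong) (simp_all add: bracket_sum_dots match admissible_def)
  finally show "bracket_sum st (Open # replicate n Dot @ Close # w) =
      (\<Sum>c\<in>admissible n. \<iota> (p c * q ^ (n - c)) * bracket_sum st (replicate (n - c) Dot @ w))" .
qed

text \<open>Around a single dot the closing value is forced to be 0, so each innermost pair
  disappears at the price of one factor q.\<close>

lemma bracket_sum_block:
  "bracket_sum st (u @ block a b @ w) = \<iota> (q ^ min a b) * bracket_sum st (u @ block (a - b) (b - a) @ w)"
proof (induction "min a b" arbitrary: a b)
  case 0
  then have "a = 0 \<or> b = 0" by linarith
  then show ?case by (auto simp: scalar_one)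
next
  case (Suc k)
  from Suc.hyps(2) obtain a' b' where ab: "a = Suc a'" "b = Suc b'" by (cases a; cases b) auto
  have "u @ block a b @ w =
      (u @ replicate a' Open) @ Open # replicate 1 Dot @ Close # (replicate b' Close @ w)"
    by (simp add: ab block_def replicate_app_Cons_same)
  then have "bracket_sum st (u @ block a b @ w) =
      \<iota> q * bracket_sum st ((u @ replicate a' Open) @ replicate 1 Dot @ (replicate b' Close @ w))"
    by (simp only: bracket_sum_match) (simp add: admissible_1 p0)
  also have "\<dots> = \<iota> q * bracket_sum st (u @ block a' b' @ w)"
    by (simp add: block_def)
  also have "\<dots> = \<iota> (q ^ min a b) * bracket_sum st (u @ block (a - b) (b - a) @ w)"
  proof -
    have "min a b = Suc (min a' b')" by (simp add: ab)
    moreover have "bracket_sum st (u @ block a' b' @ w) =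
        \<iota> (q ^ min a' b') * bracket_sum st (u @ block (a' - b') (b' - a') @ w)"
      by (rule Suc.hyps(1)) (use Suc.hyps(2) in \<open>simp add: ab\<close>)
    ultimately show ?thesis by (simp only: ab diff_Suc_Suc power_Suc scalar_mult mult.assoc)
  qed
  finally show ?case .
qed

lemma bracket_sum_blocks:
  assumes "length as = length bs"
  shows "bracket_sum st (u @ blocks as bs) =
    \<iota> (q ^ sum_list (map2 min as bs)) * bracket_sum st (u @ blocks (map2 (-) as bs) (map2 (-) bs as))"
  using assms
proof (induction as bs arbitrary: u rule: list_induct2)
  case (Cons a as b bs)
  have "bracket_sum st (u @ blocks (a # as) (b # bs)) = bracket_sum st (u @ block a b @ blocks as bs)" by simp
  also have "\<dots> = \<iota> (q ^ min a b) * bracket_sum st ((u @ block (a - b) (b - a)) @ blocks as bs)"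
    by (simp only: bracket_sum_block[of st u a b "blocks as bs"] append_assoc)
  also have "\<dots> = \<iota> (q ^ min a b) * (\<iota> (q ^ sum_list (map2 min as bs)) *
      bracket_sum st ((u @ block (a - b) (b - a)) @ blocks (map2 (-) as bs) (map2 (-) bs as)))"
    by (simp only: Cons.IH)
  finally show ?case by (simp add: power_add scalar_mult mult.assoc)
qed (simp add: scalar_one)

lemma bracket_sum_unmatched_opens:
  assumes "set w \<subseteq> {Open, Dot}"
  shows "bracket_sum st w = foldr (\<lambda>b. if b = Open then opn else dot) w 1"
  using assms by (induction w arbitrary: st) auto

lemma bracket_sum_unmatched:
  assumes "set u \<subseteq> {Close, Dot}" "set w \<subseteq> {Open, Dot}"
  shows "bracket_sum [] (u @ w) =
    foldr (\<lambda>b x. case b of Open \<Rightarrow> opn x | Dot \<Rightarrow> dot x | Close \<Rightarrow> (\<Sum>c\<le>d. cls c x)) (u @ w) 1"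
  using assms
proof (induction u)
  case Nil
  have "foldr (\<lambda>b. if b = Open then opn else dot) w 1 =
     foldr (\<lambda>b x. case b of Open \<Rightarrow> opn x | Dot \<Rightarrow> dot x | Close \<Rightarrow> (\<Sum>c\<le>d. cls c x)) w 1"
    using Nil.prems(2) by (induction w) auto
  then show ?case using bracket_sum_unmatched_opens[OF Nil.prems(2)] by simp
qed auto

end

text \<open>Prepending \<open>Open\<close> to a word without matched pairs creates an innermost pair
  with the first \<open>Close\<close>, if there is one.\<close>

lemma bracket_word_cases:
  obtains u w where "v = u @ w" "set u \<subseteq> {Close, Dot}" "set w \<subseteq> {Open, Dot}"
  | u n w where "v = u @ Open # replicate n Dot @ Close # w"
proof -
  have "(\<exists>u w. v = u @ w \<and> set u \<subseteq> {Close, Dot} \<and> set w \<subseteq> {Open, Dot}) \<or>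
    (\<exists>u n w. v = u @ Open # replicate n Dot @ Close # w)"
  proof (induction v)
    case Nil
    show ?case by (intro disjI1 exI[of _ "[]"]) simp
  next
    case (Cons b v)
    from Cons.IH show ?case
    proof
      assume "\<exists>u n w. v = u @ Open # replicate n Dot @ Close # w"
      then show ?thesis by (metis append_Cons)
    next
      assume "\<exists>u w. v = u @ w \<and> set u \<subseteq> {Close, Dot} \<and> set w \<subseteq> {Open, Dot}"
      then obtain u w where *: "v = u @ w" "set u \<subseteq> {Close, Dot}" "set w \<subseteq> {Open, Dot}" by blast
      show ?thesis
      proof (cases "b = Open")
        case False
        then have "set (b # u) \<subseteq> {Close, Dot}" using * by (cases b) auto
        then show ?thesis using * by (metis append_Cons)
      next
        case True
        show ?thesis
        proof (cases "Close \<in> set u")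
          case False
          then have "set (b # v) \<subseteq> {Open, Dot}" using * True by auto
          then show ?thesis by (metis append_Nil empty_set empty_subsetI)
        next
          case inu: True
          then obtain u1 u2 where u: "u = u1 @ Close # u2" "Close \<notin> set u1"
            by (meson split_list_first)
          then have "set u1 \<subseteq> {Dot}" using * by auto
          then have "u1 = replicate (length u1) Dot"
            by (metis replicate_length_same singletonD subset_code(1))
          then have "b # v = [] @ Open # replicate (length u1) Dot @ Close # (u2 @ w)"
            using * u True by (metis append.assoc append_Cons append_Nil)
          then show ?thesis by blast
        qed
      qed
    qed
  qed
  then show thesis using that by blast
qed

fun flip_bracket :: "bracket \<Rightarrow> bracket" where
  "flip_bracket Open = Close" | "flip_bracket Dot = Dot" | "flip_bracket Close = Open"

text \<open>Reversal compensates the change from left to right multiplication; the exchange makes U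
  the opening and T the closing factor.\<close>

definition flip :: "bracket list \<Rightarrow> bracket list" where
  "flip w = map flip_bracket (rev w)"

lemma flip_simps [simp]:
  "flip [] = []" "flip (u @ w) = flip w @ flip u" "flip (b # w) = flip w @ [flip_bracket b]"
  "flip (replicate n b) = replicate n (flip_bracket b)"
  by (simp_all add: flip_def)

text \<open>
  The dual weights multiply from the right and expand the opening brackets as \<open>U\<^bsup>-1\<^esup> P(y)\<close> instead.
\<close>

locale bracket_duality =
  bracket_weights \<iota> opn dot cls d p q + dual: bracket_weights \<iota> opn' dot' cls' d p q
  for \<iota> :: "'k::field \<Rightarrow> 'f::division_ring" and opn dot cls d p q opn' dot' cls' +
  fixes T B U :: 'f
  assumes opn_eq: "opn x = T * x" and dot_eq: "dot x = B * x"
    and cls_total: "(\<Sum>c\<le>d. cls c x) = U * x"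
    and opn'_eq: "opn' x = x * U" and dot'_eq: "dot' x = x * B"
    and cls'_total: "(\<Sum>c\<le>d. cls' c x) = x * T"
begin

text \<open>
  Both sums obey the rewriting rule of \<open>bracket_sum_match\<close> with the same coefficients, and both are the
  plain product of the letters on words without matched brackets.
\<close>

theorem bracket_sum_flip: "bracket_sum [] w = dual.bracket_sum [] (flip w)"
proof (induction "count_list w Open" arbitrary: w rule: less_induct)
  case less
  show ?case
  proof (cases w rule: bracket_word_cases)
    case (1 u v)
    define val where "val = (\<lambda>b. case b of Open \<Rightarrow> T | Dot \<Rightarrow> B | Close \<Rightarrow> U)"
    have "set (flip v) \<subseteq> {Close, Dot}" "set (flip u) \<subseteq> {Open, Dot}"
      using 1 by (auto simp: flip_def)
    then have "dual.bracket_sum [] (flip v @ flip u) = foldr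
      (\<lambda>b x. case b of Open \<Rightarrow> opn' x | Dot \<Rightarrow> dot' x | Close \<Rightarrow> (\<Sum>c\<le>d. cls' c x)) (flip v @ flip u) 1"
      by (rule dual.bracket_sum_unmatched)
    also have "\<dots> = foldr
      (\<lambda>b x. case b of Open \<Rightarrow> x * U | Dot \<Rightarrow> x * B | Close \<Rightarrow> x * T) (flip w) 1"
      by (simp add: 1 opn'_eq dot'_eq cls'_total cong: bracket.case_cong)
    \<comment> \<open>Multiplying from the right along the reversed word restores the original order
      of the factors.\<close>
    also have "\<dots> = prod_list (map val w)"
    proof (induction w)
      case (Cons b w)
      have "foldr (\<lambda>b x. case b of Open \<Rightarrow> x * U | Dot \<Rightarrow> x * B | Close \<Rightarrow> x * T) v z =
          z * foldr (\<lambda>b x. case b of Open \<Rightarrow> x * U | Dot \<Rightarrow> x * B | Close \<Rightarrow> x * T) v 1" for v z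
        by (induction v) (auto simp: mult.assoc split: bracket.splits)
      from this[of "flip w"] Cons show ?case
        by (cases b) (simp_all add: val_def)
    qed simp
    also have "\<dots> = foldr (\<lambda>b x. case b of Open \<Rightarrow> T * x | Dot \<Rightarrow> B * x | Close \<Rightarrow> U * x) w 1"
      by (induction w) (auto simp: val_def split: bracket.splits)
    also have "\<dots> = bracket_sum [] (u @ v)"
      using bracket_sum_unmatched[OF 1(2,3)] by (simp add: 1 opn_eq dot_eq cls_total cong: bracket.case_cong)
    finally show ?thesis by (simp add: 1)
  next
    case (2 u n v)
    have "bracket_sum [] w = (\<Sum>c\<in>admissible n. \<iota> (p c * q ^ (n - c)) * bracket_sum [] (u @ replicate (n - c) Dot @ v))"
      by (simp only: 2 bracket_sum_match)
    also have "\<dots> = (\<Sum>c\<in>admissible n. \<iota> (p c * q ^ (n - c)) *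
        dual.bracket_sum [] (flip (u @ replicate (n - c) Dot @ v)))"
      by (intro sum.cong refl arg_cong2[of _ _ _ _ "(*)"] less) (auto simp: 2)
    also have "\<dots> = dual.bracket_sum [] (flip v @ Open # replicate n Dot @ Close # flip u)"
      by (simp only: dual.bracket_sum_match) simp
    also have "flip v @ Open # replicate n Dot @ Close # flip u = flip w"
      by (simp add: 2)
    finally show ?thesis .
  qed
qed

end

section \<open>Sums over gradings as sums over bracket words\<close>

definition accepted :: "(step \<Rightarrow> nat) \<Rightarrow> nat list \<Rightarrow> step list \<Rightarrow> nat list set" where
  "accepted bnd st D = {ws. list_all2 (\<lambda>s n. n \<le> bnd s) D ws \<and> stack_run st (zip D ws) \<noteq> None}"

lemma accepted_Nil [simp]: "accepted bnd st [] = {[]}"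
  by (auto simp: accepted_def)

lemma accepted_Cons:
  "accepted bnd st (s # D) = (\<Union>n\<in>{..bnd s}. (#) n `
     (case stack_step st (s, n) of None \<Rightarrow> {} | Some st' \<Rightarrow> accepted bnd st' D))"
  by (auto simp: accepted_def list_all2_Cons1 split: option.splits)

lemma finite_accepted [simp]: "finite (accepted bnd st D)"
  by (induction D arbitrary: st) (auto simp: accepted_Cons split: option.splits)

lemma sum_accepted_Cons:
  "(\<Sum>ws\<in>accepted bnd st (s # D). f ws) = (\<Sum>n\<le>bnd s. case stack_step st (s, n) of None \<Rightarrow> 0
     | Some st' \<Rightarrow> \<Sum>ws\<in>accepted bnd st' D. f (n # ws))"
  unfolding accepted_Cons
  by (subst sum.UNION_disjoint)
     (auto simp: sum.reindex intro!: sum.cong split: option.splits)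

context bracket_weights
begin

context
  fixes e :: "nat \<Rightarrow> 'k" and r :: 'k and bE :: nat
begin

text \<open>The brackets come before the dot, as in \<open>stack_step\<close>, so that a bracket
  counts its own edge. The scalars \<open>e\<close> and \<open>r\<close> absorb the powers of q by
  which the two paths differ.\<close>

fun act :: "step \<times> nat \<Rightarrow> 'f \<Rightarrow> 'f" where
  "act (East, n) x = \<iota> (e n) * (opn ^^ n) (dot x)"
| "act (North, n) x = \<iota> r * cls n x"

abbreviation "bnd s \<equiv> (case s of East \<Rightarrow> bE | North \<Rightarrow> d)"

definition grading_sum :: "nat list \<Rightarrow> step list \<Rightarrow> 'f" where
  "grading_sum st D = (\<Sum>ws\<in>accepted bnd st D. foldr act (zip D ws) 1)"

lemma act_sum: "act z (sum f A) = (\<Sum>i\<in>A. act z (f i))"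
proof -
  have "(opn ^^ n) (sum g A) = (\<Sum>i\<in>A. (opn ^^ n) (g i))" for n and g :: "_ \<Rightarrow> 'f"
    by (induction n) (simp_all add: sum_maps)
  then show ?thesis by (cases z; cases "fst z") (simp_all add: sum_maps sum_distrib_left)
qed

lemma grading_sum_Nil [simp]: "grading_sum st [] = 1"
  by (simp add: grading_sum_def)

lemma grading_sum_Cons:
  "grading_sum st (s # D) = (\<Sum>n\<le>bnd s. case stack_step st (s, n) of None \<Rightarrow> 0
     | Some st' \<Rightarrow> act (s, n) (grading_sum st' D))"
  unfolding grading_sum_def sum_accepted_Cons
  by (intro sum.cong refl) (auto simp: act_sum split: option.splits)

text \<open>Neither the coefficients nor the words of the expansion depend on the stack, so it
  passes through the sum over the value of the new edge.\<close>

lemma grading_sum_North: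
  assumes "\<And>st. grading_sum st D = (\<Sum>i\<in>A. \<iota> (k i) * bracket_sum st (f i))"
  shows "grading_sum st (North # D) = (\<Sum>i\<in>A. \<iota> (r * k i) * bracket_sum st (Close # f i))"
proof (cases st)
  case Nil
  then show ?thesis
    by (simp add: grading_sum_Cons assms linear_maps sum_distrib_left scalar_mult mult.assoc)
       (rule sum.swap)
next
  case (Cons n s)
  have "grading_sum st (North # D) = (\<Sum>c\<in>admissible n. act (North, c) (grading_sum (bump (n - c) s) D))"
    unfolding grading_sum_Cons Cons admissible_def by (intro sum.mono_neutral_cong_right) auto
  then show ?thesis
    by (simp add: Cons assms linear_maps sum_distrib_left scalar_mult mult.assoc)
       (rule sum.swap)
qed

lemma grading_sum_Norths:
  assumes "\<And>st. grading_sum st D = (\<Sum>i\<in>A. \<iota> (k i) * bracket_sum st (f i))"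
  shows "grading_sum st (replicate b North @ D) =
    (\<Sum>i\<in>A. \<iota> (r ^ b * k i) * bracket_sum st (replicate b Close @ f i))"
proof (induction b arbitrary: st)
  case (Suc b)
  from grading_sum_North[OF Suc, of st] show ?case by (simp add: mult.assoc)
qed (simp add: assms)

lemma grading_sum_East:
  "grading_sum st (East # D) = (\<Sum>a\<le>bE. \<iota> (e a) * (opn ^^ a) (dot (grading_sum (bump 1 (replicate a 0 @ st)) D)))"
  by (simp add: grading_sum_Cons)

text \<open>Fixing the horizontal values \<open>as\<close> fixes all brackets; only vertical values
  remain to be summed.\<close>

lemma grading_sum_blocks:
  "grading_sum st (concat (map (\<lambda>b. East # replicate b North) bs)) =
     (\<Sum>as | set as \<subseteq> {..bE} \<and> length as = length bs.
        \<iota> (prod_list (map e as) * r ^ sum_list bs) * bracket_sum st (blocks as bs))"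
proof (induction bs arbitrary: st)
  case Nil
  have "{as :: nat list. set as \<subseteq> {..bE} \<and> length as = length ([] :: nat list)} = {[]}" by auto
  then show ?case by (simp add: scalar_one)
next
  case (Cons b bs)
  let ?L = "{as. set as \<subseteq> {..bE} \<and> length as = length bs}"
  have "grading_sum st (concat (map (\<lambda>b. East # replicate b North) (b # bs))) =
    (\<Sum>a\<le>bE. \<Sum>as\<in>?L. \<iota> (e a * (r ^ b * (prod_list (map e as) * r ^ sum_list bs))) *
       bracket_sum st (block a b @ blocks as bs))"
    by (simp add: grading_sum_East grading_sum_Norths[OF Cons] linear_maps funpow_linear sum_distrib_left
        block_def bracket_sum_opens funpow_scalar dot_scalar scalar_mult mult.assoc)
  also have "\<dots> = (\<Sum>(as, a)\<in>?L \<times> {..bE}. \<iota> (e a * (r ^ b * (prod_list (map e as) * r ^ sum_list bs))) *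
       bracket_sum st (block a b @ blocks as bs))"
    by (subst sum.swap, subst sum.cartesian_product) simp
  also have "\<dots> = (\<Sum>as | set as \<subseteq> {..bE} \<and> length as = length (b # bs).
        \<iota> (prod_list (map e as) * r ^ sum_list (b # bs)) * bracket_sum st (blocks as (b # bs)))"
  proof -
    have inj: "inj_on (\<lambda>(as, a). a # as) (?L \<times> {..bE})" by (auto simp: inj_on_def)
    show ?thesis
      unfolding length_Cons lists_length_Suc_eq sum.reindex[OF inj]
      by (intro sum.cong) (auto simp: power_add mult_ac)
  qed
  finally show ?case .
qed

lemma grading_sum_reduced_blocks:
  "grading_sum [] (concat (map (\<lambda>b. East # replicate b North) bs)) =
     (\<Sum>as | set as \<subseteq> {..bE} \<and> length as = length bs.
        \<iota> (prod_list (map e as) * r ^ sum_list bs * q ^ sum_list (map2 min as bs)) *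
        bracket_sum [] (blocks (map2 (-) as bs) (map2 (-) bs as)))"
  unfolding grading_sum_blocks
proof (intro sum.cong refl)
  fix as assume "as \<in> {as. set as \<subseteq> {..bE} \<and> length as = length bs}"
  then show "\<iota> (prod_list (map e as) * r ^ sum_list bs) * bracket_sum [] (blocks as bs) =
    \<iota> (prod_list (map e as) * r ^ sum_list bs * q ^ sum_list (map2 min as bs)) *
        bracket_sum [] (blocks (map2 (-) as bs) (map2 (-) bs as))"
    using bracket_sum_blocks[of as bs "[]" "[]"] by (simp add: scalar_mult mult.assoc)
qed

end

end

lemma flip_blocks:
  assumes "length as = length bs"
  shows "flip (blocks as bs) = blocks (rev bs) (rev as)"
proof -
  have app: "blocks (as @ [a]) (bs @ [b]) = blocks as bs @ block a b" if "length as = length bs" for as bs a b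
    using that by (induction as bs rule: list_induct2) auto
  show ?thesis using assms
    by (induction as bs rule: list_induct2) (auto simp: app block_def)
qed

section \<open>The exchange step on path sums\<close>

fun edge_vector :: "step \<times> nat \<Rightarrow> int \<times> int" where
  "edge_vector (East, n) = (- 1, int n)"
| "edge_vector (North, n) = (int n, - 1)"

fun edge_coeff :: "(nat \<Rightarrow> 'k) \<Rightarrow> (nat \<Rightarrow> 'k) \<Rightarrow> step \<times> nat \<Rightarrow> 'k" where
  "edge_coeff f g (East, n) = f n"
| "edge_coeff f g (North, n) = g n"

section \<open>Central scalars and q-commuting elements\<close>

locale central_scalars =
  fixes \<iota> :: "'k::field \<Rightarrow> 'f::division_ring"
  assumes scalar_one: "\<iota> 1 = 1"
    and scalar_add: "\<iota> (a + b) = \<iota> a + \<iota> b"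
    and scalar_mult: "\<iota> (a * b) = \<iota> a * \<iota> b"
    and scalar_central: "\<iota> a * x = x * \<iota> a"
begin

text \<open>Scalars as an outer operation give noncommutative products a normal form with a single
  scalar in front.\<close>

definition sc :: "'k \<Rightarrow> 'f \<Rightarrow> 'f" where
  "sc a x = \<iota> a * x"

lemma scalar_zero: "\<iota> 0 = 0"
  using scalar_add[of 0 0] by simp

lemma scalar_eq_0_iff [simp]: "\<iota> a = 0 \<longleftrightarrow> a = 0"
proof
  show "a = 0" if "\<iota> a = 0"
    using that scalar_mult[of a "inverse a"] by (cases "a = 0") (auto simp: scalar_one)
qed (simp add: scalar_zero)

lemma scalar_inverse: "\<iota> (inverse a) = inverse (\<iota> a)"
proof (cases "a = 0")
  case False
  then have "\<iota> a * \<iota> (inverse a) = 1" by (simp flip: scalar_mult add: scalar_one)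
  then show ?thesis by (metis inverse_unique)
qed (simp add: scalar_zero)

lemma sc_mult_left [simp]: "sc a x * y = sc a (x * y)"
  by (simp add: sc_def mult.assoc)

lemma sc_mult_right [simp]: "x * sc a y = sc a (x * y)"
  by (metis mult.assoc sc_def scalar_central)

lemma sc_sc [simp]: "sc a (sc b x) = sc (a * b) x"
  by (simp add: sc_def scalar_mult mult.assoc)

lemma sc_one [simp]: "sc 1 x = x"
  by (simp add: sc_def scalar_one)

lemma sc_add: "sc a (x + y) = sc a x + sc a y"
  by (simp add: sc_def distrib_left)

lemma sc_sum: "sc a (sum f A) = (\<Sum>i\<in>A. sc a (f i))"
  by (simp add: sc_def sum_distrib_left)

lemma sc_power [simp]: "(sc a x) ^ n = sc (a ^ n) (x ^ n)"
  by (induction n) (simp_all add: mult.commute)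

lemma sc_eq_0_iff [simp]: "sc a x = 0 \<longleftrightarrow> a = 0 \<or> x = 0"
  by (simp add: sc_def)

lemma sc_inverse [simp]: "inverse (sc a x) = sc (inverse a) (inverse x)"
  by (cases "a = 0 \<or> x = 0")
     (auto simp: sc_def scalar_zero nonzero_inverse_mult_distrib scalar_inverse[symmetric] scalar_central)

definition qcommute :: "'k \<Rightarrow> 'f \<Rightarrow> 'f \<Rightarrow> bool" where
  "qcommute k a b \<longleftrightarrow> k \<noteq> 0 \<and> a * b = sc k (b * a)"

lemma qcommuteD: "qcommute k a b \<Longrightarrow> a * b = sc k (b * a)"
  by (simp add: qcommute_def)

lemma qcommute_sym: "qcommute k a b \<Longrightarrow> qcommute (inverse k) b a"
  by (simp add: qcommute_def)

lemma qcommute_inverse_left: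
  assumes "qcommute k a b"
  shows "qcommute (inverse k) (inverse a) b"
proof (cases "a = 0")
  case False
  have "inverse a * (a * b) * inverse a = inverse a * sc k (b * a) * inverse a"
    using assms by (simp add: qcommute_def)
  then have "b * inverse a = sc k (inverse a * b)"
    using False by (simp add: mult.assoc) (simp flip: mult.assoc)
  then show ?thesis using assms by (simp add: qcommute_def)
qed (use assms in \<open>simp add: qcommute_def\<close>)

lemma qcommute_inverse_right:
  "qcommute k a b \<Longrightarrow> qcommute (inverse k) a (inverse b)"
  using qcommute_sym qcommute_inverse_left by (metis inverse_inverse_eq)

lemma qcommute_mult_right:
  assumes "qcommute k a b" "qcommute l a c"
  shows "qcommute (k * l) a (b * c)"
proof -
  have "a * (b * c) = a * b * c" by (simp add: mult.assoc)
  also have "\<dots> = sc k (b * (a * c))" using assms(1) by (simp add: qcommute_def mult.assoc)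
  also have "\<dots> = sc (k * l) (b * c * a)" using assms(2) by (simp add: qcommute_def mult.assoc)
  finally show ?thesis using assms by (simp add: qcommute_def)
qed

lemma qcommute_1: "qcommute 1 a 1"
  by (simp add: qcommute_def)

lemma qcommute_power_right:
  "qcommute k a b \<Longrightarrow> qcommute (k ^ n) a (b ^ n)"
  by (induction n) (simp_all add: qcommute_1 qcommute_mult_right)

lemma qcommute_sc_right: "qcommute k a b \<Longrightarrow> qcommute k a (sc c b)"
  by (simp add: qcommute_def mult.commute)

lemma qcommute_sc_left: "qcommute k a b \<Longrightarrow> qcommute k (sc c a) b"
  by (simp add: qcommute_def mult.commute)

lemma qcommute_assocD: "qcommute k a b \<Longrightarrow> a * (b * x) = sc k (b * (a * x))"
  by (metis mult.assoc qcommuteD sc_mult_left)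

lemma torus_monomial_West:
  "torus_monomial v \<iota> X Y (- 1, int n) = sc (v ^ n) (inverse X * Y ^ n)"
  by (simp add: torus_monomial_def sc_def mult.assoc)

lemma torus_monomial_South:
  "torus_monomial v \<iota> X Y (int n, - 1) = sc (v ^ n) (X ^ n * inverse Y)"
  by (simp add: torus_monomial_def sc_def mult.assoc)

text \<open>The factors v^-1 multiply to v^-(length D), the part of the exponent that depends on the
  size of the path only.\<close>

definition edge_weight ::
    "'k \<Rightarrow> 'f \<Rightarrow> 'f \<Rightarrow> (nat \<Rightarrow> 'k) \<Rightarrow> (nat \<Rightarrow> 'k) \<Rightarrow> step \<times> nat \<Rightarrow> 'f" where
  "edge_weight v X Y f g z =
     sc (inverse v * edge_coeff f g z) (torus_monomial v \<iota> X Y (edge_vector z))"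

definition path_sum ::
    "'k \<Rightarrow> 'f \<Rightarrow> 'f \<Rightarrow> (nat \<Rightarrow> 'k) \<Rightarrow> (nat \<Rightarrow> 'k) \<Rightarrow> nat \<Rightarrow> nat \<Rightarrow> step list \<Rightarrow> 'f" where
  "path_sum v X Y f g b1 b2 D =
     (\<Sum>ws\<in>accepted (\<lambda>s. case s of East \<Rightarrow> b1 | North \<Rightarrow> b2) [] D.
        prod_list (map (edge_weight v X Y f g) (zip D ws)))"

end

text \<open>The automaton reads from left to right and is not visibly symmetric; it inherits the
  symmetry from compatibility.\<close>

lemma accepted_mirror:
  fixes D D' :: "step list"
  assumes "D' = map (\<lambda>s. if s = East then North else East) (rev D)"
  shows "accepted (\<lambda>s. case s of East \<Rightarrow> b1 | North \<Rightarrow> b2) [] D' =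
    rev ` accepted (\<lambda>s. case s of East \<Rightarrow> b2 | North \<Rightarrow> b1) [] D"
proof -
  have zip: "zip (map (\<lambda>s. if s = East then North else East) (rev D)) (rev ws) = mirror (zip D ws)"
    if "length ws = length D" for D and ws :: "nat list"
    using that by (auto simp: mirror_def zip_rev zip_map1 simp flip: rev_map)
  have sub: "rev ws \<in> accepted (\<lambda>s. case s of East \<Rightarrow> b1 | North \<Rightarrow> b2) []
      (map (\<lambda>s. if s = East then North else East) (rev D))"
    if "ws \<in> accepted (\<lambda>s. case s of East \<Rightarrow> b2 | North \<Rightarrow> b1) [] D" for ws b1 b2 D
  proof -
    have "list_all2 (\<lambda>s n. n \<le> (case s of East \<Rightarrow> b1 | North \<Rightarrow> b2))
        (map (\<lambda>s. if s = East then North else East) (rev D)) (rev ws)"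
      using that unfolding accepted_def
      by (auto simp: list_all2_map1 elim!: list_all2_mono split: step.splits)
    moreover have "stack_run [] (zip (map (\<lambda>s. if s = East then North else East) (rev D)) (rev ws)) \<noteq> None"
      using that zip[of ws D] compatible_list_mirror[of "zip D ws"]
      by (auto simp: accepted_def compatible_list_iff_run dest: list_all2_lengthD)
    ultimately show ?thesis by (simp add: accepted_def)
  qed
  have invol: "map (\<lambda>s. if s = East then North else East)
      (rev (map (\<lambda>s. if s = East then North else East) (rev D))) = D"
    by (induction D) (auto, metis step.exhaust)
  show ?thesis
  proof (intro equalityI subsetI)
    fix ws assume ws: "ws \<in> accepted (\<lambda>s. case s of East \<Rightarrow> b1 | North \<Rightarrow> b2) [] D'"
    from sub[OF ws] have "rev ws \<in> accepted (\<lambda>s. case s of East \<Rightarrow> b2 | North \<Rightarrow> b1) [] D"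
      unfolding assms invol .
    then show "ws \<in> rev ` accepted (\<lambda>s. case s of East \<Rightarrow> b2 | North \<Rightarrow> b1) [] D"
      by (metis image_eqI rev_rev_ident)
  qed (use sub assms in auto)
qed

context central_scalars
begin

text \<open>\<open>X\<close>, \<open>Y\<close>, \<open>Z\<close> play the roles of three consecutive
  cluster variables, \<open>p\<close> and \<open>r\<close> those of the coefficients of the two
  exchange polynomials.\<close>

context
  fixes v q :: 'k and X Y :: 'f and p r :: "nat \<Rightarrow> 'k" and d d2 :: nat
  fixes Z P y U T B :: 'f
  assumes v0: "v \<noteq> 0" and q: "q = v\<^sup>2" and X0: "X \<noteq> 0" and Y0: "Y \<noteq> 0"
    and XY: "X * Y = sc q (Y * X)"
    and p0: "p 0 = 1"
    and P_def: "P = (\<Sum>c\<le>d. sc (p c) ((sc v Y) ^ c))" and P0: "P \<noteq> 0"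
    and Z_def: "Z = inverse X * P"
    and y_def: "y = sc v Y" and U_def: "U = sc v X" and T_def: "T = sc (inverse v) Z"
    and B_def: "B = inverse y"
begin

lemma q0: "q \<noteq> 0" using v0 q by simp

lemma nonzero: "Z \<noteq> 0" "y \<noteq> 0" "U \<noteq> 0" "T \<noteq> 0" "B \<noteq> 0"
  using v0 X0 Y0 P0 by (simp_all add: Z_def y_def U_def T_def B_def)

lemma qcommute_X_Y: "qcommute q X Y"
  using XY q0 by (simp add: qcommute_def)

lemma qcommute_P_Y: "qcommute 1 P Y"
proof -
  have "P * Y = Y * P"
    by (simp add: P_def sum_distrib_left sum_distrib_right power_commutes)
  then show ?thesis by (simp add: qcommute_def)
qed

lemma qcommute_Y_Z: "qcommute q Y Z"
proof -
  have "qcommute q Y (inverse X)"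
    using qcommute_X_Y qcommute_sym qcommute_inverse_right by (metis inverse_inverse_eq)
  from qcommute_mult_right[OF this qcommute_sym[OF qcommute_P_Y]] show ?thesis
    by (simp add: Z_def)
qed

lemma qcommute_T_B: "qcommute q T B"
proof -
  have "qcommute (inverse q) Z Y" by (rule qcommute_sym[OF qcommute_Y_Z])
  then have "qcommute (inverse q) T y" by (simp add: T_def y_def qcommute_sc_left qcommute_sc_right)
  then show ?thesis unfolding B_def using qcommute_inverse_right by fastforce
qed

lemma qcommute_U_B: "qcommute (inverse q) U B"
  unfolding B_def U_def y_def
  by (intro qcommute_inverse_right qcommute_sc_left qcommute_sc_right qcommute_X_Y)

lemma B_y: "c < n \<Longrightarrow> B ^ n * (y ^ c * x) = B ^ (n - c) * x"
proof (induction c arbitrary: n)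
  case (Suc c)
  then obtain m where m: "n = Suc m" by (cases n) auto
  have "B * y = 1" using nonzero by (simp add: B_def)
  have "B ^ n * (y ^ Suc c * x) = B ^ m * (B * y) * (y ^ c * x)"
    by (simp only: m power_Suc2[of B] power_Suc[of y] mult.assoc)
  also have "\<dots> = B ^ (n - Suc c) * x" using Suc by (simp add: m \<open>B * y = 1\<close>)
  finally show ?case .
qed simp

lemma y_B: "c < n \<Longrightarrow> x * y ^ c * B ^ n = x * B ^ (n - c)"
proof (induction c arbitrary: n)
  case (Suc c)
  then obtain m where m: "n = Suc m" by (cases n) auto
  have "y * B = 1" using nonzero by (simp add: B_def)
  have "x * y ^ Suc c * B ^ n = x * y ^ c * (y * B) * B ^ m"
    by (simp only: m power_Suc[of B] power_Suc2[of y] mult.assoc)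
  also have "\<dots> = x * B ^ (n - Suc c)" using Suc by (simp add: m \<open>y * B = 1\<close>)
  finally show ?case .
qed simp

lemma P_inverse_T: "P * inverse T = U"
  using P0 X0 v0 unfolding T_def U_def Z_def
  by (simp add: nonzero_inverse_mult_distrib) (simp flip: mult.assoc)

lemma inverse_U_P: "inverse U * P = T"
  using v0 unfolding T_def U_def Z_def by simp

lemma funpow_mult_left: "((\<lambda>x. a * x) ^^ n) x = a ^ n * (x :: 'f)"
  by (induction n) (simp_all add: mult.assoc)

lemma funpow_mult_right: "((\<lambda>x. x * a) ^^ n) x = x * a ^ (n :: nat)" for x :: 'f
  by (induction n arbitrary: x) (simp_all add: mult.assoc power_commutes)

text \<open>T and U^-1 q-commute with y^-1 by the same factor q, so expanding at the closing or at
  the opening bracket yields the same coefficients q^(n - c).\<close>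

interpretation duality: bracket_duality \<iota> "\<lambda>x. T * x" "\<lambda>x. B * x"
  "\<lambda>c x. sc (p c) (y ^ c * (inverse T * x))" d p q
  "\<lambda>x. x * U" "\<lambda>x. x * B" "\<lambda>c x. sc (p c) (x * inverse U * y ^ c)" T B U
proof unfold_locales
  fix c n :: nat and x assume c: "c < n"
  have TB: "qcommute (q ^ (n - c)) T (B ^ (n - c))"
    by (rule qcommute_power_right[OF qcommute_T_B])
  show "T * ((\<lambda>x. B * x) ^^ n) (sc (p c) (y ^ c * (inverse T * x))) =
      \<iota> (p c * q ^ (n - c)) * ((\<lambda>x. B * x) ^^ (n - c)) x"
    using qcommute_assocD[OF TB] nonzero c
    by (simp add: funpow_mult_left B_y flip: sc_def) (simp flip: mult.assoc)
  have UB: "qcommute (q ^ (n - c)) (inverse U) (B ^ (n - c))"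
    using qcommute_power_right[OF qcommute_inverse_left[OF qcommute_U_B]] by simp
  show "((\<lambda>x. x * B) ^^ n) (sc (p c) (x * inverse U * y ^ c)) * U =
      \<iota> (p c * q ^ (n - c)) * ((\<lambda>x. x * B) ^^ (n - c)) x"
    using qcommute_assocD[OF UB, of U] nonzero c
    by (simp add: funpow_mult_right y_B flip: sc_def) (simp add: mult.assoc)
next
  fix x
  have "(\<Sum>c\<le>d. sc (p c) (y ^ c * (inverse T * x))) = P * inverse T * x"
    by (simp add: P_def y_def sum_distrib_right mult.assoc)
  then show "(\<Sum>c\<le>d. sc (p c) (y ^ c * (inverse T * x))) = U * x"
    by (simp add: P_inverse_T)
  have "(\<Sum>c\<le>d. sc (p c) (x * inverse U * y ^ c)) = x * (inverse U * P)"
    by (simp add: P_def y_def sum_distrib_left mult.assoc)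
  then show "(\<Sum>c\<le>d. sc (p c) (x * inverse U * y ^ c)) = x * T"
    by (simp add: inverse_U_P)
qed (simp_all add: scalar_one scalar_mult p0 algebra_simps sc_add flip: sc_def)

text \<open>After reordering, a horizontal edge is r(n) T^n y^-1 with no scalar left over, and a
  vertical edge is p(n) y^n T^-1 with q^-1 left over.\<close>

lemma path_sum_eq_grading_sum:
  "path_sum v Y Z r p d2 d D = duality.grading_sum r (inverse q) d2 [] D"
proof -
  have "prod_list (map (edge_weight v Y Z r p) zs) = foldr (duality.act r (inverse q)) zs 1" for zs
  proof (induction zs)
    case (Cons z zs)
    obtain s n where z: "z = (s, n)" by (cases z)
    have "edge_weight v Y Z r p (s, n) * x = duality.act r (inverse q) (s, n) x" for x
    proof (cases s)
      case East
      have coeff: "inverse v * r n * v ^ n * inverse q ^ n = r n * inverse v ^ Suc n"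
        using v0 by (simp add: q field_simps power2_eq_square power_mult_distrib)
      have "edge_weight v Y Z r p (East, n) * x =
          sc (inverse v * r n * v ^ n) (inverse Y * (Z ^ n * x))"
        by (simp add: edge_weight_def torus_monomial_West mult.assoc)
      also have "\<dots> = sc (inverse v * r n * v ^ n * inverse q ^ n) (Z ^ n * (inverse Y * x))"
        by (simp only: sc_sc qcommute_assocD[OF qcommute_power_right[OF
          qcommute_inverse_left[OF qcommute_Y_Z]]])
      also have "\<dots> = sc (r n) (T ^ n * (B * x))"
        unfolding coeff by (simp add: T_def B_def y_def mult_ac)
      also have "\<dots> = duality.act r (inverse q) (East, n) x"
        by (simp add: funpow_mult_left flip: sc_def)
      finally show ?thesis by (simp only: East)
    next
      case North
      have coeff: "inverse v * p n * v ^ n = inverse q * (p n * (v ^ n * v))"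
        using v0 by (simp add: q field_simps power2_eq_square)
      have "edge_weight v Y Z r p (North, n) * x =
          sc (inverse v * p n * v ^ n) (Y ^ n * (inverse Z * x))"
        by (simp add: edge_weight_def torus_monomial_South mult.assoc)
      also have "\<dots> = sc (inverse q) (sc (p n) (y ^ n * (inverse T * x)))"
        unfolding coeff T_def y_def by (simp add: power_commutes)
      also have "\<dots> = duality.act r (inverse q) (North, n) x"
        by (simp flip: sc_def) (simp add: mult.commute)
      finally show ?thesis by (simp only: North)
    qed
    then show ?case using Cons by (simp add: z)
  qed simp
  then show ?thesis unfolding path_sum_def duality.grading_sum_def by simp
qed

text \<open>Right multiplication reads the path from its end: vertical edges of \<open>D'\<close>
  become openings, with q^-n left over, and its horizontal edges become closings with no
  scalar.\<close>

lemma path_sum_eq_dual_grading_sum: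
  assumes "D' = map (\<lambda>s. if s = East then North else East) (rev D)"
  shows "path_sum v X Y p g d d2 D' = duality.dual.grading_sum (\<lambda>n. inverse q ^ n * g n) 1 d2 [] D"
proof -
  define act where "act = duality.dual.act (\<lambda>n. inverse q ^ n * g n) 1"
  have prod: "prod_list (map (edge_weight v X Y p g) (mirror zs)) = foldr act zs 1" for zs
  proof (induction zs)
    case (Cons z zs)
    obtain s n where z: "z = (s, n)" by (cases z)
    show ?case
    proof (cases s)
      case East
      have "act (East, n) x = x * edge_weight v X Y p g (North, n)" for x
      proof -
        have coeff: "inverse q ^ n * g n * q ^ n * (v ^ n * inverse v) = inverse v * g n * v ^ n"
          using v0 by (simp add: q field_simps)
        have "act (East, n) x = sc (inverse q ^ n * g n) (x * B * U ^ n)"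
          by (simp add: act_def funpow_mult_right flip: sc_def)
        then have "act (East, n) x = sc (inverse q ^ n * g n) (x * (B * U ^ n))"
          by (simp only: mult.assoc)
        also have "B * U ^ n = sc (q ^ n) (U ^ n * B)"
          using qcommuteD[OF qcommute_power_right[OF qcommute_sym[OF qcommute_U_B]], of n] by simp
        also have "sc (inverse q ^ n * g n) (x * sc (q ^ n) (U ^ n * B)) =
            sc (inverse q ^ n * g n * q ^ n * (v ^ n * inverse v)) (x * (X ^ n * inverse Y))"
          by (simp add: U_def B_def y_def mult.assoc) (simp add: mult.commute)
        also have "\<dots> = x * edge_weight v X Y p g (North, n)"
          unfolding coeff by (simp add: edge_weight_def torus_monomial_South)
        finally show ?thesis .
      qed
      then show ?thesis using Cons by (simp add: z East)
    next
      case North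
      have "act (North, n) x = x * edge_weight v X Y p g (East, n)" for x
      proof -
        have "act (North, n) x = sc (p n) (x * inverse U * y ^ n)"
          by (simp add: act_def scalar_one flip: sc_def)
        also have "\<dots> = sc (p n * (v ^ n * inverse v)) (x * (inverse X * Y ^ n))"
          by (simp add: U_def y_def mult.assoc)
        also have "\<dots> = x * edge_weight v X Y p g (East, n)"
        proof -
          have "p n * (v ^ n * inverse v) = inverse v * (p n * v ^ n)" by (simp only: mult_ac)
          then show ?thesis
            by (simp only: edge_weight_def torus_monomial_West sc_mult_right sc_sc
              edge_vector.simps edge_coeff.simps mult.assoc)
        qed
        finally show ?thesis .
      qed
      then show ?thesis using Cons by (simp add: z North)
    qed
  qed simp
  have "path_sum v X Y p g d d2 D' =
    (\<Sum>ws\<in>accepted (\<lambda>s. case s of East \<Rightarrow> d2 | North \<Rightarrow> d) [] D.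
        prod_list (map (edge_weight v X Y p g) (zip D' (rev ws))))"
    unfolding path_sum_def accepted_mirror[OF assms]
    by (subst sum.reindex) (auto simp: inj_on_def)
  also have "\<dots> = (\<Sum>ws\<in>accepted (\<lambda>s. case s of East \<Rightarrow> d2 | North \<Rightarrow> d) [] D.
        prod_list (map (edge_weight v X Y p g) (mirror (zip D ws))))"
  proof (intro sum.cong refl)
    fix ws assume "ws \<in> accepted (\<lambda>s. case s of East \<Rightarrow> d2 | North \<Rightarrow> d) [] D"
    then have "length ws = length D" by (auto simp: accepted_def dest: list_all2_lengthD)
    then have "zip D' (rev ws) = mirror (zip D ws)"
      by (auto simp: assms mirror_def zip_rev zip_map1 simp flip: rev_map)
    then show "prod_list (map (edge_weight v X Y p g) (zip D' (rev ws))) =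
      prod_list (map (edge_weight v X Y p g) (mirror (zip D ws)))" by simp
  qed
  finally show ?thesis unfolding prod duality.dual.grading_sum_def act_def .
qed

text \<open>
  The sum over the horizontal values of a path \<open>\<Prod> E N\<^bsup>b\<^esup>\<close> is compared term by term with the sum over
  the vertical values \<open>d2 - a\<close> of the path \<open>\<Prod> E\<^bsup>d2 - b\<^esup> N\<close>.  Cancelling the innermost brackets of the
  blocks \<open>(\<^bsup>a\<^esup> y\<^bsup>-1\<^esup> )\<^bsup>b\<^esup>\<close> and \<open>(\<^bsup>d2 - b\<^esup> y\<^bsup>-1\<^esup> )\<^bsup>d2 - a\<^esup>\<close>, whose values are forced to be \<open>0\<close>, leaves the same
  bracket word.
\<close>

lemma path_sum_step:
  assumes "set bs \<subseteq> {..d2}"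
  shows "path_sum v X Y p (\<lambda>n. r (d2 - n)) d d2
      (concat (map (\<lambda>b. replicate (d2 - b) East @ [North]) bs)) =
    path_sum v Y Z r p d2 d (concat (map (\<lambda>b. East # replicate b North) bs))"
proof -
  \<comment> \<open>The mirror image of the longer path again consists of blocks E N^b', with b' =
    d2 - b in reverse order.\<close>
  define bs' where "bs' = rev (map (\<lambda>b. d2 - b) bs)"
  have "concat (map (\<lambda>b. replicate (d2 - b) East @ [North]) bs) =
     map (\<lambda>s. if s = East then North else East)
       (rev (concat (map (\<lambda>b. East # replicate b North) bs')))"
    unfolding bs'_def by (induction bs) auto
  then have "path_sum v X Y p (\<lambda>n. r (d2 - n)) d d2
      (concat (map (\<lambda>b. replicate (d2 - b) East @ [North]) bs)) =
    duality.dual.grading_sum (\<lambda>n. inverse q ^ n * r (d2 - n)) 1 d2 []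
      (concat (map (\<lambda>b. East # replicate b North) bs'))"
    by (rule path_sum_eq_dual_grading_sum)
  also have "\<dots> = (\<Sum>as | set as \<subseteq> {..d2} \<and> length as = length bs'.
        \<iota> (prod_list (map (\<lambda>n. inverse q ^ n * r (d2 - n)) as) * 1 ^ sum_list bs' *
           q ^ sum_list (map2 min as bs')) *
        duality.dual.bracket_sum [] (blocks (map2 (-) as bs') (map2 (-) bs' as)))"
    by (rule duality.dual.grading_sum_reduced_blocks)
  also have "\<dots> = (\<Sum>as | set as \<subseteq> {..d2} \<and> length as = length bs.
        \<iota> (prod_list (map r as) * inverse q ^ sum_list bs * q ^ sum_list (map2 min as bs)) *
        duality.bracket_sum [] (blocks (map2 (-) as bs) (map2 (-) bs as)))"
  proof (rule sum.reindex_bij_witness[of _ "\<lambda>as. rev (map (\<lambda>a. d2 - a) as)" "\<lambda>as. rev (map (\<lambda>a. d2 - a) as)"];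
      (elim CollectE conjE)?)
    fix as assume as: "set as \<subseteq> {..d2}" "length as = length bs'"
    define as' where "as' = rev (map (\<lambda>a. d2 - a) as)"
    have *: "map (\<lambda>a. d2 - (d2 - a)) cs = cs" if "set cs \<subseteq> {..d2}" for cs
      using that by (induction cs) auto
    then show "rev (map (\<lambda>a. d2 - a) (rev (map (\<lambda>a. d2 - a) as))) = as"
      using as by (simp add: rev_map o_def)
    show "rev (map (\<lambda>a. d2 - a) as) \<in> {as. set as \<subseteq> {..d2} \<and> length as = length bs}"
      using as by (auto simp: bs'_def)
    have as': "as = rev (map (\<lambda>a. d2 - a) as')" "set as' \<subseteq> {..d2}" "length as' = length bs"
      using as * by (auto simp: as'_def rev_map o_def bs'_def)
    \<comment> \<open>For truncated differences (d2 - a) - (d2 - b) = b - a, so reflecting the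
      values exchanges the openings and closings left in a block.\<close>
    have A: "map2 (-) as bs' = rev (map2 (-) bs as')" "map2 (-) bs' as = rev (map2 (-) as' bs)"
    proof -
      have "map2 (-) (map (\<lambda>a. d2 - a) xs) (map (\<lambda>a. d2 - a) ys) = map2 (-) ys xs"
        if "length xs = length ys" "set xs \<subseteq> {..d2}" "set ys \<subseteq> {..d2}" for xs ys
        using that by (induction xs ys rule: list_induct2) auto
      from this[of as' bs] this[of bs as'] as' assms
      show "map2 (-) as bs' = rev (map2 (-) bs as')" "map2 (-) bs' as = rev (map2 (-) as' bs)"
        by (simp_all add: bs'_def zip_rev flip: rev_map)
    qed
    \<comment> \<open>Both sides are q^-(b - min a b).\<close>
    have "inverse q ^ (d2 - a) * q ^ min (d2 - a) (d2 - b) = inverse q ^ b * q ^ min a b"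
      if "a \<le> d2" "b \<le> d2" for a b
    proof -
      have "d2 - a = min (d2 - a) (d2 - b) + (b - min a b)" "b = min a b + (b - min a b)"
        using that by auto
      moreover have "inverse q ^ (m + k) * q ^ m = inverse q ^ k" for m k
        using q0 by (simp add: power_add mult.assoc mult.commute power_inverse)
      ultimately show ?thesis by metis
    qed
    note coeff = this
    have "prod_list (map (\<lambda>n. inverse q ^ n * r (d2 - n)) (map (\<lambda>a. d2 - a) as')) *
        q ^ sum_list (map2 min (map (\<lambda>a. d2 - a) as') (map (\<lambda>b. d2 - b) bs)) =
      prod_list (map r as') * inverse q ^ sum_list bs * q ^ sum_list (map2 min as' bs)"
      using as'(3) as'(2) assms
    proof (induction as' bs rule: list_induct2)
      case (Cons a as b bs)
      then have IH: "prod_list (map (\<lambda>n. inverse q ^ n * r (d2 - n)) (map (\<lambda>a. d2 - a) as)) *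
        q ^ sum_list (map2 min (map (\<lambda>a. d2 - a) as) (map (\<lambda>b. d2 - b) bs)) =
        prod_list (map r as) * inverse q ^ sum_list bs * q ^ sum_list (map2 min as bs)"
        and h: "inverse q ^ (d2 - a) * q ^ min (d2 - a) (d2 - b) = inverse q ^ b * q ^ min a b"
        and a: "d2 - (d2 - a) = a"
        using coeff by auto
      have "prod_list (map (\<lambda>n. inverse q ^ n * r (d2 - n)) (map (\<lambda>a. d2 - a) (a # as))) *
        q ^ sum_list (map2 min (map (\<lambda>a. d2 - a) (a # as)) (map (\<lambda>b. d2 - b) (b # bs))) =
        r a * (inverse q ^ (d2 - a) * q ^ min (d2 - a) (d2 - b)) *
        (prod_list (map (\<lambda>n. inverse q ^ n * r (d2 - n)) (map (\<lambda>a. d2 - a) as)) *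
        q ^ sum_list (map2 min (map (\<lambda>a. d2 - a) as) (map (\<lambda>b. d2 - b) bs)))"
        by (simp add: power_add a)
      also have "\<dots> = prod_list (map r (a # as)) * inverse q ^ sum_list (b # bs) *
          q ^ sum_list (map2 min (a # as) (b # bs))"
        unfolding IH h
        by (simp only: list.map prod_list.Cons zip_Cons_Cons prod.case sum_list.Cons power_add mult_ac)
      finally show ?case .
    qed simp
    moreover have "prod_list (map f (rev xs)) = prod_list (map f xs)" for f :: "nat \<Rightarrow> 'k" and xs
      by (induction xs) (simp_all add: mult.commute)
    moreover have "sum_list (map2 min as bs') =
        sum_list (map2 min (map (\<lambda>a. d2 - a) as') (map (\<lambda>b. d2 - b) bs))"
      by (subst as'(1)) (simp add: bs'_def zip_rev as'(3) sum_list_rev flip: rev_map)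
    moreover have "prod_list (map f as) = prod_list (map f (map (\<lambda>a. d2 - a) as'))" for f :: "nat \<Rightarrow> 'k"
      using calculation(2)[of f "map (\<lambda>a. d2 - a) as'"] as'(1) by simp
    ultimately have coef: "prod_list (map (\<lambda>n. inverse q ^ n * r (d2 - n)) as) *
        1 ^ sum_list bs' * q ^ sum_list (map2 min as bs') =
      prod_list (map r as') * inverse q ^ sum_list bs * q ^ sum_list (map2 min as' bs)"
      by (simp only: mult_1_right power_one)
    have "duality.dual.bracket_sum [] (blocks (map2 (-) as bs') (map2 (-) bs' as)) =
       duality.bracket_sum [] (blocks (map2 (-) as' bs) (map2 (-) bs as'))"
      using as'(3) by (simp add: A duality.bracket_sum_flip flip_blocks)
    with coef show "\<iota> (prod_list (map r (rev (map (\<lambda>a. d2 - a) as))) * inverse q ^ sum_list bs *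
          q ^ sum_list (map2 min (rev (map (\<lambda>a. d2 - a) as)) bs)) *
        duality.bracket_sum [] (blocks (map2 (-) (rev (map (\<lambda>a. d2 - a) as)) bs)
          (map2 (-) bs (rev (map (\<lambda>a. d2 - a) as)))) =
      \<iota> (prod_list (map (\<lambda>n. inverse q ^ n * r (d2 - n)) as) * 1 ^ sum_list bs' *
           q ^ sum_list (map2 min as bs')) *
        duality.dual.bracket_sum [] (blocks (map2 (-) as bs') (map2 (-) bs' as))"
      by (simp only: as'_def)
  next
    fix as assume as: "set as \<subseteq> {..d2}" "length as = length bs"
    have "map (\<lambda>a. d2 - (d2 - a)) cs = cs" if "set cs \<subseteq> {..d2}" for cs
      using that by (induction cs) auto
    then show "rev (map (\<lambda>a. d2 - a) (rev (map (\<lambda>a. d2 - a) as))) = as"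
      using as by (simp add: rev_map o_def)
    show "rev (map (\<lambda>a. d2 - a) as) \<in> {as. set as \<subseteq> {..d2} \<and> length as = length bs'}"
      using as by (auto simp: bs'_def)
  qed
  also have "\<dots> = duality.grading_sum r (inverse q) d2 [] (concat (map (\<lambda>b. East # replicate b North) bs))"
    by (rule duality.grading_sum_reduced_blocks[symmetric])
  finally show ?thesis by (simp only: path_sum_eq_grading_sum)
qed

end

end

section \<open>Blocks of maximal Dyck paths\<close>

text \<open>Each step is forced by the current point: North as soon as the point above is not
  strictly above the diagonal. Uniqueness thus becomes a comparison step by step.\<close>

fun greedy :: "nat \<Rightarrow> nat \<Rightarrow> nat \<Rightarrow> nat \<Rightarrow> step list \<Rightarrow> bool" where
  "greedy a1 a2 x y [] \<longleftrightarrow> True"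
| "greedy a1 a2 x y (East # D) \<longleftrightarrow> a2 * x < a1 * Suc y \<and> greedy a1 a2 (Suc x) y D"
| "greedy a1 a2 x y (North # D) \<longleftrightarrow> a1 * Suc y \<le> a2 * x \<and> greedy a1 a2 x (Suc y) D"

lemma greedy_unique:
  "greedy a1 a2 x y D \<Longrightarrow> greedy a1 a2 x y D' \<Longrightarrow> length D = length D' \<Longrightarrow> D = D'"
proof (induction D arbitrary: D' x y)
  case (Cons s D)
  then obtain s' D'' where D': "D' = s' # D''" by (cases D') auto
  show ?case using Cons unfolding D' by (cases s; cases s') auto
qed simp

lemma greedy_append:
  "greedy a1 a2 x y (D @ D') \<longleftrightarrow>
     greedy a1 a2 x y D \<and> greedy a1 a2 (x + count_list D East) (y + count_list D North) D'"
  by (induction a1 a2 x y D rule: greedy.induct) auto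

lemma greedy_replicate_East:
  "greedy a1 a2 x y (replicate k East) \<longleftrightarrow> (\<forall>j<k. a2 * (x + j) < a1 * Suc y)"
  by (induction k arbitrary: x) (auto simp: less_Suc_eq_0_disj)

lemma greedy_replicate_North:
  "greedy a1 a2 x y (replicate k North) \<longleftrightarrow> (\<forall>j<k. a1 * Suc (y + j) \<le> a2 * x)"
  by (induction k arbitrary: y) (auto simp: less_Suc_eq_0_disj)

lemma count_list_replicate: "count_list (replicate n a) b = (if a = b then n else 0)"
  by (induction n) auto

lemma length_eq_count_steps: "length D = count_list D East + count_list D North"
proof (induction D)
  case (Cons s D)
  then show ?case by (cases s) auto
qed simp

lemma greedyI:
  assumes "\<And>A s B. D = A @ s # B \<Longrightarrow>
    s = North \<longleftrightarrow> a1 * Suc (y + count_list A North) \<le> a2 * (x + count_list A East)"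
  shows "greedy a1 a2 x y D"
  using assms
proof (induction D arbitrary: x y)
  case (Cons s D)
  have s: "s = North \<longleftrightarrow> a1 * Suc y \<le> a2 * x" using Cons.prems[of "[]" s D] by simp
  show ?case
  proof (cases s)
    case East
    have "greedy a1 a2 (Suc x) y D"
    proof (rule Cons.IH)
      fix A t B assume "D = A @ t # B"
      then show "t = North \<longleftrightarrow> a1 * Suc (y + count_list A North) \<le> a2 * (Suc x + count_list A East)"
        using Cons.prems[of "s # A" t B] East by simp
    qed
    then show ?thesis using s East by simp
  next
    case North
    have "greedy a1 a2 x (Suc y) D"
    proof (rule Cons.IH)
      fix A t B assume "D = A @ t # B"
      then show "t = North \<longleftrightarrow> a1 * Suc (Suc y + count_list A North) \<le> a2 * (x + count_list A East)"
        using Cons.prems[of "s # A" t B] North by simp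
    qed
    then show ?thesis using s North by simp
  qed
qed simp

lemma path_points_iff:
  "(x, y) \<in> path_points D \<longleftrightarrow>
     (\<exists>A B. D = A @ B \<and> x = count_list A East \<and> y = count_list A North)"
proof
  assume "(x, y) \<in> path_points D"
  then obtain i where "x = count_list (take i D) East" "y = count_list (take i D) North"
    by (auto simp: path_points_def)
  then show "\<exists>A B. D = A @ B \<and> x = count_list A East \<and> y = count_list A North"
    by (metis append_take_drop_id)
next
  assume "\<exists>A B. D = A @ B \<and> x = count_list A East \<and> y = count_list A North"
  then obtain A B where "D = A @ B" "x = count_list A East" "y = count_list A North" by blast
  then show "(x, y) \<in> path_points D"
    unfolding path_points_def by (intro CollectI exI[of _ "length A"]) auto
qed

text \<open>After an East step out of (x, y) the path never returns to column x, so (x, y + 1) is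
  above the path and, by maximality, above the diagonal.\<close>

lemma maximal_imp_greedy:
  assumes "is_maximal_dyck_path a1 a2 D" "a1 > 0"
  shows "greedy a1 a2 0 0 D"
proof (rule greedyI)
  fix A s B assume D: "D = A @ s # B"
  have cnt: "count_list D East = a1" "count_list D North = a2"
    and below: "\<And>x y. (x, y) \<in> path_points D \<Longrightarrow> a1 * y \<le> a2 * x"
    and maximal: "\<And>x y. x \<le> a1 \<Longrightarrow> y \<le> a2 \<Longrightarrow> above_path D (x, y) \<Longrightarrow> a2 * x < a1 * y"
    using assms(1) unfolding is_maximal_dyck_path_def above_diagonal_def by fastforce+
  let ?x = "count_list A East" and ?y = "count_list A North"
  have "s = North \<longleftrightarrow> a1 * Suc ?y \<le> a2 * ?x"
  proof (cases s)
    case North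
    have "D = (A @ [North]) @ B" using D North by simp
    then have "(?x, Suc ?y) \<in> path_points D"
      unfolding path_points_iff by (intro exI[of _ "A @ [North]"] exI[of _ B]) simp
    then show ?thesis using below North by blast
  next
    case East
    have x: "?x < a1" using cnt(1) D East by auto
    have "a2 * ?x < a1 * Suc ?y"
    proof (cases "?y = a2")
      \<comment> \<open>Here the point above leaves the rectangle and maximality says nothing about
        it; x < a1 decides directly.\<close>
      case True
      have "a2 * ?x \<le> a1 * a2" using x by (simp add: mult.commute)
      also have "\<dots> < a1 * Suc ?y" using assms(2) True by simp
      finally show ?thesis .
    next
      case False
      then have y: "Suc ?y \<le> a2" using cnt(2) D by auto
      have "above_path D (?x, Suc ?y)"
        unfolding above_path_def
      proof (clarify)
        fix y' assume "(?x, y') \<in> path_points D"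
        then obtain A' B' where A': "D = A' @ B'" "?x = count_list A' East" "y' = count_list A' North"
          by (auto simp: path_points_iff)
        from D A'(1) consider us where "A = A' @ us" | us where "A' = A @ us" "s # B = us @ B'"
          by (metis append_eq_append_conv2)
        then have "y' \<le> ?y"
        proof cases
          case (2 us)
          then have "us = []" using A'(2) East by (cases us) auto
          then show ?thesis using 2 A'(3) by simp
        qed (use A' in auto)
        then show "y' < Suc ?y" by simp
      qed
      then show ?thesis using maximal[of ?x "Suc ?y"] x y by simp
    qed
    then show ?thesis using East by (simp only: not_le[symmetric]) simp
  qed
  then show "s = North \<longleftrightarrow> a1 * Suc (0 + ?y) \<le> a2 * (0 + ?x)" by simp
qed

lemma greedy_imp_maximal:
  assumes "greedy a1 a2 0 0 D" and cnt: "count_list D East = a1" "count_list D North = a2"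
  shows "is_maximal_dyck_path a1 a2 D"
  unfolding is_maximal_dyck_path_def
proof (intro conjI cnt ballI impI)
  have below: "a1 * count_list A North \<le> a2 * count_list A East" if "D = A @ B" for A B
    using that
  proof (induction A arbitrary: B rule: rev_induct)
    case (snoc s A)
    have "greedy a1 a2 (count_list A East) (count_list A North) (s # B)"
      using assms(1) snoc.prems by (simp add: greedy_append)
    moreover have "a1 * count_list A North \<le> a2 * count_list A East" using snoc by simp
    ultimately show ?case by (cases s) auto
  qed simp
  fix z assume "z \<in> path_points D"
  then show "\<not> above_diagonal a1 a2 z"
    using below by (cases z) (fastforce simp: path_points_iff above_diagonal_def not_less)
next
  fix z assume z: "z \<in> {0..a1} \<times> {0..a2}" "above_path D z"
  obtain x y where xy: "z = (x, y)" by (cases z)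
  \<comment> \<open>The last point of the path in column x, after which comes an East step or the
    end.\<close>
  have ex: "\<exists>A B. D = A @ B \<and> count_list A East = x \<and> (B = [] \<or> hd B = East)"
    if "x \<le> count_list D East" for x and D :: "step list"
    using that
  proof (induction D arbitrary: x)
    case (Cons s D)
    show ?case
    proof (cases "s = East \<and> x = 0")
      case True
      then show ?thesis by (intro exI[of _ "[]"] exI[of _ "s # D"]) auto
    next
      case False
      then obtain x' where x': "x' \<le> count_list D East" "x = (if s = East then Suc x' else x')"
        using Cons.prems by (cases x) (auto split: if_splits)
      from Cons.IH[OF x'(1)] obtain A B where "D = A @ B" "count_list A East = x'" "B = [] \<or> hd B = East"
        by blast
      then show ?thesis using x' by (intro exI[of _ "s # A"] exI[of _ B]) auto
    qed
  qed simp
  have "x \<le> count_list D East" using z cnt xy by auto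
  from ex[OF this] obtain A B where AB: "D = A @ B" "count_list A East = x" "B = [] \<or> hd B = East"
    by blast
  then have "(x, count_list A North) \<in> path_points D" by (auto simp: path_points_iff)
  then have y: "count_list A North < y" using z xy by (auto simp: above_path_def)
  then have "B \<noteq> []" using AB cnt z xy by auto
  then obtain B' where "B = East # B'" using AB(3) by (cases B) auto
  then have "a2 * x < a1 * Suc (count_list A North)"
    using assms(1) AB by (simp add: greedy_append)
  also have "\<dots> \<le> a1 * y" using y by (intro mult_le_mono2) simp
  finally show "above_diagonal a1 a2 z" by (simp add: xy above_diagonal_def)
qed

lemma dyck_path_eqI:
  assumes "a1 > 0" "greedy a1 a2 0 0 D" "count_list D East = a1" "count_list D North = a2"
  shows "dyck_path a1 a2 = D"
  unfolding dyck_path_def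
proof (rule the_equality)
  show "is_maximal_dyck_path a1 a2 D" by (rule greedy_imp_maximal[OF assms(2-4)])
  fix D' assume D': "is_maximal_dyck_path a1 a2 D'"
  then have "length D' = length D"
    using assms(3,4) by (simp add: length_eq_count_steps is_maximal_dyck_path_def)
  then show "D' = D"
    using maximal_imp_greedy[OF D' assms(1)] assms(2) by (intro greedy_unique[of a1 a2 0 0]) auto
qed

text \<open>After i East steps and the North steps behind them, the path has height floor(a2 i /
  a1).\<close>

definition column_heights :: "nat \<Rightarrow> nat \<Rightarrow> nat list" where
  "column_heights a1 a2 = map (\<lambda>i. a2 * Suc i div a1 - a2 * i div a1) [0..<a1]"

lemma dyck_path_columns:
  assumes "a1 > 0"
  shows "dyck_path a1 a2 = concat (map (\<lambda>b. East # replicate b North) (column_heights a1 a2))"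
    and "count_list (dyck_path a1 a2) East = a1" "count_list (dyck_path a1 a2) North = a2"
proof -
  define f where "f i = a2 * i div a1" for i
  have f: "a1 * f i \<le> a2 * i" "a2 * i < a1 * Suc (f i)" for i
    using assms dividend_less_times_div[OF assms, of "a2 * i"] by (simp_all add: f_def)
  have fmono: "f i \<le> f (Suc i)" for i by (simp add: f_def div_le_mono)
  define D where "D i = concat (map (\<lambda>i. East # replicate (f (Suc i) - f i) North) [i..<a1])" for i
  have *: "greedy a1 a2 i (f i) (D i) \<and> count_list (D i) East = a1 - i \<and>
      f i + count_list (D i) North = f a1" if "i \<le> a1" for i
    using that
  proof (induction i rule: inc_induct)
    case base
    then show ?case by (simp add: D_def)
  next
    case (step i)
    have Di: "D i = East # replicate (f (Suc i) - f i) North @ D (Suc i)"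
      using step.hyps by (simp add: D_def upt_conv_Cons)
    have "a1 * Suc (f i + j) \<le> a2 * Suc i" if "j < f (Suc i) - f i" for j
    proof -
      have "a1 * Suc (f i + j) \<le> a1 * f (Suc i)" using that by (intro mult_le_mono2) simp
      then show ?thesis using f(1)[of "Suc i"] by simp
    qed
    then show ?case
      using step f(2)[of i] fmono[of i]
      by (auto simp: Di greedy_append greedy_replicate_North count_list_replicate)
  qed
  have eq: "concat (map (\<lambda>b. East # replicate b North) (column_heights a1 a2)) = D 0"
    by (simp add: D_def column_heights_def f_def o_def)
  have "f 0 = 0" "f a1 = a2" using assms by (simp_all add: f_def)
  with *[of 0] have D0: "greedy a1 a2 0 0 (D 0)" "count_list (D 0) East = a1" "count_list (D 0) North = a2"
    by simp_all
  from dyck_path_eqI[OF assms this]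
  show "dyck_path a1 a2 = concat (map (\<lambda>b. East # replicate b North) (column_heights a1 a2))"
    "count_list (dyck_path a1 a2) East = a1" "count_list (dyck_path a1 a2) North = a2"
    using D0 by (simp_all add: eq)
qed

text \<open>Put x_i = k i - floor(a2 i / a1). Then a1 x_i - a i = a2 i - a1 floor(a2 i / a1) lies in
  [0, a1), so x_i is the ceiling of a i / a1, the column in which the path to (a, a1) reaches height
  i.\<close>

lemma dyck_path_rows:
  assumes "a1 > 0" "a > 0" "a + a2 = k * a1"
  shows "set (column_heights a1 a2) \<subseteq> {..k}"
    and "dyck_path a a1 =
      concat (map (\<lambda>b. replicate (k - b) East @ [North]) (column_heights a1 a2))"
proof -
  define f where "f i = a2 * i div a1" for i
  have f: "a1 * f i \<le> a2 * i" "a2 * i < a1 * Suc (f i)" for i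
    using assms dividend_less_times_div[OF assms(1), of "a2 * i"] by (simp_all add: f_def)
  have fmono: "f i \<le> f (Suc i)" for i by (simp add: f_def div_le_mono)
  have fstep: "f (Suc i) \<le> f i + k" for i
  proof -
    have "a1 * f (Suc i) \<le> a2 * i + a2" using f(1)[of "Suc i"] by simp
    also have "\<dots> < a1 * Suc (f i) + k * a1" using f(2)[of i] assms(3) by linarith
    also have "\<dots> = a1 * Suc (f i + k)" by (simp add: algebra_simps)
    finally show ?thesis by (simp del: mult_Suc_right)
  qed
  then show "set (column_heights a1 a2) \<subseteq> {..k}"
    by (auto simp: column_heights_def f_def le_diff_conv add.commute)
  have fk: "f i \<le> k * i" for i
    by (induction i) (use fstep le_trans in \<open>auto simp: f_def[of 0] intro: le_trans[OF fstep]\<close>)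
  define x where "x i = k * i - f i" for i
  have x: "x i + f i = k * i" for i using fk by (simp add: x_def)
  define D where "D i = concat (map (\<lambda>i. replicate (k - (f (Suc i) - f i)) East @ [North]) [i..<a1])" for i
  have xS: "x (Suc i) = x i + (k - (f (Suc i) - f i))" for i
    using x[of i] x[of "Suc i"] fstep[of i] fmono[of i] by simp
  have key: "a * i + a2 * i = a1 * x i + a1 * f i" for i
  proof -
    have "a * i + a2 * i = k * a1 * i" using assms(3) by (metis add_mult_distrib)
    also have "\<dots> = a1 * (x i + f i)" by (simp add: x)
    finally show ?thesis by (simp add: add_mult_distrib2)
  qed
  have *: "greedy a a1 (x i) i (D i) \<and> count_list (D i) North = a1 - i \<and>
      x i + count_list (D i) East = x a1" if "i \<le> a1" for i
    using that
  proof (induction i rule: inc_induct)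
    case base
    then show ?case by (simp add: D_def)
  next
    case (step i)
    have Di: "D i = replicate (k - (f (Suc i) - f i)) East @ North # D (Suc i)"
      using step.hyps by (simp add: D_def upt_conv_Cons)
    have "a1 * (x i + j) < a * Suc i" if "j < k - (f (Suc i) - f i)" for j
    proof -
      have "a1 * (x i + j) + a1 \<le> a1 * x (Suc i)"
      proof -
        have "Suc (x i + j) \<le> x (Suc i)" using that xS[of i] by simp
        then have "a1 * Suc (x i + j) \<le> a1 * x (Suc i)" by (rule mult_le_mono2)
        then show ?thesis by simp
      qed
      then show ?thesis using key[of "Suc i"] f(2)[of "Suc i"] by simp
    qed
    moreover have "a * Suc i \<le> a1 * x (Suc i)"
      using key[of "Suc i"] f(1)[of "Suc i"] by linarith
    ultimately show ?case
      using step
      by (auto simp: Di greedy_append greedy_replicate_East count_list_replicate xS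
          simp del: mult_Suc_right)
  qed
  have eq: "concat (map (\<lambda>b. replicate (k - b) East @ [North]) (column_heights a1 a2)) = D 0"
    by (simp add: D_def column_heights_def f_def o_def)
  have x0: "x 0 = 0" using x[of 0] by simp
  have "f a1 = a2" using assms(1) by (simp add: f_def)
  then have "x a1 = a" using x[of a1] assms(3) by simp
  then show "dyck_path a a1 =
      concat (map (\<lambda>b. replicate (k - b) East @ [North]) (column_heights a1 a2))"
    using *[of 0] x0 assms(2) unfolding eq by (intro dyck_path_eqI) simp_all
qed

section \<open>Chebyshev polynomials\<close>

lemma cheb_swap: "cheb d1 d2 m (k + 1) = cheb d2 d1 m k"
proof (induction d2 d1 m k rule: cheb.induct)
  case (1 d2 d1 m k)
  then show ?case
    by (subst (1 2) cheb.simps) (auto simp: algebra_simps)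
qed

text \<open>Each shift of the second index exchanges d1 and d2, so the index 1 suffices.\<close>

lemma cheb_rec_1:
  "cheb d1 d2 (int (n + 2)) 1 = int d2 * cheb d2 d1 (int (n + 1)) 1 - cheb d1 d2 (int n) 1"
proof -
  have "cheb d1 d2 (int n) (- 1) = cheb d1 d2 (int n) 1"
    using cheb_swap[of d1 d2 "int n" 0] cheb_swap[of d2 d1 "int n" "- 1"] by simp
  moreover have "cheb d1 d2 (int (n + 1)) 0 = cheb d2 d1 (int (n + 1)) 1"
    using cheb_swap[of d2 d1 "int (n + 1)" 0] by simp
  moreover have "cheb d1 d2 (int (n + 1) + 1) (0 + 1) =
      int d2 * cheb d1 d2 (int (n + 1)) 0 - cheb d1 d2 (int (n + 1) - 1) (0 - 1)"
    using cheb_rec[of d1 d2 "int (n + 1)" 0] by simp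
  ultimately show ?thesis by (simp add: add.commute)
qed

lemma cheb_0 [simp]: "cheb d1 d2 0 k = 0" and cheb_1 [simp]: "cheb d1 d2 1 k = 1"
  by (simp_all add: cheb.simps)

text \<open>Positivity alone does not survive the subtraction in the recursion. The factor 2
  reproduces itself: the hypothesis times d2 gives 4 u_n <= d1 d2 u_n <= 2 d2 u'_(n+1), so at most
  half is subtracted. For d1 d2 = 4 this argument works with no other constant.\<close>

lemma cheb_growth:
  assumes "d1 * d2 \<ge> 4"
  shows "int d2 * cheb d2 d1 (int n) 1 \<le> 2 * cheb d1 d2 (int (n + 1)) 1 \<and>
    cheb d1 d2 (int (n + 1)) 1 > 0 \<and> cheb d1 d2 (int n) 1 \<ge> 0"
  using assms
proof (induction n arbitrary: d1 d2)
  case 0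
  then show ?case by simp
next
  case (Suc n)
  have d: "d2 > 0" "int d1 * int d2 \<ge> 4"
    using Suc.prems by (auto intro: Nat.gr0I simp flip: of_nat_mult)
  have IH: "int d1 * cheb d1 d2 (int n) 1 \<le> 2 * cheb d2 d1 (int (n + 1)) 1"
    "cheb d2 d1 (int (n + 1)) 1 > 0"
    using Suc.IH[of d2 d1] Suc.prems by (simp_all add: mult.commute)
  have nonneg: "cheb d1 d2 (int n) 1 \<ge> 0" "cheb d1 d2 (int (n + 1)) 1 > 0"
    using Suc.IH[of d1 d2] Suc.prems by simp_all
  have "4 * cheb d1 d2 (int n) 1 \<le> int d1 * int d2 * cheb d1 d2 (int n) 1"
    using d nonneg by (intro mult_right_mono) auto
  also have "\<dots> \<le> 2 * (int d2 * cheb d2 d1 (int (n + 1)) 1)"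
    using mult_left_mono[OF IH(1), of "int d2"] by (simp add: mult_ac)
  finally have "2 * cheb d1 d2 (int n) 1 \<le> int d2 * cheb d2 d1 (int (n + 1)) 1" by simp
  then have *: "int d2 * cheb d2 d1 (int (n + 1)) 1 \<le> 2 * cheb d1 d2 (int (n + 2)) 1"
    by (simp only: cheb_rec_1) simp
  have "0 < int d2 * cheb d2 d1 (int (n + 1)) 1" using d IH(2) by simp
  with * nonneg show ?case by simp
qed

section \<open>Gradings as lists\<close>

lemma upt_split: "a \<le> c \<Longrightarrow> c \<le> b \<Longrightarrow> [a..<b] = [a..<c] @ [c..<b]"
  using upt_add_eq_append[of a c "b - c"] by simp

lemma map_upt_eq_append_iff:
  assumes "a \<le> b"
  shows "map g [a..<b] = xs @ ys \<longleftrightarrow>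
    (\<exists>c\<in>{a..b}. xs = map g [a..<c] \<and> ys = map g [c..<b])"
proof
  assume *: "map g [a..<b] = xs @ ys"
  define c where "c = a + length xs"
  have len: "length xs \<le> b - a" using arg_cong[OF *, of length] by simp
  then have c: "c \<in> {a..b}" using assms by (auto simp: c_def)
  then have "[a..<b] = [a..<c] @ [c..<b]" by (intro upt_split) auto
  then have "map g [a..<c] @ map g [c..<b] = xs @ ys" using * by simp
  moreover have "length (map g [a..<c]) = length xs" by (simp add: c_def)
  ultimately show "\<exists>c\<in>{a..b}. xs = map g [a..<c] \<and> ys = map g [c..<b]"
    using c by auto
next
  assume "\<exists>c\<in>{a..b}. xs = map g [a..<c] \<and> ys = map g [c..<b]"
  then show "map g [a..<b] = xs @ ys"
    using upt_split by (metis atLeastAtMost_iff map_append)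
qed

lemma map_upt_eq_Cons_iff:
  "map g [a..<b] = x # ys \<longleftrightarrow> a < b \<and> x = g a \<and> ys = map g [Suc a..<b]"
  by (cases "a < b") (auto simp: upt_conv_Cons)

context
  fixes D :: "step list" and \<omega> :: "nat \<Rightarrow> nat"
begin

abbreviation graded :: "nat \<Rightarrow> step \<times> nat" where
  "graded i \<equiv> (D ! i, \<omega> i)"

lemma counts_graded:
  assumes "b \<le> length D"
  shows "nE (map graded [a..<b]) = card ({a..<b} \<inter> hor_edges D)"
    and "nN (map graded [a..<b]) = card ({a..<b} \<inter> ver_edges D)"
    and "sE (map graded [a..<b]) = sum \<omega> ({a..<b} \<inter> hor_edges D)"
    and "sN (map graded [a..<b]) = sum \<omega> ({a..<b} \<inter> ver_edges D)"
proof -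
  have *: "(\<Sum>i\<leftarrow>[a..<b]. if D ! i = s then f i else 0) = sum f ({a..<b} \<inter> {i. i < length D \<and> D ! i = s})"
    for s and f :: "nat \<Rightarrow> nat"
  proof -
    have "(\<Sum>i\<leftarrow>[a..<b]. if D ! i = s then f i else 0) = (\<Sum>i\<in>{a..<b}. if D ! i = s then f i else 0)"
      by (simp add: interv_sum_list_conv_sum_set_nat)
    also have "\<dots> = sum f ({a..<b} \<inter> {i. D ! i = s})"
      by (simp add: sum.inter_restrict)
    also have "{a..<b} \<inter> {i. D ! i = s} = {a..<b} \<inter> {i. i < length D \<and> D ! i = s}"
      using assms by auto
    finally show ?thesis .
  qed
  show "nE (map graded [a..<b]) = card ({a..<b} \<inter> hor_edges D)"
    "nN (map graded [a..<b]) = card ({a..<b} \<inter> ver_edges D)"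
    "sE (map graded [a..<b]) = sum \<omega> ({a..<b} \<inter> hor_edges D)"
    "sN (map graded [a..<b]) = sum \<omega> ({a..<b} \<inter> ver_edges D)"
    using *[of East "\<lambda>_. 1"] *[of North "\<lambda>_. 1"] *[of East \<omega>] *[of North \<omega>]
    by (simp_all add: nE_def nN_def sE_def sN_def hor_edges_def ver_edges_def o_def cong: if_cong)
qed

lemma leaves_shadow_graded:
  assumes "h \<in> hor_edges D" "w \<in> ver_edges D" "h < w"
  shows "leaves_shadow (\<omega> h) (map graded [Suc h..<w]) \<longleftrightarrow>
    (\<exists>e\<in>{h..w}. e \<noteq> w \<and> card ({h..e} \<inter> ver_edges D) = (\<Sum>h'\<in>{h..e} \<inter> hor_edges D. \<omega> h'))"
proof -
  have w: "w < length D" using assms by (simp add: ver_edges_def)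
  have Sh: "Suc h \<le> w" using assms by simp
  have eq: "nN (map graded [Suc h..<Suc e]) = \<omega> h + sE (map graded [Suc h..<Suc e]) \<longleftrightarrow>
    card ({h..e} \<inter> ver_edges D) = (\<Sum>h'\<in>{h..e} \<inter> hor_edges D. \<omega> h')" if "h \<le> e" "e < w" for e
  proof -
    have "{h..e} \<inter> ver_edges D = {Suc h..<Suc e} \<inter> ver_edges D"
      using assms by (auto simp: hor_edges_def ver_edges_def) (metis le_antisym not_less_eq_eq step.distinct(1))
    moreover have "{h..e} \<inter> hor_edges D = insert h ({Suc h..<Suc e} \<inter> hor_edges D)"
      using assms that by (auto simp: hor_edges_def)
    moreover have "Suc e \<le> length D" using that w by simp
    ultimately show ?thesis by (simp add: counts_graded del: upt_Suc)
  qed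
  have "leaves_shadow (\<omega> h) (map graded [Suc h..<w]) \<longleftrightarrow>
    (\<exists>c\<in>{Suc h..w}. nN (map graded [Suc h..<c]) = \<omega> h + sE (map graded [Suc h..<c]))"
    unfolding leaves_shadow_def map_upt_eq_append_iff[OF Sh] by blast
  \<comment> \<open>A prefix stops before \<open>c\<close>, whereas the witness edge is included: e
    = c - 1, and the empty prefix gives e = h.\<close>
  also have "\<dots> \<longleftrightarrow> (\<exists>e\<in>{h..<w}. nN (map graded [Suc h..<Suc e]) = \<omega> h + sE (map graded [Suc h..<Suc e]))"
  proof
    assume "\<exists>c\<in>{Suc h..w}. nN (map graded [Suc h..<c]) = \<omega> h + sE (map graded [Suc h..<c])"
    then obtain c where "c \<in> {Suc h..w}" "nN (map graded [Suc h..<c]) = \<omega> h + sE (map graded [Suc h..<c])"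
      by blast
    then show "\<exists>e\<in>{h..<w}. nN (map graded [Suc h..<Suc e]) = \<omega> h + sE (map graded [Suc h..<Suc e])"
      by (intro bexI[of _ "c - 1"]) auto
  next
    assume "\<exists>e\<in>{h..<w}. nN (map graded [Suc h..<Suc e]) = \<omega> h + sE (map graded [Suc h..<Suc e])"
    then obtain e where "e \<in> {h..<w}" "nN (map graded [Suc h..<Suc e]) = \<omega> h + sE (map graded [Suc h..<Suc e])"
      by blast
    then show "\<exists>c\<in>{Suc h..w}. nN (map graded [Suc h..<c]) = \<omega> h + sE (map graded [Suc h..<c])"
      by (intro bexI[of _ "Suc e"]) (auto simp del: upt_Suc)
  qed
  also have "\<dots> \<longleftrightarrow> (\<exists>e\<in>{h..<w}. card ({h..e} \<inter> ver_edges D) = (\<Sum>h'\<in>{h..e} \<inter> hor_edges D. \<omega> h'))"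
    using eq by (intro bex_cong refl) auto
  also have "\<dots> \<longleftrightarrow> (\<exists>e\<in>{h..w}. e \<noteq> w \<and> card ({h..e} \<inter> ver_edges D) = (\<Sum>h'\<in>{h..e} \<inter> hor_edges D. \<omega> h'))"
  proof -
    have "{h..<w} = {h..w} - {w}" by auto
    then show ?thesis by (simp only:) blast
  qed
  finally show ?thesis .
qed

lemma leaves_shadow_rev_graded:
  assumes "h \<in> hor_edges D" "w \<in> ver_edges D" "h < w"
  shows "leaves_shadow_rev (\<omega> w) (map graded [Suc h..<w]) \<longleftrightarrow>
    (\<exists>e\<in>{h..w}. e \<noteq> h \<and> card ({e..w} \<inter> hor_edges D) = (\<Sum>w'\<in>{e..w} \<inter> ver_edges D. \<omega> w'))"
proof -
  have w: "w < length D" using assms by (simp add: ver_edges_def)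
  have Sh: "Suc h \<le> w" using assms by simp
  have eq: "nE (map graded [e..<w]) = \<omega> w + sN (map graded [e..<w]) \<longleftrightarrow>
    card ({e..w} \<inter> hor_edges D) = (\<Sum>w'\<in>{e..w} \<inter> ver_edges D. \<omega> w')" if "h < e" "e \<le> w" for e
  proof -
    have "{e..w} \<inter> hor_edges D = {e..<w} \<inter> hor_edges D"
      using assms by (auto simp: hor_edges_def ver_edges_def) (metis le_less step.distinct(1))
    moreover have "{e..w} \<inter> ver_edges D = insert w ({e..<w} \<inter> ver_edges D)"
      using assms that by (auto simp: ver_edges_def)
    moreover have "w \<le> length D" using w by simp
    ultimately show ?thesis by (simp add: counts_graded del: upt_Suc)
  qed
  have "leaves_shadow_rev (\<omega> w) (map graded [Suc h..<w]) \<longleftrightarrow>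
    (\<exists>e\<in>{Suc h..w}. nE (map graded [e..<w]) = \<omega> w + sN (map graded [e..<w]))"
    unfolding leaves_shadow_rev_def map_upt_eq_append_iff[OF Sh] by blast
  also have "\<dots> \<longleftrightarrow> (\<exists>e\<in>{Suc h..w}. card ({e..w} \<inter> hor_edges D) = (\<Sum>w'\<in>{e..w} \<inter> ver_edges D. \<omega> w'))"
    using eq by (intro bex_cong refl) auto
  also have "\<dots> \<longleftrightarrow> (\<exists>e\<in>{h..w}. e \<noteq> h \<and> card ({e..w} \<inter> hor_edges D) = (\<Sum>w'\<in>{e..w} \<inter> ver_edges D. \<omega> w'))"
  proof -
    have "{Suc h..w} = {h..w} - {h}" by auto
    then show ?thesis by (simp only:) blast
  qed
  finally show ?thesis .
qed

lemma compatible_grading_iff_list: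
  "compatible_grading D \<omega> \<longleftrightarrow> compatible_list (map graded [0..<length D])"
proof -
  have split: "map graded [0..<length D] = A @ (East, a) # M @ (North, c) # C \<longleftrightarrow>
    (\<exists>h w. h \<in> hor_edges D \<and> w \<in> ver_edges D \<and> h < w \<and> A = map graded [0..<h] \<and> a = \<omega> h \<and>
       M = map graded [Suc h..<w] \<and> c = \<omega> w \<and> C = map graded [Suc w..<length D])" (is "?L \<longleftrightarrow> ?R")
    for A a M c C
  proof
    assume ?L
    from this[unfolded map_upt_eq_append_iff[OF le0]] obtain h
      where A: "A = map graded [0..<h]" and tl: "map graded [h..<length D] = (East, a) # M @ (North, c) # C"
      by auto
    from tl[unfolded map_upt_eq_Cons_iff] have h: "A = map graded [0..<h]" "h < length D"
      "(East, a) = graded h" "M @ (North, c) # C = map graded [Suc h..<length D]"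
      using A by auto
    have "Suc h \<le> length D" using h by simp
    from h(4)[symmetric, unfolded map_upt_eq_append_iff[OF this]]
    obtain w where w: "w \<in> {Suc h..length D}" "M = map graded [Suc h..<w]"
      "map graded [w..<length D] = (North, c) # C" by auto
    then show ?R using h
      by (intro exI[of _ h] exI[of _ w]) (auto simp: map_upt_eq_Cons_iff hor_edges_def ver_edges_def)
  next
    assume ?R
    then obtain h w where hw: "h \<in> hor_edges D" "w \<in> ver_edges D" "h < w"
      and *: "A = map graded [0..<h]" "a = \<omega> h" "M = map graded [Suc h..<w]" "c = \<omega> w"
        "C = map graded [Suc w..<length D]" by blast
    have "[0..<length D] = [0..<h] @ h # [Suc h..<w] @ w # [Suc w..<length D]"
    proof -
      have "h < length D" "w < length D" using hw by (auto simp: hor_edges_def ver_edges_def)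
      then show ?thesis
        using hw(3) upt_split[of 0 h "length D"] upt_split[of "Suc h" w "length D"]
        by (simp add: upt_conv_Cons[of h "length D"] upt_conv_Cons[of w "length D"])
    qed
    then show ?L using hw * by (simp add: hor_edges_def ver_edges_def)
  qed
  have "compatible_list (map graded [0..<length D]) \<longleftrightarrow>
    (\<forall>h\<in>hor_edges D. \<forall>w\<in>ver_edges D. h < w \<longrightarrow> leaves_shadow (\<omega> h) (map graded [Suc h..<w]) \<or>
       leaves_shadow_rev (\<omega> w) (map graded [Suc h..<w]))"
    unfolding compatible_list_def split by blast
  also have "\<dots> \<longleftrightarrow> compatible_grading D \<omega>"
    unfolding compatible_grading_def
    using leaves_shadow_graded leaves_shadow_rev_graded by (intro ball_cong refl imp_cong) blast
  finally show ?thesis by simp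
qed

end

lemma sum_compatible_gradings:
  "(\<Sum>\<omega>\<in>compatible_gradings b1 b2 D. F (map \<omega> [0..<length D])) =
     (\<Sum>ws\<in>accepted (\<lambda>s. case s of East \<Rightarrow> b1 | North \<Rightarrow> b2) [] D. F ws)"
proof (rule sum.reindex_bij_witness[of _ "\<lambda>ws. restrict ((!) ws) {..<length D}"
      "\<lambda>\<omega>. map \<omega> [0..<length D]"])
  have iff: "map \<omega> [0..<length D] \<in> accepted (\<lambda>s. case s of East \<Rightarrow> b1 | North \<Rightarrow> b2) [] D \<longleftrightarrow>
    bounded_grading b1 b2 D \<omega> \<and> compatible_grading D \<omega>" for \<omega>
  proof -
    have "zip D (map \<omega> [0..<length D]) = map (graded D \<omega>) [0..<length D]"
      by (rule nth_equalityI) auto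
    moreover have "list_all2 (\<lambda>s n. n \<le> (case s of East \<Rightarrow> b1 | North \<Rightarrow> b2)) D (map \<omega> [0..<length D]) \<longleftrightarrow>
      bounded_grading b1 b2 D \<omega>"
      by (auto simp: list_all2_conv_all_nth bounded_grading_def hor_edges_def ver_edges_def split: step.splits)
    ultimately show ?thesis
      by (simp add: accepted_def compatible_grading_iff_list compatible_list_iff_run)
  qed
  show "map \<omega> [0..<length D] \<in> accepted (\<lambda>s. case s of East \<Rightarrow> b1 | North \<Rightarrow> b2) [] D"
    if "\<omega> \<in> compatible_gradings b1 b2 D" for \<omega>
    using that iff by (simp add: compatible_gradings_def)
  show "restrict ((!) (map \<omega> [0..<length D])) {..<length D} = \<omega>"
    if "\<omega> \<in> compatible_gradings b1 b2 D" for \<omega>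
    using that by (auto simp: compatible_gradings_def PiE_def extensional_def fun_eq_iff)
  fix ws assume ws: "ws \<in> accepted (\<lambda>s. case s of East \<Rightarrow> b1 | North \<Rightarrow> b2) [] D"
  then have len: "length ws = length D" by (auto simp: accepted_def dest: list_all2_lengthD)
  show *: "map (restrict ((!) ws) {..<length D}) [0..<length D] = ws"
    by (rule nth_equalityI) (auto simp: len)
  then show "restrict ((!) ws) {..<length D} \<in> compatible_gradings b1 b2 D"
    using ws iff[of "restrict ((!) ws) {..<length D}"] by (simp add: compatible_gradings_def)
qed simp

section \<open>Cluster variables\<close>

text \<open>The four polynomials form a cycle, which the replacement rotates; reflecting twice is
  the identity because P1(0) is nonzero.\<close>

lemma exchange_poly_shift:
  assumes "coeff P1 0 \<noteq> 0"
  shows "exchange_poly P2 (reflect_poly P1) k = exchange_poly P1 P2 (k + 1)"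
proof -
  have "k mod 4 = 0 \<or> k mod 4 = 1 \<or> k mod 4 = 2 \<or> k mod 4 = 3" by presburger
  moreover have "(k + 1) mod 4 = (if k mod 4 = 3 then 0 else k mod 4 + 1)" by presburger
  ultimately show ?thesis using assms by (auto simp: exchange_poly_def)
qed

text \<open>The offsets belong to \<alpha> = 3 and the reflection k -> 3 - k: the variable of index
  k is computed upwards with polynomial k + 2, that of index 3 - k downwards with polynomial 7 -
  k.\<close>

lemma exchange_poly_reflect:
  assumes "coeff P1 0 \<noteq> 0" "coeff P2 0 \<noteq> 0"
  shows "exchange_poly (reflect_poly P2) (reflect_poly P1) (k + 2) = exchange_poly P1 P2 (7 - k)"
proof -
  have "k mod 4 = 0 \<or> k mod 4 = 1 \<or> k mod 4 = 2 \<or> k mod 4 = 3" by presburger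
  moreover have "k mod 4 = 0 \<Longrightarrow> (k + 2) mod 4 = 2 \<and> (7 - k) mod 4 = 3"
    "k mod 4 = 1 \<Longrightarrow> (k + 2) mod 4 = 3 \<and> (7 - k) mod 4 = 2"
    "k mod 4 = 2 \<Longrightarrow> (k + 2) mod 4 = 0 \<and> (7 - k) mod 4 = 1"
    "k mod 4 = 3 \<Longrightarrow> (k + 2) mod 4 = 1 \<and> (7 - k) mod 4 = 0"
    by presburger+
  ultimately show ?thesis using assms by (auto simp: exchange_poly_def)
qed

context central_scalars
begin

definition qpair :: "'k \<Rightarrow> 'f \<Rightarrow> 'f \<Rightarrow> bool" where
  "qpair v X Y \<longleftrightarrow> v \<noteq> 0 \<and> X \<noteq> 0 \<and> Y \<noteq> 0 \<and> X * Y = sc (v\<^sup>2) (Y * X)"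

lemma qpair_qcommute: "qpair v X Y \<Longrightarrow> qcommute (v\<^sup>2) X Y"
  by (simp add: qpair_def qcommute_def)

lemma nc_eval_sc: "nc_eval \<iota> P (\<iota> a * x) = (\<Sum>j\<le>degree P. sc (coeff P j) ((sc a x) ^ j))"
  by (simp add: nc_eval_def del: sc_power flip: sc_def)

text \<open>Conjugation by \<open>X\<close> rescales the \<open>j\<close>-th term by \<open>q\<^sup>j\<close>, which separates the terms.\<close>

lemma qcommute_independent:
  assumes "qcommute q X Y" "X \<noteq> 0" "Y \<noteq> 0" "\<And>n. n > 0 \<Longrightarrow> q ^ n \<noteq> 1"
    and "(\<Sum>j\<le>n. sc (c j) (Y ^ j)) = 0"
  shows "j \<le> n \<Longrightarrow> c j = 0"
  using assms(5)
proof (induction n arbitrary: c j)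
  case 0
  then show ?case by simp
next
  case (Suc n)
  have q0: "q \<noteq> 0" using assms(1) by (simp add: qcommute_def)
  have "0 = X * (\<Sum>j\<le>Suc n. sc (c j) (Y ^ j)) - sc (q ^ Suc n) ((\<Sum>j\<le>Suc n. sc (c j) (Y ^ j)) * X)"
    using Suc.prems(2) by (simp add: sc_def)
  also have "\<dots> = (\<Sum>j\<le>Suc n. sc (c j * q ^ j - q ^ Suc n * c j) (Y ^ j)) * X"
  proof -
    have "X * (\<Sum>j\<le>Suc n. sc (c j) (Y ^ j)) = (\<Sum>j\<le>Suc n. sc (c j * q ^ j) (Y ^ j)) * X"
      using qcommuteD[OF qcommute_power_right[OF assms(1)]]
      by (simp add: sum_distrib_left sum_distrib_right del: sum.atMost_Suc)
    moreover have "sc (a - b) x = sc a x - sc b x" for a b x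
      using scalar_add[of "a - b" b] by (simp add: sc_def flip: left_diff_distrib)
    ultimately show ?thesis
      by (simp add: sc_sum sum_subtractf left_diff_distrib del: sum.atMost_Suc flip: sc_mult_left)
  qed
  finally have "(\<Sum>j\<le>Suc n. sc (c j * q ^ j - q ^ Suc n * c j) (Y ^ j)) = 0"
    using assms(2) by simp
  then have "(\<Sum>j\<le>n. sc (c j * q ^ j - q ^ Suc n * c j) (Y ^ j)) = 0"
    by (simp add: mult.commute sc_def scalar_zero)
  from Suc.IH[OF _ this] have "c j * q ^ j - q ^ Suc n * c j = 0" if "j \<le> n" for j
    using that by blast
  moreover have "q ^ j \<noteq> q ^ Suc n" if "j \<le> n" for j
  proof
    assume "q ^ j = q ^ Suc n"
    also have "\<dots> = q ^ j * q ^ (Suc n - j)" using that by (simp flip: power_add)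
    finally have "q ^ (Suc n - j) = 1" using q0 by simp
    then show False using assms(4)[of "Suc n - j"] that by simp
  qed
  ultimately have *: "c j = 0" if "j \<le> n" for j using that by fastforce
  then have "sc (c (Suc n)) (Y ^ Suc n) = 0" using Suc.prems(2) by (simp add: sc_def scalar_zero)
  then have "c (Suc n) = 0" using assms(3) by (simp del: power_Suc)
  then show ?case using * Suc.prems(1) by (cases "j = Suc n") auto
qed

lemma nc_eval_nonzero:
  assumes "qpair v X Y" "\<And>n. n > 0 \<Longrightarrow> v ^ n \<noteq> 1" "coeff P 0 = 1"
  shows "nc_eval \<iota> P (\<iota> v * Y) \<noteq> 0"
proof
  assume "nc_eval \<iota> P (\<iota> v * Y) = 0"
  then have *: "(\<Sum>j\<le>degree P. sc (coeff P j) ((sc v Y) ^ j)) = 0" by (simp only: nc_eval_sc)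
  have "coeff P 0 = 0"
  proof (rule qcommute_independent[OF _ _ _ _ *])
    show "qcommute (v\<^sup>2) X (sc v Y)" by (rule qcommute_sc_right[OF qpair_qcommute[OF assms(1)]])
    show "X \<noteq> 0" "sc v Y \<noteq> 0" using assms(1) by (auto simp: qpair_def)
    show "(v\<^sup>2) ^ n \<noteq> 1" if "n > 0" for n using assms(2)[of "2 * n"] that by (simp add: power_mult)
  qed simp
  then show False using assms(3) by simp
qed

definition next_var :: "'k \<Rightarrow> 'k poly \<Rightarrow> 'f \<Rightarrow> 'f \<Rightarrow> 'f" where
  "next_var v P X Y = inverse X * nc_eval \<iota> P (\<iota> v * Y)"

text \<open>The relation recurs with the same v, so the induction can restart from the next
  pair.\<close>

lemma qpair_next_var:
  assumes "qpair v X Y" "\<And>n. n > 0 \<Longrightarrow> v ^ n \<noteq> 1" "coeff P 0 = 1"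
  shows "qpair v Y (next_var v P X Y)"
proof -
  have *: "v \<noteq> 0" "X \<noteq> 0" "Y \<noteq> 0" "X * Y = sc (v\<^sup>2) (Y * X)" using assms(1) by (auto simp: qpair_def)
  note nz = nc_eval_nonzero[OF assms]
  have "qcommute (v\<^sup>2) Y (next_var v P X Y)"
    using qcommute_Y_Z[OF *(1) refl *(2-4) assms(3) nc_eval_sc _ next_var_def refl refl refl refl] nz
    by simp
  then show ?thesis using * nz by (simp add: qpair_def qcommute_def next_var_def)
qed

lemma cluster_var_rec:
  "k > 2 \<Longrightarrow> cluster_var v \<iota> X Y P1 P2 \<alpha> k =
    next_var v (exchange_poly P1 P2 (\<alpha> + (k - 1)))
      (cluster_var v \<iota> X Y P1 P2 \<alpha> (k - 2)) (cluster_var v \<iota> X Y P1 P2 \<alpha> (k - 1))"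
  by (subst cluster_var.simps) (simp add: next_var_def)

lemma cluster_var_base:
  "cluster_var v \<iota> X Y P1 P2 \<alpha> 1 = X" "cluster_var v \<iota> X Y P1 P2 \<alpha> 2 = Y"
  by (simp_all add: cluster_var.simps)

text \<open>The starting pair moves by one while \<alpha> stays 3, because the polynomials are
  rotated instead.\<close>

lemma cluster_var_shift:
  assumes "coeff P1 0 \<noteq> 0"
  shows "cluster_var v \<iota> X Y P1 P2 3 (int n + 2) =
    cluster_var v \<iota> Y (next_var v P1 X Y) P2 (reflect_poly P1) 3 (int n + 1)"
proof (induction n rule: less_induct)
  case (less n)
  consider "n = 0" | "n = 1" | m where "n = m + 2"
    by (metis One_nat_def add_2_eq_Suc' not0_implies_Suc)
  then show ?case
  proof cases
    case 2
    have "cluster_var v \<iota> X Y P1 P2 3 3 = next_var v (exchange_poly P1 P2 5) X Y"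
      using cluster_var_rec[of 3 v X Y P1 P2 3] by (simp add: cluster_var_base)
    then show ?thesis using 2 by (simp add: cluster_var_base exchange_poly_def)
  next
    case (3 m)
    have IH: "cluster_var v \<iota> X Y P1 P2 3 (int m + 2) =
        cluster_var v \<iota> Y (next_var v P1 X Y) P2 (reflect_poly P1) 3 (int m + 1)"
      "cluster_var v \<iota> X Y P1 P2 3 (int m + 3) =
        cluster_var v \<iota> Y (next_var v P1 X Y) P2 (reflect_poly P1) 3 (int m + 2)"
      using less.IH[of m] less.IH[of "m + 1"] 3 by (simp_all add: algebra_simps)
    have "exchange_poly P1 P2 (int m + 6) = exchange_poly P2 (reflect_poly P1) (int m + 5)"
      using exchange_poly_shift[OF assms, of P2 "int m + 5"] by (simp add: add.commute)
    then show ?thesis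
      using 3 IH cluster_var_rec[of "int m + 4" v X Y P1 P2 3]
        cluster_var_rec[of "int m + 3" v Y "next_var v P1 X Y" P2 "reflect_poly P1" 3]
      by (simp add: algebra_simps)
  qed (simp add: cluster_var_base)
qed

lemma qpair_cluster_var:
  assumes "qpair v X Y" "\<And>n. n > 0 \<Longrightarrow> v ^ n \<noteq> 1" "coeff P1 0 = 1" "coeff P2 0 = 1"
    "lead_coeff P1 = 1" "lead_coeff P2 = 1"
  shows "qpair v (cluster_var v \<iota> X Y P1 P2 3 (int n + 1)) (cluster_var v \<iota> X Y P1 P2 3 (int n + 2))"
  using assms(1,3-6)
proof (induction n arbitrary: X Y P1 P2)
  case (Suc n)
  have "qpair v Y (next_var v P1 X Y)" by (rule qpair_next_var) (use Suc.prems assms in auto)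
  from Suc.IH[OF this, of P2 "reflect_poly P1"] Suc.prems
  show ?case
    using cluster_var_shift[of P1 v X Y P2 n] cluster_var_shift[of P1 v X Y P2 "Suc n"]
    by (simp add: algebra_simps coeff_reflect_poly)
qed (simp add: cluster_var_base)

text \<open>The inverse stands on the right in the downward recursion and on the left in the upward
  one. Moving it across a j-th power costs v^(2j), which turns v^-j into v^j.\<close>

lemma cluster_var_reflect:
  assumes "qpair v X Y" "\<And>n. n > 0 \<Longrightarrow> v ^ n \<noteq> 1" "coeff P1 0 = 1" "coeff P2 0 = 1"
    "lead_coeff P1 = 1" "lead_coeff P2 = 1"
  shows "cluster_var v \<iota> X Y P1 P2 3 (2 - int n) =
    cluster_var (inverse v) \<iota> Y X (reflect_poly P2) (reflect_poly P1) 3 (int n + 1)"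
proof (induction n rule: less_induct)
  case (less n)
  consider "n = 0" | "n = 1" | m where "n = m + 2"
    by (metis One_nat_def add_2_eq_Suc' not0_implies_Suc)
  then show ?case
  proof cases
    case (3 m)
    let ?C = "cluster_var v \<iota> X Y P1 P2 3"
    let ?W = "cluster_var (inverse v) \<iota> Y X (reflect_poly P2) (reflect_poly P1) 3"
    have v0: "v \<noteq> 0" using assms by (simp add: qpair_def)
    have IH: "?C (2 - int m) = ?W (int m + 1)" "?C (1 - int m) = ?W (int m + 2)"
      using less.IH[of m] less.IH[of "m + 1"] 3 by (simp_all add: algebra_simps)
    have "qpair (inverse v) Y X"
      using assms(1) by (simp add: qpair_def power_inverse)
    moreover have "inverse v ^ n \<noteq> 1" if "n > 0" for n
      using assms(2)[OF that] by (simp add: power_inverse)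
    ultimately have pair: "qpair (inverse v) (?W (int m + 1)) (?W (int m + 2))"
      using assms by (intro qpair_cluster_var) (auto simp: coeff_reflect_poly)
    let ?A = "?W (int m + 1)" and ?B = "?W (int m + 2)"
    define P where "P = exchange_poly P1 P2 (4 - int m)"
    have P: "exchange_poly (reflect_poly P2) (reflect_poly P1) (int m + 5) = P"
      using exchange_poly_reflect[of P1 P2 "int m + 3"] assms by (simp add: P_def algebra_simps)
    have comm: "qcommute (v\<^sup>2) (inverse ?A) ?B"
      using qcommute_inverse_left[OF qpair_qcommute[OF pair]] by (simp add: power_inverse)
    have "inverse ?A * (sc (inverse v) ?B) ^ j = (sc v ?B) ^ j * inverse ?A" for j
    proof -
      have "qcommute ((v\<^sup>2) ^ j) (inverse ?A) (sc (inverse v) ?B ^ j)"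
        by (intro qcommute_power_right qcommute_sc_right comm)
      then have "inverse ?A * (sc (inverse v) ?B) ^ j = sc ((v\<^sup>2) ^ j * inverse v ^ j) (?B ^ j * inverse ?A)"
        by (simp only: qcommute_def sc_power sc_mult_left sc_sc)
      moreover have "(v\<^sup>2) ^ j * inverse v ^ j = v ^ j"
        using v0 by (simp add: power2_eq_square field_simps power_mult_distrib)
      ultimately show ?thesis by simp
    qed
    then have "next_var (inverse v) P ?A ?B = nc_eval \<iota> P (\<iota> v * ?B) * inverse ?A"
      by (simp add: next_var_def nc_eval_sc sum_distrib_left sum_distrib_right del: sc_power)
    moreover have "?C (- int m) = nc_eval \<iota> P (\<iota> v * ?C (1 - int m)) * inverse (?C (2 - int m))"
      by (subst cluster_var.simps) (simp add: P_def algebra_simps)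
    moreover have "?W (int m + 3) = next_var (inverse v) P ?A ?B"
      using cluster_var_rec[of "int m + 3" "inverse v" Y X "reflect_poly P2" "reflect_poly P1" 3]
      by (simp add: P algebra_simps)
    ultimately show ?thesis using 3 IH by (simp add: algebra_simps)
  qed (simp_all add: cluster_var_base)
qed

end

section \<open>Ordered products of torus monomials\<close>

lemma edges_partition: "hor_edges D \<union> ver_edges D = {..<length D}" "hor_edges D \<inter> ver_edges D = {}"
  by (auto simp: hor_edges_def ver_edges_def) (metis step.exhaust)

lemma finite_edges [simp]: "finite (hor_edges D)" "finite (ver_edges D)"
  by (simp_all add: hor_edges_def ver_edges_def)

lemma card_edges: "card (hor_edges D) = count_list D East" "card (ver_edges D) = count_list D North"
  by (auto simp: hor_edges_def ver_edges_def count_list_eq_length_filter length_filter_conv_card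
      intro!: arg_cong[of _ _ card])

lemma pair_sum_eq:
  "(\<Sum>(e, e')\<in>{(e, e'). e < n \<and> e' < n \<and> e < e'}. F e e') = (\<Sum>e'<n. \<Sum>e<e'. F e e')"
  for F :: "nat \<Rightarrow> nat \<Rightarrow> int"
proof -
  have "(\<Sum>e'<n. \<Sum>e<e'. F e e') = (\<Sum>(e', e)\<in>(SIGMA e':{..<n}. {..<e'}). F e e')"
    by (subst sum.Sigma) auto
  also have "\<dots> = (\<Sum>(e, e')\<in>{(e, e'). e < n \<and> e' < n \<and> e < e'}. F e e')"
    by (rule sum.reindex_bij_witness[of _ prod.swap prod.swap]) auto
  finally show ?thesis by simp
qed

lemma weights_eq_double_sum:
  assumes "H \<union> V = {..<n}"
  shows "gamma_weight H V \<omega> = (\<Sum>j<n. \<Sum>i<j. gamma_pair H V \<omega> i j)"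
    and "beta_weight H V \<omega> = (\<Sum>j<n. \<Sum>i<j. beta_pair H V \<omega> i j)"
  unfolding gamma_weight_def beta_weight_def assms lessThan_iff pair_sum_eq by (rule refl)+

definition symplectic :: "int \<times> int \<Rightarrow> int \<times> int \<Rightarrow> int" where
  "symplectic a b = fst a * snd b - snd a * fst b"

text \<open>A check of the four kinds of edge pairs. Interchanging the roles in \<gamma> reverses
  the sign of the form, as the passage from v to v^-1 requires.\<close>

lemma weight_eq_symplectic:
  assumes "\<And>i. vec i = edge_vector (D ! i, \<omega> i)"
  shows "gamma_weight (hor_edges D) (ver_edges D) \<omega> + beta_weight (hor_edges D) (ver_edges D) \<omega> =
      (\<Sum>j<length D. \<Sum>i<j. symplectic (vec i) (vec j))"
    and "gamma_weight (ver_edges D) (hor_edges D) \<omega> + beta_weight (hor_edges D) (ver_edges D) \<omega> =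
      - (\<Sum>j<length D. \<Sum>i<j. symplectic (vec i) (vec j))"
proof -
  have H: "e \<in> hor_edges D \<longleftrightarrow> D ! e = East" "e \<in> ver_edges D \<longleftrightarrow> D ! e = North" if "e < length D" for e
    using that by (auto simp: hor_edges_def ver_edges_def)
  have "gamma_pair (hor_edges D) (ver_edges D) \<omega> i j + beta_pair (hor_edges D) (ver_edges D) \<omega> i j =
      symplectic (vec i) (vec j)"
    "gamma_pair (ver_edges D) (hor_edges D) \<omega> i j + beta_pair (hor_edges D) (ver_edges D) \<omega> i j =
      - symplectic (vec i) (vec j)" if "i < j" "j < length D" for i j
    using that by (cases "D ! i"; cases "D ! j"; force simp: H gamma_pair_def beta_pair_def assms symplectic_def)+
  then have "(\<Sum>j<length D. \<Sum>i<j. gamma_pair (hor_edges D) (ver_edges D) \<omega> i j +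
        beta_pair (hor_edges D) (ver_edges D) \<omega> i j) =
      (\<Sum>j<length D. \<Sum>i<j. symplectic (vec i) (vec j))"
    "(\<Sum>j<length D. \<Sum>i<j. gamma_pair (ver_edges D) (hor_edges D) \<omega> i j +
        beta_pair (hor_edges D) (ver_edges D) \<omega> i j) =
      (\<Sum>j<length D. \<Sum>i<j. - symplectic (vec i) (vec j))"
    by (auto intro!: sum.cong)
  then show "gamma_weight (hor_edges D) (ver_edges D) \<omega> + beta_weight (hor_edges D) (ver_edges D) \<omega> =
      (\<Sum>j<length D. \<Sum>i<j. symplectic (vec i) (vec j))"
    "gamma_weight (ver_edges D) (hor_edges D) \<omega> + beta_weight (hor_edges D) (ver_edges D) \<omega> =
      - (\<Sum>j<length D. \<Sum>i<j. symplectic (vec i) (vec j))"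
    using weights_eq_double_sum[OF edges_partition(1)[of D]]
      weights_eq_double_sum(1)[of "ver_edges D" "hor_edges D" "length D"] edges_partition(1)[of D]
    by (simp_all add: Un_commute sum.distrib sum_negf)
qed

context central_scalars
begin

lemma qcommute_powi_right: "qcommute k a b \<Longrightarrow> qcommute (k powi n) a (b powi n)"
  using qcommute_power_right[of k a b "nat n"]
    qcommute_power_right[of "inverse k" a "inverse b" "nat (- n)"] qcommute_inverse_right[of k a b]
  by (cases "n \<ge> 0") (simp_all add: power_int_def)

lemma qcommute_powi:
  assumes "qcommute k a b"
  shows "qcommute (k powi (m * n)) (a powi m) (b powi n)"
proof -
  have "qcommute (k powi n) a (b powi n)" by (rule qcommute_powi_right[OF assms])
  from qcommute_sym[OF qcommute_powi_right[OF qcommute_sym[OF this], of m]]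
  moreover have "k powi (m * n) = (k powi n) powi m"
    by (metis mult.commute power_int_mult)
  ultimately show ?thesis
    by (simp add: power_int_inverse)
qed

lemma torus_monomial_mult:
  assumes "qpair v X Y"
  shows "torus_monomial v \<iota> X Y a * torus_monomial v \<iota> X Y b =
    sc (v powi symplectic a b) (torus_monomial v \<iota> X Y (a + b))"
proof -
  obtain a1 a2 b1 b2 where ab: "a = (a1, a2)" "b = (b1, b2)" by (cases a; cases b)
  have nz: "v \<noteq> 0" "X \<noteq> 0" "Y \<noteq> 0" using assms by (auto simp: qpair_def)
  have XY: "X powi b1 * Y powi a2 = sc (v powi (2 * (b1 * a2))) (Y powi a2 * X powi b1)"
    using qcommuteD[OF qcommute_powi[OF qpair_qcommute[OF assms], of b1 a2]]
    by (simp add: power_int_mult)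
  have "Y powi a2 * X powi b1 = sc (v powi (- (2 * (b1 * a2)))) (X powi b1 * Y powi a2)"
    unfolding XY using nz by (simp add: power_int_minus)
  then have YX: "Y powi a2 * (X powi b1 * z) = sc (v powi (- (2 * (b1 * a2)))) (X powi b1 * (Y powi a2 * z))" for z
    by (metis mult.assoc sc_mult_left)
  have tm: "torus_monomial v \<iota> X Y (c1, c2) = sc (v powi (- c1 * c2)) (X powi c1 * Y powi c2)" for c1 c2
    by (simp add: torus_monomial_def sc_def mult.assoc)
  have "torus_monomial v \<iota> X Y a * torus_monomial v \<iota> X Y b =
    sc (v powi (- a1 * a2) * v powi (- b1 * b2) * v powi (- (2 * (b1 * a2))))
      (X powi a1 * (X powi b1 * (Y powi a2 * Y powi b2)))"
    by (simp add: ab tm mult.assoc YX) (simp add: mult.left_commute)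
  also have "X powi a1 * (X powi b1 * (Y powi a2 * Y powi b2)) = X powi (a1 + b1) * Y powi (a2 + b2)"
    using nz by (simp add: power_int_add mult.assoc)
  also have "v powi (- a1 * a2) * v powi (- b1 * b2) * v powi (- (2 * (b1 * a2))) =
      v powi (symplectic a b) * v powi (- (a1 + b1) * (a2 + b2))"
  proof -
    have "- a1 * a2 + - b1 * b2 + - (2 * (b1 * a2)) = symplectic a b + - (a1 + b1) * (a2 + b2)"
      by (simp add: ab symplectic_def algebra_simps)
    then show ?thesis using nz by (simp only: power_int_add[symmetric] simp_thms)
  qed
  finally show ?thesis by (simp add: ab tm)
qed

lemma prod_list_torus_monomials:
  assumes "qpair v X Y"
  shows "prod_list (map (\<lambda>i. sc (c i) (torus_monomial v \<iota> X Y (w i))) [0..<n]) =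
    sc ((\<Prod>i<n. c i) * v powi (\<Sum>j<n. \<Sum>i<j. symplectic (w i) (w j)))
      (torus_monomial v \<iota> X Y (\<Sum>i<n. w i))"
proof (induction n)
  case 0
  then show ?case by (simp add: torus_monomial_def zero_prod_def scalar_one)
next
  case (Suc n)
  have v0: "v \<noteq> 0" using assms by (simp add: qpair_def)
  have lin: "symplectic (\<Sum>i<n. w i) x = (\<Sum>i<n. symplectic (w i) x)" for x
    by (simp add: symplectic_def fst_sum snd_sum sum_distrib_right sum_subtractf)
  show ?case
    using v0 by (simp add: Suc torus_monomial_mult[OF assms] lin power_int_add mult_ac)
qed

text \<open>Reordering costs v^(2ab), exactly the change of sign in the normalising exponent
  -ab.\<close>

lemma torus_monomial_swap:
  assumes "qpair v X Y"
  shows "torus_monomial (inverse v) \<iota> Y X (a, b) = torus_monomial v \<iota> X Y (b, a)"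
proof -
  have v0: "v \<noteq> 0" using assms by (simp add: qpair_def)
  have "X powi b * Y powi a = sc (v powi (2 * (b * a))) (Y powi a * X powi b)"
    using qcommuteD[OF qcommute_powi[OF qpair_qcommute[OF assms], of b a]]
    by (simp add: power_int_mult)
  then have "torus_monomial v \<iota> X Y (b, a) =
      sc (v powi (- b * a) * v powi (2 * (b * a))) (Y powi a * X powi b)"
    by (simp add: torus_monomial_def mult.assoc flip: sc_def)
  also have "v powi (- b * a) * v powi (2 * (b * a)) = inverse v powi (- a * b)"
  proof -
    have "- b * a + 2 * (b * a) = a * b" by (simp add: algebra_simps)
    then have "v powi (- b * a) * v powi (2 * (b * a)) = v powi (a * b)"
      using v0 by (simp only: power_int_add[symmetric] simp_thms)
    then show ?thesis by (simp add: power_int_inverse power_int_minus)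
  qed
  finally show ?thesis
    by (simp add: torus_monomial_def mult.assoc flip: sc_def)
qed

end

section \<open>Induction over the cluster variables and the expansion formulas\<close>

lemma not_algebraic_root_of_unity:
  assumes "\<not> algebraic (v :: 'k :: field_char_0)"
  shows "v \<noteq> 0" "n > 0 \<Longrightarrow> v ^ n \<noteq> 1"
proof -
  show "v \<noteq> 0" using assms by auto
  show "v ^ n \<noteq> 1" if "n > 0"
  proof
    assume "v ^ n = 1"
    then have "poly (monom 1 n - 1) v = 0" by (simp add: poly_monom)
    moreover have "coeff (monom 1 n - 1 :: 'k poly) i \<in> \<int>" for i
      by (auto simp: coeff_monom simp flip: one_pCons split: if_splits)
    moreover have "coeff (monom 1 n - 1 :: 'k poly) n = 1" using that by simp
    then have "monom 1 n - 1 \<noteq> (0 :: 'k poly)" by (metis coeff_0 zero_neq_one)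
    ultimately show False using assms unfolding algebraic_def by blast
  qed
qed

lemma quantum_torus_pair:
  assumes "quantum_torus_fractions v \<iota> Z1 Z2" and v0: "v \<noteq> 0"
  shows "central_scalars \<iota>" and "central_scalars.qpair \<iota> v Z1 Z2"
proof -
  interpret quantum_torus_fractions v \<iota> Z1 Z2 by (rule assms(1))
  show cs: "central_scalars \<iota>"
    by unfold_locales (rule scalar_one scalar_add scalar_mult scalar_central)+
  then interpret central_scalars \<iota> .
  have eval: "prod_list (map (letter_value Z1 Z2) l) = \<iota> c * prod_list (map (letter_value Z1 Z2) r)"
    if lrc: "(l, r, c) \<in> torus_relations v" "l \<noteq> r" "c \<noteq> 0" for l r c
  proof -
    let ?f = "Poly_Mapping.single l 1 - Poly_Mapping.single r c"
    have "?f \<in> torus_ideal v"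
      using torus_ideal.rel[OF lrc(1), of "[]" "[]" 1] by simp
    then have "free_eval \<iota> Z1 Z2 ?f = 0" by (simp add: presentation)
    moreover have "Poly_Mapping.keys ?f = {l, r}"
      using lrc by (auto simp: in_keys_iff lookup_minus lookup_single when_def split: if_splits)
    moreover have "\<iota> (- c) = - \<iota> c"
      using scalar_add[of c "- c"] scalar_zero by (simp add: eq_neg_iff_add_eq_0 add.commute)
    ultimately show ?thesis
      using lrc by (simp add: free_eval_def lookup_minus lookup_single when_def scalar_one)
  qed
  \<comment> \<open>As the inverse of 0 is 0, this also shows that both generators are
    nonzero.\<close>
  have "Z1 * inverse Z1 = 1" "Z2 * inverse Z2 = 1"
    using eval[of "[X1, X1i]" "[]" 1] eval[of "[X2, X2i]" "[]" 1]
    by (simp_all add: torus_relations_def scalar_one)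
  moreover have "Z1 * Z2 = \<iota> (v\<^sup>2) * (Z2 * Z1)"
    using eval[of "[X1, X2]" "[X2, X1]" "v\<^sup>2"] v0 by (simp add: torus_relations_def)
  ultimately show "qpair v Z1 Z2"
    using v0 by (auto simp: qpair_def sc_def)
qed

context central_scalars
begin

lemma path_sum_cong:
  assumes "\<And>n. n \<le> b1 \<Longrightarrow> f n = f' n" "\<And>n. n \<le> b2 \<Longrightarrow> g n = g' n"
  shows "path_sum v X Y f g b1 b2 D = path_sum v X Y f' g' b1 b2 D"
  unfolding path_sum_def
proof (intro sum.cong refl arg_cong[of _ _ prod_list] map_cong)
  fix ws z assume "ws \<in> accepted (\<lambda>s. case s of East \<Rightarrow> b1 | North \<Rightarrow> b2) [] D" "z \<in> set (zip D ws)"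
  then have "snd z \<le> (case fst z of East \<Rightarrow> b1 | North \<Rightarrow> b2)"
    by (auto simp: accepted_def list_all2_iff)
  then show "edge_weight v X Y f g z = edge_weight v X Y f' g' z"
    using assms by (cases z; cases "fst z") (auto simp: edge_weight_def)
qed

text \<open>Passing to the next pair lowers n by one, and the Chebyshev recursion becomes the
  relation \<open>a + a2 = degree P2 * a1\<close> that links the two Dyck paths.\<close>

lemma cluster_var_eq_path_sum:
  assumes "qpair v X Y" "\<And>n. n > 0 \<Longrightarrow> v ^ n \<noteq> 1" "coeff P1 0 = 1" "coeff P2 0 = 1"
    "lead_coeff P1 = 1" "lead_coeff P2 = 1" "degree P1 * degree P2 \<ge> 4"
  shows "cluster_var v \<iota> X Y P1 P2 3 (int n + 3) =
    sc v (path_sum v X Y (coeff P1) (\<lambda>j. coeff P2 (degree P2 - j)) (degree P1) (degree P2)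
      (dyck_path (nat (cheb (degree P1) (degree P2) (int (n + 1)) 1))
        (nat (cheb (degree P2) (degree P1) (int n) 1))))"
  using assms(1,3-7)
proof (induction n arbitrary: X Y P1 P2)
  case 0
  have "v \<noteq> 0" using 0 by (simp add: qpair_def)
  have "dyck_path 1 0 = [East]"
    by (simp add: dyck_path_columns column_heights_def)
  moreover have "path_sum v X Y (coeff P1) (\<lambda>j. coeff P2 (degree P2 - j)) (degree P1) (degree P2) [East] =
      (\<Sum>a\<le>degree P1. edge_weight v X Y (coeff P1) (\<lambda>j. coeff P2 (degree P2 - j)) (East, a))"
    by (simp add: path_sum_def sum_accepted_Cons)
  moreover have "cluster_var v \<iota> X Y P1 P2 3 3 = next_var v P1 X Y"
    using cluster_var_rec[of 3 v X Y P1 P2 3] by (simp add: cluster_var_base exchange_poly_def)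
  ultimately show ?case
    using \<open>v \<noteq> 0\<close>
    by (simp add: next_var_def nc_eval_sc edge_weight_def torus_monomial_West sc_sum sum_distrib_left
        flip: mult.assoc)
next
  case (Suc n)
  let ?d1 = "degree P1" and ?d2 = "degree P2"
  have nz: "nc_eval \<iota> P1 (\<iota> v * Y) \<noteq> 0"
    by (rule nc_eval_nonzero) (use Suc.prems assms(2) in auto)
  have pair: "v \<noteq> 0" "X \<noteq> 0" "Y \<noteq> 0" "X * Y = sc (v\<^sup>2) (Y * X)"
    using Suc.prems by (auto simp: qpair_def)
  have deg: "degree (reflect_poly P1) = ?d1" using Suc.prems by simp
  define a1 where "a1 = nat (cheb ?d2 ?d1 (int (n + 1)) 1)"
  define a2 where "a2 = nat (cheb ?d1 ?d2 (int n) 1)"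
  define a where "a = nat (cheb ?d1 ?d2 (int (n + 2)) 1)"
  have g1: "cheb ?d1 ?d2 (int (n + 2)) 1 > 0" "cheb ?d2 ?d1 (int (n + 1)) 1 > 0"
    "cheb ?d1 ?d2 (int n) 1 \<ge> 0"
    using cheb_growth[of ?d1 ?d2 "n + 1"] cheb_growth[of ?d1 ?d2 n] cheb_growth[of ?d2 ?d1 n] Suc.prems
    by (simp_all add: mult.commute)
  have "int (a + a2) = int (?d2 * a1)"
    using g1 cheb_rec_1[of ?d1 ?d2 n] by (simp add: a_def a1_def a2_def)
  then have sum: "a + a2 = ?d2 * a1" by (simp only: of_nat_eq_iff)
  have pos: "a > 0" "a1 > 0" using g1 by (simp_all add: a_def a1_def)
  note rows = dyck_path_rows[OF pos(2,1) sum]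
  have "cluster_var v \<iota> X Y P1 P2 3 (int (Suc n) + 3) =
      cluster_var v \<iota> Y (next_var v P1 X Y) P2 (reflect_poly P1) 3 (int n + 3)"
    using cluster_var_shift[of P1 v X Y P2 "n + 2"] Suc.prems by (simp add: algebra_simps)
  also have "\<dots> = sc v (path_sum v Y (next_var v P1 X Y) (coeff P2)
      (\<lambda>j. coeff (reflect_poly P1) (?d1 - j)) ?d2 ?d1 (dyck_path a1 a2))"
    using Suc.IH[of Y "next_var v P1 X Y" P2 "reflect_poly P1"] Suc.prems
      qpair_next_var[OF Suc.prems(1) assms(2) Suc.prems(2)]
    by (simp add: a1_def a2_def coeff_reflect_poly mult.commute)
  \<comment> \<open>Vertical edges read coefficients backwards, which undoes the reflection of
    P1.\<close>
  also have "path_sum v Y (next_var v P1 X Y) (coeff P2)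
      (\<lambda>j. coeff (reflect_poly P1) (?d1 - j)) ?d2 ?d1 (dyck_path a1 a2) =
    path_sum v Y (next_var v P1 X Y) (coeff P2) (coeff P1) ?d2 ?d1 (dyck_path a1 a2)"
    by (rule path_sum_cong) (auto simp: coeff_reflect_poly)
  also have "\<dots> = path_sum v X Y (coeff P1) (\<lambda>j. coeff P2 (?d2 - j)) ?d1 ?d2 (dyck_path a a1)"
    unfolding rows(2) dyck_path_columns(1)[OF pos(2)]
    by (rule path_sum_step[OF pair(1) refl pair(2-4) Suc.prems(2) nc_eval_sc nz next_var_def
          refl refl refl refl rows(1), symmetric])
  finally show ?case by (simp add: a_def a1_def add.commute)
qed

lemma path_sum_eq_sum_gradings:
  assumes "qpair v X Y"
  shows "sc v (path_sum v X Y f g b1 b2 D) =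
    (\<Sum>\<omega>\<in>compatible_gradings b1 b2 D.
       sc ((\<Prod>h\<in>hor_edges D. f (\<omega> h)) * (\<Prod>w\<in>ver_edges D. g (\<omega> w)))
        (sc (v powi (1 - int (length D) + (\<Sum>j<length D. \<Sum>i<j.
            symplectic (edge_vector (D ! i, \<omega> i)) (edge_vector (D ! j, \<omega> j)))))
          (torus_monomial v \<iota> X Y
            (- int (card (hor_edges D)) + int (\<Sum>w\<in>ver_edges D. \<omega> w),
             - int (card (ver_edges D)) + int (\<Sum>h\<in>hor_edges D. \<omega> h)))))"
proof -
  have v0: "v \<noteq> 0" using assms by (simp add: qpair_def)
  have split: "prod F {..<length D} = prod F (hor_edges D) * prod F (ver_edges D)" for F :: "nat \<Rightarrow> 'k"
    using prod.union_disjoint[of "hor_edges D" "ver_edges D" F] edges_partition[of D] by simp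
  have split_sum: "sum F {..<length D} = sum F (hor_edges D) + sum F (ver_edges D)" for F :: "nat \<Rightarrow> int \<times> int"
    using sum.union_disjoint[of "hor_edges D" "ver_edges D" F] edges_partition[of D] by simp
  have summand: "sc v (prod_list (map (edge_weight v X Y f g) (zip D (map \<omega> [0..<length D])))) =
     sc ((\<Prod>h\<in>hor_edges D. f (\<omega> h)) * (\<Prod>w\<in>ver_edges D. g (\<omega> w)))
        (sc (v powi (1 - int (length D) + (\<Sum>j<length D. \<Sum>i<j.
            symplectic (edge_vector (D ! i, \<omega> i)) (edge_vector (D ! j, \<omega> j)))))
          (torus_monomial v \<iota> X Y
            (- int (card (hor_edges D)) + int (\<Sum>w\<in>ver_edges D. \<omega> w),
             - int (card (ver_edges D)) + int (\<Sum>h\<in>hor_edges D. \<omega> h))))" for \<omega>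
  proof -
    let ?z = "\<lambda>i. (D ! i, \<omega> i)"
    let ?L = "\<Sum>j<length D. \<Sum>i<j. symplectic (edge_vector (?z i)) (edge_vector (?z j))"
    have "zip D (map \<omega> [0..<length D]) = map ?z [0..<length D]"
      by (rule nth_equalityI) auto
    then have "prod_list (map (edge_weight v X Y f g) (zip D (map \<omega> [0..<length D]))) =
      prod_list (map (\<lambda>i. sc (inverse v * edge_coeff f g (?z i))
        (torus_monomial v \<iota> X Y (edge_vector (?z i)))) [0..<length D])"
      by (simp add: o_def edge_weight_def)
    also have "\<dots> = sc ((\<Prod>i<length D. inverse v * edge_coeff f g (?z i)) * v powi ?L)
        (torus_monomial v \<iota> X Y (\<Sum>i<length D. edge_vector (?z i)))"
      by (rule prod_list_torus_monomials[OF assms])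
    also have "(\<Prod>i<length D. inverse v * edge_coeff f g (?z i)) =
      inverse v ^ length D * ((\<Prod>h\<in>hor_edges D. f (\<omega> h)) * (\<Prod>w\<in>ver_edges D. g (\<omega> w)))"
      by (simp add: prod.distrib split) (simp add: hor_edges_def ver_edges_def)
    also have "(\<Sum>i<length D. edge_vector (?z i)) =
        (- int (card (hor_edges D)) + int (\<Sum>w\<in>ver_edges D. \<omega> w),
         - int (card (ver_edges D)) + int (\<Sum>h\<in>hor_edges D. \<omega> h))"
    proof -
      have "(\<Sum>i\<in>hor_edges D. edge_vector (?z i)) = (\<Sum>i\<in>hor_edges D. (- 1, int (\<omega> i)))"
        "(\<Sum>i\<in>ver_edges D. edge_vector (?z i)) = (\<Sum>i\<in>ver_edges D. (int (\<omega> i), - 1))"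
        by (auto simp: hor_edges_def ver_edges_def intro!: sum.cong)
      then show ?thesis
        by (simp add: split_sum prod_eq_iff fst_sum snd_sum)
    qed
    finally show ?thesis
      using v0 by (simp add: power_int_add power_int_diff power_inverse field_simps)
  qed
  have "sc v (path_sum v X Y f g b1 b2 D) =
    (\<Sum>ws\<in>accepted (\<lambda>s. case s of East \<Rightarrow> b1 | North \<Rightarrow> b2) [] D.
      sc v (prod_list (map (edge_weight v X Y f g) (zip D ws))))"
    by (simp add: path_sum_def sc_sum)
  then show ?thesis unfolding sum_compatible_gradings[symmetric] summand .
qed

end

theorem corollary5p4:
  fixes v :: "'k::field_char_0"
    and \<iota> :: "'k \<Rightarrow> 'f::division_ring"
    and Z1 Z2 :: 'f
    and P1 P2 :: "'k poly"
    and d1 d2 :: nat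
  assumes "\<not> algebraic v"
    and "quantum_torus_fractions v \<iota> Z1 Z2"
    and "lead_coeff P1 = 1" and "degree P1 = d1" and "poly P1 0 = 1"
    and "lead_coeff P2 = 1" and "degree P2 = d2" and "poly P2 0 = 1"
    and "d1 * d2 \<ge> 4"
  shows
    "(\<forall>m\<ge>3.
        cluster_var v \<iota> Z1 Z2 P1 P2 3 m =
        (let u = cheb d1 d2;
             D = dyck_path (nat (u (m - 2) 1)) (nat (u (m - 3) 2));
             H = hor_edges D;
             V = ver_edges D
         in \<Sum>\<omega>\<in>compatible_gradings d1 d2 D.
              \<iota> ((\<Prod>h\<in>H. coeff P1 (\<omega> h)) * (\<Prod>w\<in>V. coeff P2 (d2 - \<omega> w))) *
              \<iota> (v powi (1 - u (m - 2) 1 - u (m - 3) 2 + gamma_weight H V \<omega> + beta_weight H V \<omega>)) *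
              torus_monomial v \<iota> Z1 Z2
                (- u (m - 2) 1 + int (\<Sum>w\<in>V. \<omega> w), - u (m - 3) 2 + int (\<Sum>h\<in>H. \<omega> h))))
     \<and>
     (\<forall>m\<le>0.
        cluster_var v \<iota> Z1 Z2 P1 P2 3 m =
        (let u' = cheb' d1 d2;
             D' = dyck_path (nat (u' (- m + 1) 1)) (nat (u' (- m) 2));
             H' = hor_edges D';
             V' = ver_edges D'
         in \<Sum>\<omega>\<in>compatible_gradings d2 d1 D'.
              \<iota> ((\<Prod>h\<in>H'. coeff P2 (d2 - \<omega> h)) * (\<Prod>w\<in>V'. coeff P1 (\<omega> w))) *
              \<iota> (v powi (- 1 + u' (- m + 1) 1 + u' (- m) 2 + gamma_weight V' H' \<omega> + beta_weight H' V' \<omega>)) *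
              torus_monomial v \<iota> Z1 Z2
                (- u' (- m) 2 + int (\<Sum>h\<in>H'. \<omega> h), - u' (- m + 1) 1 + int (\<Sum>w\<in>V'. \<omega> w))))"
proof -
  note v = not_algebraic_root_of_unity[OF assms(1)]
  interpret central_scalars \<iota> by (rule quantum_torus_pair(1)[OF assms(2) v(1)])
  have pair: "qpair v Z1 Z2" by (rule quantum_torus_pair(2)[OF assms(2) v(1)])
  have c: "coeff P1 0 = 1" "coeff P2 0 = 1" using assms by (simp_all add: poly_0_coeff_0)
  have pos: "cheb e1 e2 (int (n + 1)) 1 > 0" "cheb e1 e2 (int n) 1 \<ge> 0" if "e1 * e2 \<ge> 4" for e1 e2 n
    using cheb_growth[OF that, of n] by auto
  have edges: "int (card (hor_edges D)) = a1" "int (card (ver_edges D)) = a2"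
    "int (length D) = a1 + a2" if "D = dyck_path (nat a1) (nat a2)" "a1 > 0" "a2 \<ge> 0" for D a1 a2
    using dyck_path_columns(2,3)[of "nat a1" "nat a2"] that
    by (simp_all add: card_edges length_eq_count_steps)
  have "cluster_var v \<iota> Z1 Z2 P1 P2 3 m =
        (\<Sum>\<omega>\<in>compatible_gradings d1 d2 D.
              \<iota> ((\<Prod>h\<in>hor_edges D. coeff P1 (\<omega> h)) * (\<Prod>w\<in>ver_edges D. coeff P2 (d2 - \<omega> w))) *
              \<iota> (v powi (1 - a1 - a2 + gamma_weight (hor_edges D) (ver_edges D) \<omega> +
                beta_weight (hor_edges D) (ver_edges D) \<omega>)) *
              torus_monomial v \<iota> Z1 Z2
                (- a1 + int (\<Sum>w\<in>ver_edges D. \<omega> w), - a2 + int (\<Sum>h\<in>hor_edges D. \<omega> h)))"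
    if m: "m \<ge> 3" and a: "a1 = cheb d1 d2 (m - 2) 1" "a2 = cheb d1 d2 (m - 3) 2"
      and D: "D = dyck_path (nat a1) (nat a2)" for m a1 a2 D
  proof -
    define n where "n = nat (m - 3)"
    have n: "m = int n + 3" using m by (simp add: n_def)
    have a': "a1 = cheb d1 d2 (int (n + 1)) 1" "a2 = cheb d2 d1 (int n) 1"
      using a cheb_swap[of d1 d2 "int n" 1] by (simp_all add: n add.commute)
    have "a1 > 0" "a2 \<ge> 0" using pos assms(9) unfolding a' by (simp_all add: mult.commute)
    note e = edges[OF D this]
    have "cluster_var v \<iota> Z1 Z2 P1 P2 3 m =
      sc v (path_sum v Z1 Z2 (coeff P1) (\<lambda>j. coeff P2 (d2 - j)) d1 d2 D)"
      using cluster_var_eq_path_sum[OF pair v(2) c assms(3,6), of n] assms(4,7,9)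
      by (simp add: n D a')
    then show ?thesis
      unfolding path_sum_eq_sum_gradings[OF pair] e
    proof (simp only:, intro sum.cong refl)
      fix \<omega>
      let ?L = "\<Sum>j<length D. \<Sum>i<j. symplectic (edge_vector (D ! i, \<omega> i)) (edge_vector (D ! j, \<omega> j))"
      have w: "1 - (a1 + a2) + ?L = 1 - a1 - a2 + gamma_weight (hor_edges D) (ver_edges D) \<omega> +
          beta_weight (hor_edges D) (ver_edges D) \<omega>"
        using weight_eq_symplectic(1)[of "\<lambda>i. edge_vector (D ! i, \<omega> i)" D \<omega>] by simp
      show "sc ((\<Prod>h\<in>hor_edges D. coeff P1 (\<omega> h)) * (\<Prod>w\<in>ver_edges D. coeff P2 (d2 - \<omega> w)))
         (sc (v powi (1 - (a1 + a2) + ?L)) (torus_monomial v \<iota> Z1 Z2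
            (- a1 + int (\<Sum>w\<in>ver_edges D. \<omega> w), - a2 + int (\<Sum>h\<in>hor_edges D. \<omega> h)))) =
        \<iota> ((\<Prod>h\<in>hor_edges D. coeff P1 (\<omega> h)) * (\<Prod>w\<in>ver_edges D. coeff P2 (d2 - \<omega> w))) *
         \<iota> (v powi (1 - a1 - a2 + gamma_weight (hor_edges D) (ver_edges D) \<omega> +
            beta_weight (hor_edges D) (ver_edges D) \<omega>)) *
         torus_monomial v \<iota> Z1 Z2
            (- a1 + int (\<Sum>w\<in>ver_edges D. \<omega> w), - a2 + int (\<Sum>h\<in>hor_edges D. \<omega> h))"
        unfolding w by (simp only: sc_def mult.assoc)
    qed
  qed
  moreover have "cluster_var v \<iota> Z1 Z2 P1 P2 3 m =
        (\<Sum>\<omega>\<in>compatible_gradings d2 d1 D.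
              \<iota> ((\<Prod>h\<in>hor_edges D. coeff P2 (d2 - \<omega> h)) * (\<Prod>w\<in>ver_edges D. coeff P1 (\<omega> w))) *
              \<iota> (v powi (- 1 + a1 + a2 + gamma_weight (ver_edges D) (hor_edges D) \<omega> +
                beta_weight (hor_edges D) (ver_edges D) \<omega>)) *
              torus_monomial v \<iota> Z1 Z2
                (- a2 + int (\<Sum>h\<in>hor_edges D. \<omega> h), - a1 + int (\<Sum>w\<in>ver_edges D. \<omega> w)))"
    if m: "m \<le> 0" and a: "a1 = cheb' d1 d2 (- m + 1) 1" "a2 = cheb' d1 d2 (- m) 2"
      and D: "D = dyck_path (nat a1) (nat a2)" for m a1 a2 D
  proof -
    define n where "n = nat (- m)"
    have n: "m = - int n" using m by (simp add: n_def)
    have a': "a1 = cheb d2 d1 (int (n + 1)) 1" "a2 = cheb d1 d2 (int n) 1"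
      using a cheb_swap[of d1 d2 "int (n + 1)" 1] by (simp_all add: n cheb'_def add.commute)
    have "a1 > 0" "a2 \<ge> 0" using pos assms(9) unfolding a' by (simp_all add: mult.commute)
    note e = edges[OF D this]
    have pair': "qpair (inverse v) Z2 Z1" using pair by (simp add: qpair_def power_inverse)
    have v': "inverse v ^ n \<noteq> 1" if "n > 0" for n
      using v(2)[OF that] by (simp add: power_inverse)
    have lead: "lead_coeff (reflect_poly P1) = 1" "lead_coeff (reflect_poly P2) = 1"
      "coeff (reflect_poly P1) 0 = 1" "coeff (reflect_poly P2) 0 = 1"
      "degree (reflect_poly P1) = d1" "degree (reflect_poly P2) = d2"
      using c assms by (simp_all add: coeff_reflect_poly)
    \<comment> \<open>m = 2 - (n + 2) is reflected to 3 - m = n + 3.\<close>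
    have "cluster_var v \<iota> Z1 Z2 P1 P2 3 m =
        cluster_var (inverse v) \<iota> Z2 Z1 (reflect_poly P2) (reflect_poly P1) 3 (int n + 3)"
      using cluster_var_reflect[OF pair v(2) c assms(3,6), of "n + 2"] by (simp add: n algebra_simps)
    also have "\<dots> = sc (inverse v) (path_sum (inverse v) Z2 Z1 (coeff (reflect_poly P2))
        (\<lambda>j. coeff (reflect_poly P1) (d1 - j)) d2 d1 D)"
      using cluster_var_eq_path_sum[OF pair' v' lead(4,3,2,1), of n] lead(5,6) assms(9)
      by (simp add: D a' mult.commute)
    also have "path_sum (inverse v) Z2 Z1 (coeff (reflect_poly P2))
        (\<lambda>j. coeff (reflect_poly P1) (d1 - j)) d2 d1 D =
      path_sum (inverse v) Z2 Z1 (\<lambda>j. coeff P2 (d2 - j)) (coeff P1) d2 d1 D"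
      by (rule path_sum_cong) (use assms in \<open>auto simp: coeff_reflect_poly\<close>)
    finally show ?thesis
      unfolding path_sum_eq_sum_gradings[OF pair'] e torus_monomial_swap[OF pair]
    proof (simp only:, intro sum.cong refl)
      fix \<omega>
      let ?L = "\<Sum>j<length D. \<Sum>i<j. symplectic (edge_vector (D ! i, \<omega> i)) (edge_vector (D ! j, \<omega> j))"
      have "inverse v powi (1 - (a1 + a2) + ?L) = v powi (- (1 - (a1 + a2) + ?L))"
        by (simp only: power_int_inverse power_int_minus)
      also have "- (1 - (a1 + a2) + ?L) = - 1 + a1 + a2 + gamma_weight (ver_edges D) (hor_edges D) \<omega> +
          beta_weight (hor_edges D) (ver_edges D) \<omega>"
        using weight_eq_symplectic(2)[of "\<lambda>i. edge_vector (D ! i, \<omega> i)" D \<omega>] by simp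
      finally have w: "inverse v powi (1 - (a1 + a2) + ?L) = v powi (- 1 + a1 + a2 +
          gamma_weight (ver_edges D) (hor_edges D) \<omega> + beta_weight (hor_edges D) (ver_edges D) \<omega>)" .
      show "sc ((\<Prod>h\<in>hor_edges D. coeff P2 (d2 - \<omega> h)) * (\<Prod>w\<in>ver_edges D. coeff P1 (\<omega> w)))
         (sc (inverse v powi (1 - (a1 + a2) + ?L)) (torus_monomial v \<iota> Z1 Z2
            (- a2 + int (\<Sum>h\<in>hor_edges D. \<omega> h), - a1 + int (\<Sum>w\<in>ver_edges D. \<omega> w)))) =
        \<iota> ((\<Prod>h\<in>hor_edges D. coeff P2 (d2 - \<omega> h)) * (\<Prod>w\<in>ver_edges D. coeff P1 (\<omega> w))) *
         \<iota> (v powi (- 1 + a1 + a2 + gamma_weight (ver_edges D) (hor_edges D) \<omega> +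
            beta_weight (hor_edges D) (ver_edges D) \<omega>)) *
         torus_monomial v \<iota> Z1 Z2
            (- a2 + int (\<Sum>h\<in>hor_edges D. \<omega> h), - a1 + int (\<Sum>w\<in>ver_edges D. \<omega> w))"
        unfolding w by (simp only: sc_def mult.assoc)
    qed
  qed
  ultimately show ?thesis unfolding Let_def by blast
qed

end
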